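(* (a) For every $0<r<\infty$ there exists a constant $c_r$ such that, for all $j$, $$\|P_{j1}\|_\infty\le c_r r^{-j},$$ or more precisely $$\lim_{j\to\infty}\frac1j\log\|P_{j1}\|_\infty=-\infty .$$ (b) There exists a constant $c$ such that, for all $j$, $$\|P_{j2}\|_\infty\le c\,\lambda_2^{-j},$$ and $$\lim_{j\to\infty}(-\lambda_2)^jP_{j2}=\varphi,$$ where $\varphi$ is a $\lambda_2$-Neumann eigenfunction of $\Delta$ (in particular $\varphi\not\equiv 0$, $-\Delta\varphi=\lambda_2\varphi$) which is symmetric under $\rho_0$ and vanishes on $F_0(SG)$, the limit existing uniformly and in energy.
   Context: Let $q_0,q_1,q_2$ be the vertices of an equilateral triangle in the plane (indices mod 3), $F_i(x)=\frac12(x+q_i)$, and let $SG$ (Sierpinski gasket) be the unique nonempty compact set with $SG=\bigcup_{i=0}^2F_i(SG)$. For a word $w=(w_1,\dots,w_m)\in\{0,1,2\}^m$, $|w|=m$, put $F_w=F_{w_1}\circ\cdots\circ F_{w_m}$. $V_0=\{q_0,q_1,q_2\}$, $V_m=\bigcup_iF_i(V_{m-1})$, $V_*=\bigcup_mV_m$; for distinct $x,y\in V_m$, $x\sim_my$ means $x,y$ lie in a common set $F_w(SG)$ with $|w|=m$. Laplacian: $u\in\mathrm{dom}\,\Delta$ with $\Delta u=f$ means that $u,f$ are continuous on $SG$ and $\frac32 5^m\sum_{y\sim_mx}(u(y)-u(x))\to f(x)$ as $m\to\infty$, uniformly for $x\in V_*\setminus V_0$. Powers $\Delta^n$ and $\mathrm{dom}\,\Delta^n$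 are defined iteratively. Normal derivative: $\partial_nu(q_j)=\lim_{m\to\infty}(5/3)^m\big(2u(q_j)-u(F_j^mq_{j+1})-u(F_j^mq_{j-1})\big)$. Tangential derivative: $\partial_Tu(q_j)=\lim_{m\to\infty}5^m\big(u(F_j^mq_{j+1})-u(F_j^mq_{j-1})\big)$. $\mathcal H_j$ is the $(3j+3)$-dimensional space of solutions of $\Delta^{j+1}u=0$ on $SG$. The monomial $P_{jk}=P^{(0)}_{jk}$ ($k=1,2,3$, $j\ge0$) is the unique function in $\mathcal H_j$ such that for all $0\le m\le j$: $\Delta^mP_{jk}(q_0)=\delta_{mj}\delta_{k1}$, $\partial_n\Delta^mP_{jk}(q_0)=\delta_{mj}\delta_{k2}$, $\partial_T\Delta^mP_{jk}(q_0)=\delta_{mj}\delta_{k3}$. A $\lambda$-Neumann eigenfunction is a nonzero $u\in\mathrm{dom}\,\Delta$ with $-\Delta u=\lambda u$ and $\partial_nu(q_i)=0$ for $i=0,1,2$. $\lambda_2\approx135.572126995788$ denotes the second nonzero Neumann eigenvalue (distinct eigenvalues listed in increasing order, not counting multiplicity). $\rho_0$ is the reflection of $SG$ fixing $q_0$ and interchanging $q_1,q_2$. The energy is $\mathcal E(u,u)=\lim_{m\to\infty}(5/3)^m\sum_{x\sim_my}(u(x)-u(y))^2$; convergence in energy means $\mathcal E(u_j-u,u_j-u)\to0$. *)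

theory Defs
  imports "HOL-Analysis.Analysis"
begin

text \<open>
  The vertices of the triangle are indexed by the numeral type \<open>3\<close>, whose arithmetic is
  arithmetic modulo 3. Functions on the gasket are total functions on the plane of which only
  the values on the gasket matter; where a function on the gasket is defined by a unique
  description, it is extended by 0.
\<close>

definition equilateral :: "(3 \<Rightarrow> real^2) \<Rightarrow> bool" where
  "equilateral q \<longleftrightarrow> (\<exists>s>0. \<forall>i j. i \<noteq> j \<longrightarrow> dist (q i) (q j) = s)"

definition sg_map :: "(3 \<Rightarrow> real^2) \<Rightarrow> 3 \<Rightarrow> real^2 \<Rightarrow> real^2" where
  "sg_map q i x = (1/2) *\<^sub>R (x + q i)"

definition SG :: "(3 \<Rightarrow> real^2) \<Rightarrow> (real^2) set" where
  "SG q = (THE K. K \<noteq> {} \<and> compact K \<and> K = (\<Union>i. sg_map q i ` K))"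

definition sg_word_map :: "(3 \<Rightarrow> real^2) \<Rightarrow> 3 list \<Rightarrow> real^2 \<Rightarrow> real^2" where
  "sg_word_map q w = foldr (\<lambda>i g. sg_map q i \<circ> g) w id"

primrec sg_vertices :: "(3 \<Rightarrow> real^2) \<Rightarrow> nat \<Rightarrow> (real^2) set" where
  "sg_vertices q 0 = range q"
| "sg_vertices q (Suc m) = (\<Union>i. sg_map q i ` sg_vertices q m)"

definition sg_adj :: "(3 \<Rightarrow> real^2) \<Rightarrow> nat \<Rightarrow> real^2 \<Rightarrow> real^2 \<Rightarrow> bool" where
  "sg_adj q m x y \<longleftrightarrow> x \<in> sg_vertices q m \<and> y \<in> sg_vertices q m \<and> x \<noteq> y \<and>
     (\<exists>w. length w = m \<and> x \<in> sg_word_map q w ` SG q \<and> y \<in> sg_word_map q w ` SG q)"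

text \<open>
  The level-\<open>m\<close> difference operator makes sense only at points of level \<open>m\<close>, so the uniform
  convergence ranges, at stage \<open>m\<close>, over all non-boundary vertices of level \<open>m\<close>.
\<close>

definition has_laplacian ::
  "(3 \<Rightarrow> real^2) \<Rightarrow> (real^2 \<Rightarrow> real) \<Rightarrow> (real^2 \<Rightarrow> real) \<Rightarrow> bool" where
  "has_laplacian q u f \<longleftrightarrow> continuous_on (SG q) u \<and> continuous_on (SG q) f \<and>
     (\<forall>e>0. \<exists>M. \<forall>m\<ge>M. \<forall>x \<in> sg_vertices q m - sg_vertices q 0.
        \<bar>3/2 * 5 ^ m * (\<Sum>y | sg_adj q m x y. u y - u x) - f x\<bar> < e)"

definition dom_laplacian :: "(3 \<Rightarrow> real^2) \<Rightarrow> (real^2 \<Rightarrow> real) set" where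
  "dom_laplacian q = {u. \<exists>f. has_laplacian q u f}"

definition laplacian :: "(3 \<Rightarrow> real^2) \<Rightarrow> (real^2 \<Rightarrow> real) \<Rightarrow> real^2 \<Rightarrow> real" where
  "laplacian q u = (THE f. has_laplacian q u f \<and> (\<forall>x. x \<notin> SG q \<longrightarrow> f x = 0))"

primrec dom_laplacian_pow :: "(3 \<Rightarrow> real^2) \<Rightarrow> nat \<Rightarrow> (real^2 \<Rightarrow> real) set" where
  "dom_laplacian_pow q 0 = {u. continuous_on (SG q) u}"
| "dom_laplacian_pow q (Suc n) =
     {u. u \<in> dom_laplacian q \<and> laplacian q u \<in> dom_laplacian_pow q n}"

definition has_normal_deriv ::
  "(3 \<Rightarrow> real^2) \<Rightarrow> (real^2 \<Rightarrow> real) \<Rightarrow> 3 \<Rightarrow> real \<Rightarrow> bool" where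
  "has_normal_deriv q u j d \<longleftrightarrow>
     (\<lambda>m. (5/3) ^ m * (2 * u (q j) - u ((sg_map q j ^^ m) (q (j + 1)))
                                   - u ((sg_map q j ^^ m) (q (j - 1))))) \<longlonglongrightarrow> d"

definition has_tangential_deriv ::
  "(3 \<Rightarrow> real^2) \<Rightarrow> (real^2 \<Rightarrow> real) \<Rightarrow> 3 \<Rightarrow> real \<Rightarrow> bool" where
  "has_tangential_deriv q u j d \<longleftrightarrow>
     (\<lambda>m. 5 ^ m * (u ((sg_map q j ^^ m) (q (j + 1)))
                   - u ((sg_map q j ^^ m) (q (j - 1))))) \<longlonglongrightarrow> d"

definition polyharmonic :: "(3 \<Rightarrow> real^2) \<Rightarrow> nat \<Rightarrow> (real^2 \<Rightarrow> real) set" where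
  "polyharmonic q j =
     {u. u \<in> dom_laplacian_pow q (j + 1) \<and> (\<forall>x\<in>SG q. (laplacian q ^^ (j + 1)) u x = 0)}"

definition is_monomial ::
  "(3 \<Rightarrow> real^2) \<Rightarrow> nat \<Rightarrow> nat \<Rightarrow> (real^2 \<Rightarrow> real) \<Rightarrow> bool" where
  "is_monomial q j k u \<longleftrightarrow> u \<in> polyharmonic q j \<and>
     (\<forall>m\<le>j. (laplacian q ^^ m) u (q 0) = of_bool (m = j \<and> k = 1) \<and>
            has_normal_deriv q ((laplacian q ^^ m) u) 0 (of_bool (m = j \<and> k = 2)) \<and>
            has_tangential_deriv q ((laplacian q ^^ m) u) 0 (of_bool (m = j \<and> k = 3)))"

text \<open>Meaningful for \<open>k = 1, 2, 3\<close>.\<close>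

definition monomial :: "(3 \<Rightarrow> real^2) \<Rightarrow> nat \<Rightarrow> nat \<Rightarrow> real^2 \<Rightarrow> real" where
  "monomial q j k = (THE u. is_monomial q j k u \<and> (\<forall>x. x \<notin> SG q \<longrightarrow> u x = 0))"

definition sup_norm :: "(3 \<Rightarrow> real^2) \<Rightarrow> (real^2 \<Rightarrow> real) \<Rightarrow> real" where
  "sup_norm q u = (SUP x\<in>SG q. \<bar>u x\<bar>)"

definition neumann_eigenfunction ::
  "(3 \<Rightarrow> real^2) \<Rightarrow> real \<Rightarrow> (real^2 \<Rightarrow> real) \<Rightarrow> bool" where
  "neumann_eigenfunction q l u \<longleftrightarrow> (\<exists>x\<in>SG q. u x \<noteq> 0) \<and> u \<in> dom_laplacian q \<and>
     (\<forall>x\<in>SG q. - laplacian q u x = l * u x) \<and> (\<forall>i. has_normal_deriv q u i 0)"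

definition neumann_spectrum :: "(3 \<Rightarrow> real^2) \<Rightarrow> real set" where
  "neumann_spectrum q = {l. \<exists>u. neumann_eigenfunction q l u}"

text \<open>The nonzero Neumann eigenvalues in increasing order, without multiplicity, from index 0.\<close>

primrec nonzero_neumann_eigenvalue :: "(3 \<Rightarrow> real^2) \<Rightarrow> nat \<Rightarrow> real" where
  "nonzero_neumann_eigenvalue q 0 = (LEAST l. l \<in> neumann_spectrum q - {0})"
| "nonzero_neumann_eigenvalue q (Suc n) =
     (LEAST l. l \<in> neumann_spectrum q - {0} \<and> nonzero_neumann_eigenvalue q n < l)"

definition lambda2 :: "(3 \<Rightarrow> real^2) \<Rightarrow> real" where
  "lambda2 q = nonzero_neumann_eigenvalue q 1"

text \<open>
  The orthogonal reflection in the perpendicular bisector of \<open>q 1\<close> and \<open>q 2\<close>, which passes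
  through \<open>q 0\<close> when the triangle is equilateral.
\<close>

definition rho0 :: "(3 \<Rightarrow> real^2) \<Rightarrow> real^2 \<Rightarrow> real^2" where
  "rho0 q x = (let v = q 2 - q 1 in x - (2 * ((x - q 0) \<bullet> v) / (v \<bullet> v)) *\<^sub>R v)"

lemma rho0_vertices:
  assumes "equilateral q"
  shows "rho0 q (q 0) = q 0" "rho0 q (q 1) = q 2" "rho0 q (q 2) = q 1"
proof -
  obtain s where s: "s > 0" "\<And>i j. i \<noteq> j \<Longrightarrow> dist (q i) (q j) = s"
    using assms unfolding equilateral_def by blast
  define a where "a = q 1 - q 0"
  define b where "b = q 2 - q 0"
  have "norm a = s" "norm b = s" "norm (b - a) = s"
    using s(2)[of 1 0] s(2)[of 2 0] s(2)[of 2 1] by (simp_all add: a_def b_def dist_norm)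
  then have n: "a \<bullet> a = s\<^sup>2" "b \<bullet> b = s\<^sup>2" "(b - a) \<bullet> (b - a) = s\<^sup>2"
    by (simp_all add: dot_square_norm)
  then have ab: "2 * (a \<bullet> b) = s\<^sup>2"
    by (simp add: inner_diff inner_commute)
  have v: "q 2 - q 1 = b - a" by (simp add: a_def b_def)
  have c: "2 * (a \<bullet> (b - a)) / ((b - a) \<bullet> (b - a)) = -1"
    "2 * (b \<bullet> (b - a)) / ((b - a) \<bullet> (b - a)) = 1"
    unfolding n using ab n s(1) by (simp_all add: inner_diff inner_commute field_simps)
  show "rho0 q (q 0) = q 0" by (simp add: rho0_def)
  show "rho0 q (q 1) = q 2" "rho0 q (q 2) = q 1"
    unfolding rho0_def Let_def v a_def[symmetric] b_def[symmetric] c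
    by (simp_all add: a_def b_def)
qed

text \<open>
  Each edge counts once: the double sum meets every edge twice, hence the factor 1/2. The level
  energies increase with \<open>m\<close>, so the limit is taken in the extended reals, where it always
  exists.
\<close>

definition energy_level :: "(3 \<Rightarrow> real^2) \<Rightarrow> nat \<Rightarrow> (real^2 \<Rightarrow> real) \<Rightarrow> real" where
  "energy_level q m u =
     (5/3) ^ m * (1/2 * (\<Sum>x\<in>sg_vertices q m. \<Sum>y | sg_adj q m x y. (u x - u y)\<^sup>2))"

definition energy :: "(3 \<Rightarrow> real^2) \<Rightarrow> (real^2 \<Rightarrow> real) \<Rightarrow> ereal" where
  "energy q u = lim (\<lambda>m. ereal (energy_level q m u))"

definition converges_in_energy ::
  "(3 \<Rightarrow> real^2) \<Rightarrow> (nat \<Rightarrow> real^2 \<Rightarrow> real) \<Rightarrow> (real^2 \<Rightarrow> real) \<Rightarrow> bool" where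
  "converges_in_energy q U u \<longleftrightarrow> (\<lambda>j. energy q (\<lambda>x. U j x - u x)) \<longlonglongrightarrow> 0"

end

theory Submission
  imports Defs "HOL-Complex_Analysis.Complex_Analysis"
begin

text \<open>
  Spectral decimation: a discrete eigenfunction with eigenvalue \<open>y (5 - y)\<close> on a cell extends to the
  subdivided cell with eigenvalue \<open>y\<close>, so an eigenfunction \<open>-\<Delta>u = \<lambda>u\<close> satisfies on level \<open>m\<close> the
  discrete equation with eigenvalue \<open>\<Psi> (2/3 \<lambda> / 5^m)\<close>, where \<open>\<Psi>\<close> is the entire function with
  \<open>\<Psi> (5 x) = \<Psi> x (5 - \<Psi> x)\<close> and \<open>\<Psi>' 0 = 1\<close>. With \<open>\<lambda>\<close> a formal variable the equation is solvable
  for all corner values in the power series, and the coefficient of \<open>\<lambda>^j\<close> of the solution is a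
  preimage of the preceding one under \<open>-\<Delta>\<close>. For suitable corner values the coefficients are
  \<open>(-1)^j P_{jk}\<close>, which turns the theorem into one about convergence radii in \<open>\<lambda>\<close>. The family of
  the \<open>P_{j1}\<close> is entire, uniformly on the gasket. The family of the \<open>P_{j2}\<close> becomes entire after
  multiplication by the infinite product of the \<open>1 - \<Psi> (2/75 \<lambda> / 5^k) / 3\<close>, whose only zero in some
  disc of radius greater than \<open>\<lambda>\<^sub>2\<close> is a simple one at \<open>\<lambda>\<^sub>2\<close>. So the family has a simple pole there,
  and the eigenfunction \<open>\<phi>\<close> is its residue up to a factor.
\<close>

section \<open>The Poincare function of spectral decimation\<close>

text \<open>Power series in \<lambda> are used because the decimation rule divides by (2 - y) (5 -
  y): as a series this has constant term 10 and is a unit, while at a concrete \<lambda> it may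
  vanish. It remains to show that the growth of the coefficients is not affected by these zeros. The
  poles of the \<open>P_{j2}\<close> come from another division. A solution that is 0 at
  \<open>q 0\<close> and c_m at both its neighbours on level m satisfies (2 - y) (5 - y) c_{m+1} =
  (6 - y) c_m, with y on level m + 1, and prescribing the limit of (5/3)^m c_m means dividing by all
  the 6 - y. As y = z (5 - z) with z one level deeper, 6 - y = (2 - z) (3 - z); the factors 2 - z
  cancel in the next step, and the product of the 3 - z remains. It first vanishes where the
  eigenvalue on level 2 is 3, hence \<open>lam2\<close> = 3/2 * 25 * \<open>psi3\<close>. A converse
  is needed too. The Laplacian is a limit, so an eigenfunction satisfies the discrete equations a
  priori only asymptotically. That they hold exactly on fine levels is the source of the uniqueness
  of the monomials and of the identification of \<open>lam2\<close> as the second nonzero Neumann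
  eigenvalue.\<close>

definition fps_scale :: "'a::field \<Rightarrow> 'a fps \<Rightarrow> 'a fps" where
  "fps_scale c F = Abs_fps (\<lambda>n. c ^ n * fps_nth F n)"

lemma fps_scale_nth [simp]: "fps_nth (fps_scale c F) n = c ^ n * fps_nth F n"
  by (simp add: fps_scale_def)

lemma fps_scale_compose: "fps_scale c F = fps_compose F (fps_const c * fps_X)"
  by (simp add: fps_scale_def fps_compose_linear)

lemma fps_scale_mult: "fps_scale c (F * G) = fps_scale c F * fps_scale c G"
  by (simp add: fps_scale_compose fps_compose_mult_distrib)

lemma fps_scale_diff: "fps_scale c (F - G) = fps_scale c F - fps_scale c G"
  by (simp add: fps_eq_iff algebra_simps)

lemma fps_scale_const [simp]: "fps_scale c (fps_const a) = fps_const a"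
  by (simp add: fps_eq_iff)

lemma fps_scale_1 [simp]: "fps_scale c 1 = 1"
  by (simp add: fps_eq_iff)

lemma fps_scale_numeral [simp]: "fps_scale c (numeral a) = numeral a"
  by (metis fps_scale_const fps_numeral_fps_const)

lemma fps_scale_X [simp]: "fps_scale c fps_X = fps_const c * fps_X"
  by (auto simp: fps_eq_iff fps_X_def)

lemma fps_scale_scale [simp]: "fps_scale a (fps_scale b F) = fps_scale (a * b) F"
  by (simp add: fps_eq_iff power_mult_distrib)

lemma eval_fps_scale: "eval_fps (fps_scale c F) z = eval_fps F (c * z)"
  for F :: "'a::{banach, real_normed_field} fps"
  by (simp add: eval_fps_def power_mult_distrib mult_ac)

lemma fps_conv_radius_scale_ge:
  fixes F :: "real fps"
  assumes "c > 0" "ereal r \<le> fps_conv_radius F"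
  shows "ereal (r / c) \<le> fps_conv_radius (fps_scale c F)"
  unfolding fps_conv_radius_def
proof (rule conv_radius_geI_ex)
  fix s :: real assume s: "s > 0" "ereal s < ereal (r / c)"
  have "ereal (norm (c * s)) < fps_conv_radius F"
    using s assms by (intro less_le_trans[OF _ assms(2)]) (auto simp: field_simps)
  from summable_fps[OF this]
  show "\<exists>z. norm z = s \<and> summable (\<lambda>n. fps_nth (fps_scale c F) n * z ^ n)"
    using s by (intro exI[of _ s]) (simp add: power_mult_distrib mult_ac)
qed

lemma fps_conv_radius_geI_bound:
  fixes F :: "'a::{banach, real_normed_field} fps"
  assumes "R > 0" and bd: "\<And>n. norm (fps_nth F n) * R ^ n \<le> C"
  shows "ereal R \<le> fps_conv_radius F"
  unfolding fps_conv_radius_def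
proof (rule conv_radius_geI_ex')
  fix r :: real assume r: "0 < r" "ereal r < ereal R"
  have "norm (fps_nth F n * of_real r ^ n) \<le> C * (r / R) ^ n" for n
  proof -
    have "norm (fps_nth F n * of_real r ^ n) = norm (fps_nth F n) * R ^ n * (r / R) ^ n"
      using r assms(1) by (simp add: norm_mult norm_power power_divide)
    also have "\<dots> \<le> C * (r / R) ^ n"
      using r assms(1) by (intro mult_right_mono bd) auto
    finally show ?thesis .
  qed
  moreover have "summable (\<lambda>n. C * (r / R) ^ n)"
    using r assms(1) by (intro summable_mult summable_geometric) auto
  ultimately show "summable (\<lambda>n. fps_nth F n * of_real r ^ n)"
    by (rule summable_comparison_test'[where N = 0, rotated])
qed

text \<open>Radii multiplied again and again by a fixed q > 1 are unbounded. Such chains come from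
  improving a bound repeatedly or from a functional equation.\<close>

lemma fps_conv_radius_infI:
  fixes F :: "real fps"
  assumes "\<And>n. ereal (c * q ^ n) \<le> fps_conv_radius F" "c > 0" "q > 1"
  shows "fps_conv_radius F = \<infinity>"
proof (rule ereal_top)
  fix B :: real
  obtain n where "B / c < q ^ n" using assms(3) real_arch_pow by blast
  then have "B \<le> c * q ^ n" using assms(2) by (simp add: field_simps)
  then show "ereal B \<le> fps_conv_radius F"
    using assms(1)[of n] by (meson ereal_less_eq(3) order.trans)
qed

section \<open>Coefficients of the Poincare series and their decay\<close>

fun psi_coeff :: "nat \<Rightarrow> real" where
  "psi_coeff n = (if n = 0 then 0 else if n = 1 then 1
     else - (\<Sum>i=1..<n. psi_coeff i * psi_coeff (n - i)) / (5 ^ n - 5))"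

declare psi_coeff.simps [simp del]

definition psi :: "real fps" where "psi = Abs_fps psi_coeff"

lemma psi_coeff_0 [simp]: "psi_coeff 0 = 0" and psi_coeff_1 [simp]: "psi_coeff (Suc 0) = 1"
  by (simp_all add: psi_coeff.simps)

lemma psi_nth [simp]: "fps_nth psi n = psi_coeff n"
  by (simp add: psi_def)

lemma psi_coeff_rec:
  "(5 ^ n - 5) * psi_coeff n = - (\<Sum>i=1..<n. psi_coeff i * psi_coeff (n - i))" if "n \<ge> 2"
proof -
  have "(5::real) ^ 2 \<le> 5 ^ n" using that by (intro power_increasing) auto
  then show ?thesis using that by (subst psi_coeff.simps) (simp add: field_simps)
qed

text \<open>Comparing coefficients gives the recursion (5^n - 5) a_n = - sum a_i a_(n-i). At n = 1
  the left factor is 0, so this coefficient is free; it is normalised to 1.\<close>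

lemma psi_scale: "fps_scale 5 psi = psi * (5 - psi)"
proof (rule fps_ext)
  fix n :: nat
  have sq: "fps_nth (psi * psi) n = (\<Sum>i=1..<n. psi_coeff i * psi_coeff (n - i))"
  proof -
    have "fps_nth (psi * psi) n = (\<Sum>i=0..n. psi_coeff i * psi_coeff (n - i))"
      by (simp add: fps_mult_nth)
    also have "\<dots> = (\<Sum>i=1..<n. psi_coeff i * psi_coeff (n - i))"
    proof (rule sum.mono_neutral_right)
      show "\<forall>i\<in>{0..n} - {1..<n}. psi_coeff i * psi_coeff (n - i) = 0"
      proof
        fix i assume "i \<in> {0..n} - {1..<n}"
        then have "i = 0 \<or> i = n" by auto
        then show "psi_coeff i * psi_coeff (n - i) = 0" by auto
      qed
    qed auto
    finally show ?thesis .
  qed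
  have "fps_nth (psi * (5 - psi)) n = 5 * psi_coeff n - (\<Sum>i=1..<n. psi_coeff i * psi_coeff (n - i))"
    by (simp add: right_diff_distrib mult.commute[of psi 5] fps_mult_numeral_left sq)
  also have "\<dots> = 5 ^ n * psi_coeff n"
  proof (cases "n \<ge> 2")
    case True
    then show ?thesis using psi_coeff_rec[OF True] by (simp add: algebra_simps)
  next
    case False
    then have "n = 0 \<or> n = 1" by auto
    then show ?thesis by auto
  qed
  finally show "fps_nth (fps_scale 5 psi) n = fps_nth (psi * (5 - psi)) n" by simp
qed

lemma psi_coeff_le_1: "\<bar>psi_coeff n\<bar> \<le> 1"
proof (induction n rule: less_induct)
  case (less n)
  show ?case
  proof (cases "n \<ge> 2")
    case True
    have b: "real n \<le> 5 ^ n - 5"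
      using True
    proof (induction n rule: dec_induct)
      case (step m)
      have "(5::real) ^ 2 \<le> 5 ^ m" using step by (intro power_increasing) auto
      then show ?case using step by simp
    qed auto
    have "\<bar>(5 ^ n - 5) * psi_coeff n\<bar> \<le> (\<Sum>i=1..<n. \<bar>psi_coeff i * psi_coeff (n - i)\<bar>)"
      using sum_abs[of "\<lambda>i. psi_coeff i * psi_coeff (n - i)" "{1..<n}"] psi_coeff_rec[OF True] by simp
    also have "\<dots> \<le> (\<Sum>i=1..<n. 1)"
    proof (rule sum_mono)
      fix i assume "i \<in> {1..<n}"
      then show "\<bar>psi_coeff i * psi_coeff (n - i)\<bar> \<le> 1"
        using less[of i] less[of "n - i"] by (simp add: abs_mult mult_le_one)
    qed
    also have "\<dots> \<le> 5 ^ n - 5" using b True by simp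
    finally have "(5 ^ n - 5) * \<bar>psi_coeff n\<bar> \<le> (5 ^ n - 5) * 1" using b True by (simp add: abs_mult)
    then show ?thesis using b True by (metis mult_le_cancel_left_pos of_nat_0_less_iff less_le_trans pos2)
  next
    case False
    then have "n = 0 \<or> n = 1" by auto
    then show ?thesis by auto
  qed
qed

text \<open>A convolution of n - 1 terms of size R^n is divided by 5^n - 5. Since the factor n has
  to be absorbed, less than a factor 5 is gained per index; 4 is enough, as the step is
  iterated.\<close>

lemma psi_coeff_bound_step:
  assumes "\<And>n. \<bar>psi_coeff n\<bar> \<le> K * R ^ n" "R > 0"
  shows "\<exists>K'. \<forall>n. \<bar>psi_coeff n\<bar> \<le> K' * (R / 4) ^ n"
proof -
  have K: "K \<ge> 0" using assms(1)[of 0] by simp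
  have *: "\<bar>psi_coeff n\<bar> \<le> (5 * K\<^sup>2) * (R / 4) ^ n" if n: "n \<ge> 2" for n
  proof -
    have p: "real n * 4 ^ n \<le> 5 * (5 ^ n - 5)"
      using n
    proof (induction n rule: dec_induct)
      case (step m)
      have "real m + 1 \<le> (5/4)^m * 4" if "m \<ge> 2" for m
        using that
      proof (induction m rule: dec_induct)
        case (step k)
        have "(5/4::real)^2 \<le> (5/4) ^ k" using step by (intro power_increasing) auto
        then show ?case using step by (simp add: power2_eq_square)
      qed (simp add: power2_eq_square)
      note this[of m]
      then have "(real m + 1) * 4 ^ m \<le> (5/4)^m * 4 * 4 ^ m" using step by (intro mult_right_mono) auto
      also have "\<dots> = 4 * 5 ^ m" by (simp add: power_divide)
      finally have a: "(real m + 1) * 4 ^ m \<le> 4 * 5 ^ m" .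
      have "real (Suc m) * 4 ^ Suc m = 4 * ((real m + 1) * 4 ^ m)" by (simp add: algebra_simps)
      also have "\<dots> \<le> 16 * 5 ^ m" using a by simp
      also have "\<dots> \<le> 5 * (5 ^ Suc m - 5)"
      proof -
        have "(5::real) ^ 2 \<le> 5 ^ m" using step by (intro power_increasing) auto
        then show ?thesis by simp
      qed
      finally show ?case .
    qed simp
    have d: "(5::real) ^ n - 5 > 0"
    proof -
      have "(5::real) ^ 2 \<le> 5 ^ n" using n by (intro power_increasing) auto
      then show ?thesis by simp
    qed
    have "\<bar>(5 ^ n - 5) * psi_coeff n\<bar> \<le> (\<Sum>i=1..<n. \<bar>psi_coeff i * psi_coeff (n - i)\<bar>)"
      using sum_abs[of "\<lambda>i. psi_coeff i * psi_coeff (n - i)" "{1..<n}"] psi_coeff_rec[OF n] by simp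
    also have "\<dots> \<le> (\<Sum>i=1..<n. K\<^sup>2 * R ^ n)"
    proof (rule sum_mono)
      fix i assume i: "i \<in> {1..<n}"
      have "\<bar>psi_coeff i * psi_coeff (n - i)\<bar> \<le> (K * R ^ i) * (K * R ^ (n - i))"
        unfolding abs_mult using assms K by (intro mult_mono) auto
      also have "\<dots> = K\<^sup>2 * R ^ n" using i by (simp add: power2_eq_square flip: power_add)
      finally show "\<bar>psi_coeff i * psi_coeff (n - i)\<bar> \<le> K\<^sup>2 * R ^ n" .
    qed
    also have "\<dots> = real (n - 1) * (K\<^sup>2 * R ^ n)" by simp
    also have "\<dots> \<le> real n * (K\<^sup>2 * R ^ n)" using assms by (intro mult_right_mono) auto
    also have "\<dots> = real n * 4 ^ n * (K\<^sup>2 * (R / 4) ^ n)" by (simp add: power_divide)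
    also have "\<dots> \<le> 5 * (5 ^ n - 5) * (K\<^sup>2 * (R / 4) ^ n)" using p assms by (intro mult_right_mono) auto
    finally have "(5 ^ n - 5) * \<bar>psi_coeff n\<bar> \<le> (5 ^ n - 5) * ((5 * K\<^sup>2) * (R / 4) ^ n)"
      using d by (simp add: abs_mult algebra_simps)
    then show ?thesis using d by (rule mult_left_le_imp_le)
  qed
  show ?thesis
  proof (intro exI allI)
    fix n
    \<comment> \<open>The summand 4 / R provides for n = 1, where the recursion says
      nothing.\<close>
    show "\<bar>psi_coeff n\<bar> \<le> (5 * K\<^sup>2 + 4 / R) * (R / 4) ^ n"
    proof (cases "n \<ge> 2")
      case True
      have "0 \<le> 4 / R * (R / 4) ^ n" using assms by auto
      then show ?thesis using *[OF True] by (simp add: algebra_simps)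
    next
      case False
      then have "n = 0 \<or> n = 1" by auto
      then show ?thesis using assms(2) by (auto simp: field_simps)
    qed
  qed
qed

lemma psi_conv_radius [simp]: "fps_conv_radius psi = \<infinity>"
proof (rule fps_conv_radius_infI[where c = 1 and q = 4])
  fix k :: nat
  have "\<exists>K. \<forall>n. \<bar>psi_coeff n\<bar> \<le> K * (1 / 4 ^ k) ^ n"
  proof (induction k)
    case 0
    show ?case using psi_coeff_le_1 by (intro exI[of _ 1]) auto
  next
    case (Suc k)
    then obtain K where "\<And>n. \<bar>psi_coeff n\<bar> \<le> K * (1 / 4 ^ k) ^ n" by auto
    from psi_coeff_bound_step[OF this] show ?case by (simp add: field_simps)
  qed
  then obtain K where K: "\<And>n. \<bar>psi_coeff n\<bar> \<le> K * (1 / 4 ^ k) ^ n" by blast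
  show "ereal (1 * 4 ^ k) \<le> fps_conv_radius psi"
  proof (rule fps_conv_radius_geI_bound)
    fix n
    show "norm (fps_nth psi n) * (1 * 4 ^ k) ^ n \<le> K"
      using mult_right_mono[OF K[of n], of "(4 ^ k) ^ n"] by (simp add: power_divide)
  qed simp
qed auto

text \<open>\<open>prd\<close> is the infinite product of the \<open>1 - psi(x / 5^k) / 3\<close> over \<open>k \<ge> 0\<close>.\<close>

fun prd_coeff :: "nat \<Rightarrow> real" where
  "prd_coeff n = (if n = 0 then 1
     else - (\<Sum>i=1..n. psi_coeff i * (1/5) ^ (n - i) * prd_coeff (n - i)) / (3 * (1 - (1/5) ^ n)))"

declare prd_coeff.simps [simp del]

definition prd :: "real fps" where "prd = Abs_fps prd_coeff"

lemma prd_nth [simp]: "fps_nth prd n = prd_coeff n"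
  by (simp add: prd_def)

lemma prd_coeff_0 [simp]: "prd_coeff 0 = 1"
  by (simp add: prd_coeff.simps)

lemma pow5_less: "n > 0 \<Longrightarrow> (1/5::real) ^ n \<le> 1/5"
  using power_decreasing[of 1 n "1/5::real"] by simp

text \<open>Splitting off the factor k = 0 leaves the same product at x / 5. Comparing coefficients
  is the recursion of \<open>prd_coeff\<close>, solvable because 1 - 5^-n is nonzero for n >
  0.\<close>

lemma prd_eq: "prd = (1 - fps_const (1/3) * psi) * fps_scale (1/5) prd"
proof (rule fps_ext)
  fix n
  have "fps_nth (psi * fps_scale (1/5) prd) n
      = (\<Sum>i=1..n. psi_coeff i * ((1/5) ^ (n - i) * prd_coeff (n - i)))"
    unfolding fps_mult_nth by (rule sum.mono_neutral_cong_right) (auto simp: not_le)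
  then have e: "fps_nth ((1 - fps_const (1/3) * psi) * fps_scale (1/5) prd) n
     = (1/5) ^ n * prd_coeff n - (1/3) * (\<Sum>i=1..n. psi_coeff i * ((1/5) ^ (n - i) * prd_coeff (n - i)))"
    by (simp add: left_diff_distrib mult.assoc)
  show "fps_nth prd n = fps_nth ((1 - fps_const (1/3) * psi) * fps_scale (1/5) prd) n"
  proof (cases "n = 0")
    case True
    then show ?thesis by (simp add: e)
  next
    case False
    have "(1 - (1/5) ^ n) * prd_coeff n
       = - (1/3) * (\<Sum>i=1..n. psi_coeff i * ((1/5) ^ (n - i) * prd_coeff (n - i)))"
      using False pow5_less[of n]
      by (subst prd_coeff.simps) (simp add: field_simps mult.assoc)
    then show ?thesis unfolding prd_nth e by (simp add: left_diff_distrib)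
  qed
qed

lemma prd_coeff_bound: "\<bar>prd_coeff n\<bar> \<le> 2 ^ n"
proof (induction n rule: less_induct)
  case (less n)
  show ?case
  proof (cases "n = 0")
    case False
    let ?S = "\<Sum>i=1..n. psi_coeff i * (1/5) ^ (n - i) * prd_coeff (n - i)"
    have "\<bar>?S\<bar> \<le> (\<Sum>i=1..n. 2 ^ (n - i))"
    proof (rule order.trans[OF sum_abs sum_mono])
      fix i assume i: "i \<in> {1..n}"
      have "\<bar>psi_coeff i * (1/5) ^ (n - i) * prd_coeff (n - i)\<bar> \<le> 1 * 1 * 2 ^ (n - i)"
        unfolding abs_mult using i less[of "n - i"] psi_coeff_le_1
        by (intro mult_mono) (auto simp: power_le_one)
      then show "\<bar>psi_coeff i * (1/5) ^ (n - i) * prd_coeff (n - i)\<bar> \<le> 2 ^ (n - i)" by simp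
    qed
    also have "\<dots> = (\<Sum>i<n. 2 ^ i)"
      by (rule sum.reindex_bij_witness[where i = "\<lambda>i. n - i" and j = "\<lambda>i. n - i"]) auto
    also have "\<dots> \<le> (2::real) ^ n"
      using sum_gp_strict[of "2::real" n] by simp
    finally have "\<bar>?S\<bar> \<le> 2 ^ n" .
    moreover have "\<bar>prd_coeff n\<bar> = \<bar>?S\<bar> / (3 * (1 - (1/5) ^ n))"
      using False pow5_less[of n] by (subst prd_coeff.simps) (simp add: abs_divide)
    moreover have "\<bar>?S\<bar> / (3 * (1 - (1/5) ^ n)) \<le> \<bar>?S\<bar>"
      using False pow5_less[of n] by (intro divide_le_eq[THEN iffD2])
        (auto intro: order.trans[OF _ mult_left_mono[of 1]])
    ultimately show ?thesis by linarith
  qed simp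
qed

text \<open>The functional equation expresses the series at x through the entire \<open>psi\<close>
  and the series at x / 5, so a known radius can be multiplied by 5.\<close>

lemma prd_conv_radius [simp]: "fps_conv_radius prd = \<infinity>"
proof (rule fps_conv_radius_infI[where c = "1/2" and q = 5])
  fix k :: nat
  show "ereal (1/2 * 5 ^ k) \<le> fps_conv_radius prd"
  proof (induction k)
    case 0
    show ?case
      using prd_coeff_bound by (intro fps_conv_radius_geI_bound[of _ _ 1]) (auto simp: power_divide)
  next
    case (Suc k)
    have "ereal (1/2 * 5 ^ k / (1/5)) \<le> fps_conv_radius (fps_scale (1/5) prd)"
      using Suc by (intro fps_conv_radius_scale_ge) auto
    moreover have "fps_conv_radius (1 - fps_const (1/3) * psi) = \<infinity>"
      using fps_conv_radius_diff[of 1 "fps_const (1/3) * psi"]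
      by (simp add: fps_conv_radius_cmult_left)
    ultimately show ?case
      using fps_conv_radius_mult[of "1 - fps_const (1/3) * psi" "fps_scale (1/5) prd"]
      by (subst prd_eq) (simp add: mult.commute)
  qed
qed auto

lemma div_pow5_tendsto_0: "(\<lambda>k. c / 5 ^ k) \<longlonglongrightarrow> (0::real)"
proof -
  have "(\<lambda>k. c * (1/5) ^ k) \<longlonglongrightarrow> 0"
    by (intro tendsto_mult_right_zero LIMSEQ_power_zero) simp
  then show ?thesis by (simp add: power_divide)
qed

section \<open>Evaluation at real and complex arguments\<close>

definition rfps :: "real fps \<Rightarrow> 'a::real_normed_field fps" where
  "rfps F = Abs_fps (\<lambda>n. of_real (fps_nth F n))"

lemma rfps_nth [simp]: "fps_nth (rfps F) n = of_real (fps_nth F n)"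
  by (simp add: rfps_def)

lemma rfps_real [simp]: "rfps F = F"
  by (simp add: fps_eq_iff)

lemma rfps_mult: "rfps (F * G) = rfps F * rfps G"
  by (simp add: fps_eq_iff fps_mult_nth)

lemma rfps_diff: "rfps (F - G) = rfps F - rfps G"
  by (simp add: fps_eq_iff)

lemma rfps_const [simp]: "rfps (fps_const c) = fps_const (of_real c)"
  by (simp add: fps_eq_iff)

lemma rfps_1 [simp]: "rfps 1 = 1"
  by (simp add: fps_eq_iff)

lemma rfps_numeral [simp]: "rfps (numeral k) = numeral k"
  by (metis rfps_const fps_numeral_fps_const of_real_numeral)

lemma rfps_X [simp]: "rfps fps_X = fps_X"
  by (simp add: fps_eq_iff fps_X_def)

lemma rfps_scale: "rfps (fps_scale c F) = fps_scale (of_real c) (rfps F)"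
  by (simp add: fps_eq_iff)

lemma fps_conv_radius_rfps [simp]:
  "fps_conv_radius (rfps F :: 'a::{banach, real_normed_field} fps) = fps_conv_radius F"
  unfolding fps_conv_radius_def conv_radius_def by simp

lemma eval_rfps_of_real:
  assumes "ereal \<bar>x\<bar> < fps_conv_radius F"
  shows "eval_fps (rfps F) (of_real x :: 'a::{banach, real_normed_field}) = of_real (eval_fps F x)"
proof -
  have "summable (\<lambda>n. fps_nth F n * x ^ n)" using assms by (intro summable_fps) auto
  from suminf_of_real[OF this, where 'a = 'a] show ?thesis
    by (simp add: eval_fps_def)
qed

definition Psi :: "'a::{banach, real_normed_field} \<Rightarrow> 'a" where
  "Psi z = eval_fps (rfps psi) z"

definition Prd :: "'a::{banach, real_normed_field} \<Rightarrow> 'a" where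
  "Prd z = eval_fps (rfps prd) z"

lemma Psi_5: "Psi (5 * z) = Psi z * (5 - Psi z)"
proof -
  have "Psi (5 * z) = eval_fps (rfps (fps_scale 5 psi)) z"
    by (simp add: Psi_def rfps_scale eval_fps_scale)
  also have "\<dots> = eval_fps (rfps psi * (5 - rfps psi)) z"
    by (simp add: psi_scale rfps_mult rfps_diff)
  also have "\<dots> = Psi z * (5 - Psi z)"
    using fps_conv_radius_diff[of 5 "rfps psi :: 'a fps"]
    by (subst eval_fps_mult) (auto simp: eval_fps_diff Psi_def)
  finally show ?thesis .
qed

lemma Psi_div: "Psi z = Psi (z / 5) * (5 - Psi (z / 5))"
  using Psi_5[of "z / 5"] by simp

lemma Psi_0 [simp]: "Psi 0 = 0"
  by (simp add: Psi_def eval_fps_at_0)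

lemma Psi_of_real: "Psi (of_real x :: 'a::{banach, real_normed_field}) = of_real (Psi x)"
  by (simp add: Psi_def eval_rfps_of_real)

lemma continuous_on_Psi [continuous_intros]:
  "continuous_on A f \<Longrightarrow> continuous_on A (\<lambda>x. Psi (f x :: 'a::{banach, real_normed_field}))"
  unfolding Psi_def by (rule continuous_on_eval_fps') auto

lemma Psi_has_field_derivative:
  "(Psi has_field_derivative eval_fps (fps_deriv (rfps psi)) z) (at z)"
  for z :: "'a::{banach, real_normed_field}"
  using has_field_derivative_eval_fps[of z "rfps psi :: 'a fps"]
  unfolding Psi_def[abs_def] by simp

lemma Psi_near_0:
  fixes z :: "'a::{banach, real_normed_field}"
  assumes "norm z \<le> 1/2"
  shows "norm (Psi z - z) \<le> 2 * norm z ^ 2"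
proof -
  have s: "(\<lambda>n. of_real (psi_coeff n) * z ^ n) sums Psi z"
    using sums_eval_fps[of z "rfps psi :: 'a fps"] by (simp add: Psi_def)
  have s2: "(\<lambda>n. of_real (psi_coeff (n + 2)) * z ^ (n + 2)) sums (Psi z - z)"
    using sums_split_initial_segment[OF s, of 2] by (simp add: numeral_2_eq_2)
  have g: "(\<lambda>n. norm z ^ 2 * norm z ^ n) sums (norm z ^ 2 * (1 / (1 - norm z)))"
    using assms by (intro sums_mult geometric_sums) auto
  have "norm (Psi z - z) \<le> norm z ^ 2 * (1 / (1 - norm z))"
  proof -
    have "norm (of_real (psi_coeff (n + 2)) * z ^ (n + 2)) \<le> norm z ^ 2 * norm z ^ n" for n
      using mult_right_mono[OF psi_coeff_le_1[of "n + 2"], of "norm z ^ (n + 2)"]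
      by (simp add: norm_mult norm_power power_add mult_ac power2_eq_square)
    from norm_suminf_le[OF this sums_summable[OF g]] show ?thesis
      using sums_unique[OF s2] sums_unique[OF g] by simp
  qed
  also have "\<dots> \<le> norm z ^ 2 * 2"
    using assms by (intro mult_left_mono) (auto simp: field_simps)
  finally show ?thesis by simp
qed

lemma pow5_Psi_tendsto:
  fixes z :: "'a::{banach, real_normed_field}"
  shows "(\<lambda>k. 5 ^ k * Psi (z / 5 ^ k)) \<longlonglongrightarrow> z"
proof (rule Lim_null_comparison[THEN LIM_zero_cancel])
  have t: "(\<lambda>k. norm z / 5 ^ k) \<longlonglongrightarrow> 0" by (rule div_pow5_tendsto_0)
  then have "\<forall>\<^sub>F k in sequentially. norm z / 5 ^ k < 1/2"
    by (rule order_tendstoD) auto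
  then show "\<forall>\<^sub>F k in sequentially. norm (5 ^ k * Psi (z / 5 ^ k) - z) \<le> 2 * norm z ^ 2 / 5 ^ k"
  proof eventually_elim
    case (elim k)
    have "norm (5 ^ k * Psi (z / 5 ^ k) - z) = 5 ^ k * norm (Psi (z / 5 ^ k) - z / 5 ^ k)"
    proof -
      have "5 ^ k * Psi (z / 5 ^ k) - z = 5 ^ k * (Psi (z / 5 ^ k) - z / 5 ^ k)"
        by (simp add: right_diff_distrib)
      then show ?thesis by (simp add: norm_mult norm_power)
    qed
    also have "\<dots> \<le> 5 ^ k * (2 * norm (z / 5 ^ k) ^ 2)"
      using elim by (intro mult_left_mono Psi_near_0) (auto simp: norm_divide norm_power)
    also have "\<dots> = 2 * norm z ^ 2 / 5 ^ k"
      by (simp add: norm_divide norm_power power2_eq_square field_simps)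
    finally show ?case .
  qed
  show "(\<lambda>k. 2 * norm z ^ 2 / 5 ^ k) \<longlonglongrightarrow> 0" by (rule div_pow5_tendsto_0)
qed

text \<open>The argument is recovered as the limit of 5^k Psi (z / 5^k). This turns the control of
  branches of y (5 - y) into injectivity.\<close>

lemma Psi_inject_limit:
  fixes z w :: "'a::{banach, real_normed_field}"
  assumes "\<And>k. Psi (z / 5 ^ k) = Psi (w / 5 ^ k)"
  shows "z = w"
  using pow5_Psi_tendsto[of z] pow5_Psi_tendsto[of w] assms LIMSEQ_unique by fastforce

section \<open>Real values of Psi up to the first point where it equals 3\<close>

lemma Psi_neg: "Psi x < 0" if "x < 0" for x :: real
proof -
  have small: "Psi y < 0" if "y < 0" "- 1/4 \<le> y" for y :: real
  proof -
    have "2 * y ^ 2 \<le> - y / 2"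
      using that mult_left_mono[of "-y" "1/4" "-2 * y"] by (simp add: power2_eq_square)
    then show ?thesis using Psi_near_0[of y] that by (simp add: abs_le_iff)
  qed
  obtain k where k: "- 4 * x < 5 ^ k" using real_arch_pow[of 5 "-4 * x"] by auto
  have "Psi (x / 5 ^ j) < 0" if "j \<le> k" for j
    using that
  proof (induction j rule: inc_induct)
    case base
    show ?case using k that \<open>x < 0\<close> by (intro small) (auto simp: field_simps)
  next
    case (step j)
    have "Psi (x / 5 ^ j) = Psi (x / 5 ^ Suc j) * (5 - Psi (x / 5 ^ Suc j))"
      using Psi_div[of "x / 5 ^ j"] by (simp add: mult.commute)
    then show ?case using step by (simp add: mult_neg_pos)
  qed
  from this[of 0] show ?thesis by simp
qed

text \<open>The map y (5 - y) preserves positivity below 5, so the sign spreads from a neighbourhood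
  of 0 to larger arguments.\<close>

lemma Psi_pos:
  fixes x :: real
  assumes "0 < x" "\<And>y. 0 < y \<Longrightarrow> y \<le> x / 5 \<Longrightarrow> Psi y < 5"
  shows "Psi x > 0"
proof -
  have small: "Psi y > 0" if "y > 0" "y \<le> 1/4" for y :: real
  proof -
    have "2 * y ^ 2 \<le> y / 2"
      using that mult_left_mono[of "y" "1/4" "2 * y"] by (simp add: power2_eq_square)
    then show ?thesis using Psi_near_0[of y] that by (simp add: abs_le_iff)
  qed
  obtain k where k: "4 * x < 5 ^ k" using real_arch_pow[of 5 "4 * x"] by auto
  have "Psi (x / 5 ^ j) > 0" if "j \<le> k" for j
    using that
  proof (induction j rule: inc_induct)
    case base
    show ?case using k assms(1) by (intro small) (auto simp: field_simps)
  next
    case (step j)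
    have e: "Psi (x / 5 ^ j) = Psi (x / 5 ^ Suc j) * (5 - Psi (x / 5 ^ Suc j))"
      using Psi_div[of "x / 5 ^ j"] by (simp add: mult.commute)
    have "x / 5 ^ j \<le> x" using assms(1) by (simp add: divide_le_eq mult_le_cancel_left1)
    then have "Psi (x / 5 ^ Suc j) < 5" using assms(1) by (intro assms(2)) auto
    then show ?case using step e by simp
  qed
  from this[of 0] show ?thesis by simp
qed

text \<open>If all values on the positive axis were below 3, a value in (2, 3) would produce one
  above 6 at five times the argument; so they would be at most 2, where y (5 - y) \<ge> 3 y makes
  the values at 5^k grow geometrically.\<close>

lemma ex_Psi_ge_3: "\<exists>x>0. Psi x \<ge> (3::real)"
proof (rule ccontr)
  assume "\<not> ?thesis"
  then have lt: "Psi x < 3" if "x > 0" for x :: real using that by force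
  have pos: "Psi x > 0" if "x > 0" for x :: real
    using that lt by (intro Psi_pos) (auto intro: less_trans[of _ 3])
  have le2: "Psi x \<le> 2" if "x > 0" for x :: real
  proof (rule ccontr)
    assume "\<not> Psi x \<le> 2"
    then have "(Psi x - 2) * (3 - Psi x) > 0" using lt[of x] that by simp
    then have "Psi (5 * x) > 6" unfolding Psi_5 by (simp add: algebra_simps)
    then show False using lt[of "5 * x"] that by simp
  qed
  have "3 ^ k * Psi 1 \<le> Psi (5 ^ k :: real)" for k
  proof (induction k)
    case (Suc k)
    have "3 * Psi (5 ^ k) \<le> Psi (5 ^ k) * (5 - Psi (5 ^ k :: real))"
      using pos[of "5 ^ k"] le2[of "5 ^ k"] by (simp add: mult.commute)
    then show ?case using Suc by (simp add: Psi_5)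
  qed simp
  moreover obtain k where "2 / Psi 1 < (3::real) ^ k" using real_arch_pow[of 3] by auto
  then have "2 < 3 ^ k * Psi (1::real)" using pos[of 1] by (simp add: field_simps)
  ultimately show False using le2[of "5 ^ k"] by (metis linorder_not_less order.trans zero_less_numeral zero_less_power)
qed

lemma ex_least_Psi_3: "\<exists>x>0. Psi x = (3::real) \<and> (\<forall>y. 0 \<le> y \<and> y < x \<longrightarrow> Psi y < 3)"
proof -
  obtain X where X: "X > 0" "Psi X \<ge> (3::real)" using ex_Psi_ge_3 by blast
  let ?S = "{0..X} \<inter> Psi -` {3..}"
  have "closed ?S" by (intro continuous_closed_preimage continuous_on_Psi continuous_on_id) auto
  then have "compact ?S" using compact_Int_closed[of "{0..X}" ?S] by simp
  moreover have "X \<in> ?S" using X by auto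
  ultimately obtain a where a: "a \<in> ?S" "\<And>y. y \<in> ?S \<Longrightarrow> a \<le> y"
    using compact_attains_inf[of ?S] by blast
  have lt: "Psi y < 3" if "0 \<le> y" "y < a" for y :: real
    using a(2)[of y] a(1) that by force
  have a0: "a > 0" using a(1) by (cases "a = 0") auto
  have "Psi a = 3"
  proof (rule ccontr)
    assume "Psi a \<noteq> 3"
    then have "Psi a > 3" using a(1) by auto
    then obtain y where y: "0 \<le> y" "y \<le> a" "Psi y = 3"
      using IVT'[of Psi 0 3 a] a0 continuous_on_Psi[of "{0..a}" "\<lambda>x. x"] by auto
    then have "y < a" using \<open>Psi a > 3\<close> by (cases "y = a") auto
    then show False using lt[of y] y by simp
  qed
  then show ?thesis using a0 lt by blast
qed

text \<open>The first two nonzero Neumann eigenvalues will be 15/2 and 75/2 times this number, since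
  their discrete eigenvalues pass through 3 on level 1 and on level 2.\<close>

definition psi3 :: real where
  "psi3 = (SOME x. x > 0 \<and> Psi x = (3::real) \<and> (\<forall>y. 0 \<le> y \<and> y < x \<longrightarrow> Psi y < 3))"

lemma psi3: "psi3 > 0" "Psi psi3 = 3" "\<And>y. y < psi3 \<Longrightarrow> Psi y < 3"
proof -
  have *: "psi3 > 0 \<and> Psi psi3 = 3 \<and> (\<forall>y. 0 \<le> y \<and> y < psi3 \<longrightarrow> Psi y < 3)"
    unfolding psi3_def by (rule someI_ex[OF ex_least_Psi_3])
  then show "psi3 > 0" "Psi psi3 = 3" by auto
  show "Psi y < 3" if "y < psi3" for y
    using * that Psi_neg[of y] by (cases "y \<ge> 0") auto
qed

lemma Psi_le_3: "y \<le> psi3 \<Longrightarrow> Psi y \<le> 3"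
  using psi3 by (cases "y = psi3") (auto intro: less_imp_le)

lemma Psi_5_psi3: "Psi (5 * psi3) = 6"
  by (simp add: Psi_5 psi3)

text \<open>The value w at y satisfies w (5 - w) \<le> 3 and w < 3, hence lies at or below the
  smaller root (5 - sqrt 13) / 2 = 0.697... of w (5 - w) = 3. The bound 7/10 keeps it away from the
  critical point 5/2 and the exceptional value 2.\<close>

lemma Psi_small: "Psi y < 7/10" if "y \<le> psi3 / 5"
proof (rule ccontr)
  assume "\<not> Psi y < 7/10"
  moreover have "Psi y < 3" using that psi3 by (intro psi3(3)) auto
  ultimately have "0 \<le> (Psi y - 7/10) * (3 - Psi y)" by simp
  moreover have "Psi y * (5 - Psi y) \<le> 3"
    using Psi_le_3[of "5 * y"] that by (simp add: Psi_5)
  ultimately show False using \<open>\<not> Psi y < 7/10\<close> \<open>Psi y < 3\<close>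
    by (simp add: algebra_simps) argo
qed

text \<open>At every finer scale the values are below 5/2, the critical point of y (5 - y), so
  equality at one scale passes to the next.\<close>

lemma Psi_inj:
  assumes "x \<le> psi3" "y \<le> psi3" "Psi x = Psi y"
  shows "x = y"
proof (rule Psi_inject_limit)
  fix k
  show "Psi (x / 5 ^ k) = Psi (y / 5 ^ k)"
  proof (induction k)
    case (Suc k)
    have le: "z / 5 ^ Suc k \<le> psi3 / 5" if "z \<le> psi3" for z :: real
    proof -
      have "z / 5 ^ k \<le> psi3 / 5 ^ k" using that by (simp add: divide_right_mono)
      also have "\<dots> \<le> psi3" using psi3(1) by (simp add: divide_le_eq mult_le_cancel_left1)
      finally show ?thesis by (simp add: field_simps)
    qed
    let ?z = "Psi (x / 5 ^ Suc k)" and ?w = "Psi (y / 5 ^ Suc k)"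
    have "?z * (5 - ?z) = ?w * (5 - ?w)"
      using Suc Psi_div[of "x / 5 ^ k"] Psi_div[of "y / 5 ^ k"] by (simp add: mult.commute)
    then have "(?z - ?w) * (5 - ?z - ?w) = 0" by (simp add: algebra_simps)
    moreover have "?z < 7/10" by (rule Psi_small[OF le[OF assms(1)]])
    moreover have "?w < 7/10" by (rule Psi_small[OF le[OF assms(2)]])
    ultimately show ?case by simp
  qed (use assms in auto)
qed

text \<open>By the differentiated functional equation a zero of the derivative moves from x to x /
  5, since 5 - 2 Psi (x / 5) is nonzero there. Zeros would accumulate at 0, where the derivative is
  1.\<close>

lemma Psi_deriv_psi3: "eval_fps (fps_deriv psi) psi3 \<noteq> 0"
proof
  assume z: "eval_fps (fps_deriv psi) psi3 = 0"
  let ?D = "eval_fps (fps_deriv psi)"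
  have D: "(Psi has_real_derivative ?D x) (at x)" for x
    using Psi_has_field_derivative[of x] by simp
  have rec: "?D x = ?D (x / 5) * (5 - 2 * Psi (x / 5)) / 5" for x
  proof (rule DERIV_unique[OF D])
    have d: "((\<lambda>x. Psi (x / 5)) has_real_derivative ?D (x / 5) * (1 / 5)) (at x)"
      by (rule DERIV_chain2[OF D]) (auto intro!: derivative_eq_intros)
    have "((\<lambda>x. Psi (x / 5) * (5 - Psi (x / 5))) has_real_derivative
        ?D (x / 5) * (1 / 5) * (5 - Psi (x / 5)) + (0 - ?D (x / 5) * (1 / 5)) * Psi (x / 5)) (at x)"
      by (intro DERIV_mult DERIV_diff DERIV_const d)
    moreover have "(\<lambda>x::real. Psi (x / 5) * (5 - Psi (x / 5))) = Psi"
      by (rule ext) (rule Psi_div[symmetric])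
    moreover have "?D (x / 5) * (1 / 5) * (5 - Psi (x / 5)) + (0 - ?D (x / 5) * (1 / 5)) * Psi (x / 5)
        = ?D (x / 5) * (5 - 2 * Psi (x / 5)) / 5"
      by (simp add: field_simps)
    ultimately show "(Psi has_real_derivative ?D (x / 5) * (5 - 2 * Psi (x / 5)) / 5) (at x)"
      by (simp only:)
  qed
  have "?D (psi3 / 5 ^ k) = 0" for k
  proof (induction k)
    case (Suc k)
    have "psi3 / 5 ^ k \<le> psi3" using psi3(1) by (simp add: divide_le_eq mult_le_cancel_left1)
    then have "Psi (psi3 / 5 ^ k / 5) < 7/10" by (intro Psi_small) auto
    then have "5 - 2 * Psi (psi3 / 5 ^ k / 5) \<noteq> 0" by linarith
    then show ?case using Suc rec[of "psi3 / 5 ^ k"] by (simp add: mult.commute)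
  qed (use z in simp)
  moreover have "(\<lambda>k. ?D (psi3 / 5 ^ k)) \<longlonglongrightarrow> ?D 0"
  proof (rule isCont_tendsto_compose[where g = ?D and l = 0])
    show "isCont ?D 0"
      using continuous_on_eval_fps'[of UNIV "\<lambda>x. x" "fps_deriv psi"]
        fps_conv_radius_deriv[of psi]
      by (auto simp: continuous_on_eq_continuous_at)
    show "(\<lambda>k. psi3 / 5 ^ k) \<longlonglongrightarrow> 0" by (rule div_pow5_tendsto_0)
  qed
  ultimately have "(\<lambda>k. 0) \<longlonglongrightarrow> ?D 0" by simp
  then have "?D 0 = 0" by (simp add: LIMSEQ_const_iff)
  then show False by (simp add: eval_fps_at_0)
qed

section \<open>The zeros of the infinite product\<close>

text \<open>For r \<le> 5 the discriminant 25 - 4 r is positive, so both preimages under s (5 - s)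
  are real, and they lie in [0, 5] again: the interval is backward invariant in the complex
  plane.\<close>

lemma Psi_preimage_real:
  fixes w :: complex
  assumes "Psi (5 * w) = of_real r" "0 \<le> r" "r \<le> 5"
  shows "\<exists>s. 0 \<le> s \<and> s \<le> 5 \<and> Psi w = of_real s"
proof -
  define d where "d = sqrt (25 - 4 * r)"
  have d2: "d\<^sup>2 = 25 - 4 * r" using assms by (simp add: d_def)
  have d: "0 \<le> d" "d \<le> 5" using assms unfolding d_def by (auto intro!: real_le_lsqrt)
  have "(Psi w - of_real ((5 + d) / 2)) * (Psi w - of_real ((5 - d) / 2))
      = of_real ((25 - d\<^sup>2) / 4) - Psi w * (5 - Psi w)"
    by (simp add: field_simps power2_eq_square)
  also have "\<dots> = 0" using assms(1) by (simp add: d2 Psi_5)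
  finally have "Psi w = of_real ((5 + d) / 2) \<or> Psi w = of_real ((5 - d) / 2)"
    by (metis eq_iff_diff_eq_0 mult_eq_0_iff)
  then show ?thesis using d
    by (elim disjE; intro exI[of _ "(5 + d) / 2"] exI[of _ "(5 - d) / 2"]) auto
qed

text \<open>Backward invariance of [0, 5] makes all Psi (z / 5^k) real and nonnegative, hence also
  their rescaled limit z; on the real axis \<open>psi3\<close> is the first solution.\<close>

lemma Psi_eq_3_unique:
  fixes z :: complex
  assumes "norm z \<le> psi3" "Psi z = 3"
  shows "z = of_real psi3"
proof -
  have "\<exists>s. 0 \<le> s \<and> s \<le> 5 \<and> Psi (z / 5 ^ k) = of_real s" for k
  proof (induction k)
    case 0
    show ?case using assms by (intro exI[of _ 3]) auto
  next
    case (Suc k)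
    have "5 * (z / 5 ^ Suc k) = z / 5 ^ k" by simp
    then show ?case using Suc Psi_preimage_real[of "z / 5 ^ Suc k"] by metis
  qed
  then obtain s where s: "\<And>k. 0 \<le> s k" "\<And>k. Psi (z / 5 ^ k) = of_real (s k)" by metis
  have "z \<in> \<real>\<^sub>\<ge>\<^sub>0"
  proof (rule closed_sequentially[OF closed_nonneg_Reals_complex _ pow5_Psi_tendsto[of z]])
    fix k
    have "5 ^ k * Psi (z / 5 ^ k) = of_real (5 ^ k * s k)" by (simp add: s(2))
    moreover have "5 ^ k * s k \<ge> 0" using s(1)[of k] by simp
    ultimately show "5 ^ k * Psi (z / 5 ^ k) \<in> \<real>\<^sub>\<ge>\<^sub>0"
      by (metis nonneg_Reals_of_real_iff)
  qed
  then obtain x where x: "x \<ge> 0" "z = of_real x" by (auto simp: nonneg_Reals_def)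
  then have "Psi x = (3::real)" using assms(2) Psi_of_real[of x, where 'a = complex]
    by (metis of_real_eq_iff of_real_numeral)
  moreover have "x \<le> psi3" using assms(1) x by simp
  ultimately show ?thesis using psi3(3)[of x] x by (cases "x = psi3") auto
qed

lemma Prd_div: "Prd z = (1 - Psi z / 3) * Prd (z / 5)"
  for z :: "'a::{banach, real_normed_field}"
proof -
  have "Prd z = eval_fps (rfps ((1 - fps_const (1/3) * psi) * fps_scale (1/5) prd)) z"
    unfolding Prd_def by (subst prd_eq) (rule refl)
  also have "\<dots> = eval_fps ((1 - fps_const (1/3) * rfps psi) * rfps (fps_scale (1/5) prd)) z"
    by (simp add: rfps_mult rfps_diff)
  also have "\<dots> = (1 - Psi z / 3) * eval_fps (rfps (fps_scale (1/5) prd)) z"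
  proof -
    have r1: "fps_conv_radius (fps_const (1/3) * rfps psi :: 'a fps) = \<infinity>"
      by (simp add: fps_conv_radius_cmult_left)
    have r2: "fps_conv_radius (1 - fps_const (1/3) * rfps psi :: 'a fps) = \<infinity>"
      using fps_conv_radius_diff[of 1 "fps_const (1/3) * rfps psi :: 'a fps"] r1 by simp
    have r3: "fps_conv_radius (fps_scale (1/5) prd) = \<infinity>"
    proof (rule fps_conv_radius_infI[where c = 5 and q = 5])
      fix n
      have "ereal (5 ^ n / (1/5)) \<le> fps_conv_radius (fps_scale (1/5) prd)"
        by (rule fps_conv_radius_scale_ge) auto
      then show "ereal (5 * 5 ^ n) \<le> fps_conv_radius (fps_scale (1/5) prd)" by (simp add: mult.commute)
    qed auto
    show ?thesis using r1 r2 r3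
      by (simp add: eval_fps_mult eval_fps_diff Psi_def)
  qed
  also have "eval_fps (rfps (fps_scale (1/5) prd)) z = Prd (z / 5)"
    by (simp add: rfps_scale eval_fps_scale Prd_def)
  finally show ?thesis .
qed

lemma Prd_0 [simp]: "Prd 0 = 1"
  by (simp add: Prd_def eval_fps_at_0)

lemma Prd_of_real: "Prd (of_real x :: 'a::{banach, real_normed_field}) = of_real (Prd x)"
  by (simp add: Prd_def eval_rfps_of_real)

lemma isCont_Prd: "isCont Prd (z :: 'a::{banach, real_normed_field})"
  using continuous_on_eval_fps'[of UNIV "\<lambda>x. x" "rfps prd :: 'a fps"]
  unfolding Prd_def[abs_def] by (auto simp: continuous_on_eq_continuous_at)

text \<open>At any other zero no factor of the product vanishes, so the zero is handed down to all z
  / 5^k, contradicting Prd 0 = 1. By the size of z, a factor with k > 0 cannot vanish.\<close>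

lemma Prd_eq_0_imp:
  fixes z :: complex
  assumes "norm z \<le> psi3" "Prd z = 0"
  shows "z = of_real psi3"
proof (rule ccontr)
  assume ne: "z \<noteq> of_real psi3"
  have "Prd (z / 5 ^ k) = 0" for k
  proof (induction k)
    case (Suc k)
    have le: "norm (z / 5 ^ k) \<le> norm z / 5 ^ k" by (simp add: norm_divide norm_power)
    have "Psi (z / 5 ^ k) \<noteq> 3"
    proof
      assume 3: "Psi (z / 5 ^ k) = 3"
      have "norm z / 5 ^ k \<le> norm z" by (simp add: divide_le_eq mult_le_cancel_left1)
      then have "z / 5 ^ k = of_real psi3" using le assms 3 by (intro Psi_eq_3_unique) auto
      then have "psi3 \<le> norm z / 5 ^ k" using le psi3(1) by simp
      then have "5 ^ k * psi3 \<le> psi3" using assms by (simp add: field_simps)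
      then have "k = 0" using psi3(1) by (simp add: mult_le_cancel_right2) (metis less_numeral_extra(3) linorder_not_less one_less_numeral_iff one_less_power semiring_norm(77) zero_less_iff_neq_zero)
      then show False using \<open>z / 5 ^ k = of_real psi3\<close> ne by simp
    qed
    then have "1 - Psi (z / 5 ^ k) / 3 \<noteq> 0" by (simp add: field_simps)
    then show ?case using Prd_div[of "z / 5 ^ k"] Suc by (simp add: mult.commute)
  qed (use assms in simp)
  moreover have "(\<lambda>k. Prd (z / 5 ^ k)) \<longlonglongrightarrow> Prd 0"
  proof (rule isCont_tendsto_compose[where g = Prd and l = 0, OF isCont_Prd])
    have "(\<lambda>k. norm (z / 5 ^ k)) \<longlonglongrightarrow> 0"
      using div_pow5_tendsto_0[of "norm z"] by (simp add: norm_divide norm_power)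
    then show "(\<lambda>k. z / 5 ^ k) \<longlonglongrightarrow> 0" by (rule tendsto_norm_zero_cancel)
  qed
  ultimately have "(\<lambda>k. 0) \<longlonglongrightarrow> (1::complex)" by simp
  then show False by (simp add: LIMSEQ_const_iff)
qed

lemma Prd_psi3: "Prd (psi3 :: real) = 0"
  using Prd_div[of psi3] psi3 by simp

text \<open>Only the factor k = 0 vanishes at \<open>psi3\<close>, and by
  \<open>Psi_deriv_psi3\<close> to first order.\<close>

lemma Prd_deriv_psi3: "deriv Prd (of_real psi3 :: complex) \<noteq> 0"
proof -
  let ?p = "of_real psi3 :: complex"
  have "Psi ?p = 3" by (simp add: Psi_of_real psi3)
  let ?dP = "eval_fps (fps_deriv (rfps psi)) ?p"
  have dp: "?dP = of_real (eval_fps (fps_deriv psi) psi3)"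
  proof -
    have "fps_deriv (rfps psi) = (rfps (fps_deriv psi) :: complex fps)"
      by (simp add: fps_eq_iff)
    moreover have "fps_conv_radius (fps_deriv psi) = \<infinity>"
      using fps_conv_radius_deriv[of psi] by simp
    ultimately show ?thesis by (simp add: eval_rfps_of_real)
  qed
  have d: "(Prd has_field_derivative D) (at ?p)" if "D = deriv Prd ?p" for D
  proof -
    have "Prd holomorphic_on UNIV"
      unfolding Prd_def[abs_def] by (intro holomorphic_intros) auto
    then show ?thesis using that holomorphic_derivI by blast
  qed
  have d5: "((\<lambda>z. Prd (z / 5)) has_field_derivative deriv (\<lambda>z. Prd (z / 5)) ?p) (at ?p)"
  proof -
    have "(Prd \<circ> (\<lambda>z. z / 5)) holomorphic_on UNIV"
    proof (rule holomorphic_on_compose_gen)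
      show "(Prd :: complex \<Rightarrow> complex) holomorphic_on UNIV"
        unfolding Prd_def[abs_def] by (intro holomorphic_intros) auto
    qed (auto intro!: holomorphic_intros)
    then have "(\<lambda>z::complex. Prd (z / 5)) holomorphic_on UNIV" by (simp add: o_def)
    then show ?thesis using holomorphic_derivI by blast
  qed
  have "((\<lambda>z. (1 - Psi z / 3) * Prd (z / 5)) has_field_derivative
      (1 - Psi ?p / 3) * deriv (\<lambda>z. Prd (z / 5)) ?p + (0 - ?dP / 3) * Prd (?p / 5)) (at ?p)"
    by (intro DERIV_mult' DERIV_diff DERIV_const DERIV_cdivide Psi_has_field_derivative d5)
  moreover have "(\<lambda>z::complex. (1 - Psi z / 3) * Prd (z / 5)) = Prd"
    by (rule ext) (rule Prd_div[symmetric])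
  ultimately have "deriv Prd ?p = (1 - Psi ?p / 3) * deriv (\<lambda>z. Prd (z / 5)) ?p + (0 - ?dP / 3) * Prd (?p / 5)"
    by (simp add: DERIV_imp_deriv)
  then have "deriv Prd ?p = - ?dP / 3 * Prd (?p / 5)"
    using \<open>Psi ?p = 3\<close> by simp
  moreover have "Prd (?p / 5) \<noteq> 0"
    using Prd_eq_0_imp[of "?p / 5"] psi3(1) by auto
  ultimately show ?thesis using dp Psi_deriv_psi3 by simp
qed

text \<open>The reciprocal of \<open>prd\<close> with its dominant pole removed.\<close>

definition prd_inv :: "real fps" where
  "prd_inv = (fps_X - fps_const psi3) * inverse prd"

lemma prd_inv_mult: "prd_inv * prd = fps_X - fps_const psi3"
proof -
  have "inverse prd * prd = 1" by (rule inverse_mult_eq_1) simp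
  then show ?thesis unfolding prd_inv_def by (simp add: mult.assoc)
qed

text \<open>The quotient of \<open>Prd\<close> by z - \<open>psi3\<close> is entire and has no zero
  in the closed disc, hence by compactness none in a larger disc. Its reciprocal has a power series
  there, which cancellation identifies with \<open>prd_inv\<close>.\<close>

lemma prd_inv_properties:
  "\<exists>r > psi3. ereal r \<le> fps_conv_radius prd_inv" "eval_fps prd_inv psi3 \<noteq> 0"
proof -
  let ?p = "of_real psi3 :: complex"
  define k :: "complex \<Rightarrow> complex" where
    "k = (\<lambda>z. if z = ?p then deriv Prd ?p else (Prd z - Prd ?p) / (z - ?p))"
  have Pp: "Prd ?p = 0" by (simp add: Prd_of_real Prd_psi3)
  have hP: "(Prd :: complex \<Rightarrow> complex) holomorphic_on UNIV"
    unfolding Prd_def[abs_def] by (intro holomorphic_intros) auto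
  have hk: "k holomorphic_on UNIV"
    unfolding k_def by (rule pole_lemma[OF hP]) simp
  have keq: "(z - ?p) * k z = Prd z" for z by (simp add: k_def Pp)
  have knz: "k z \<noteq> 0" if "norm z \<le> psi3" for z
    using that Prd_eq_0_imp[of z] Prd_deriv_psi3 keq[of z] by (cases "z = ?p") (auto simp: k_def)
  have "\<exists>r>psi3. \<forall>z. norm z < r \<longrightarrow> k z \<noteq> 0"
  proof -
    have ck: "continuous_on UNIV k" using hk by (rule holomorphic_on_imp_continuous_on)
    have "closed (UNIV \<inter> k -` {0})" by (rule continuous_closed_preimage[OF ck]) auto
    then have cl: "closed {z. k z = 0}" by (simp add: vimage_def)
    have disj: "cball 0 psi3 \<inter> {z. k z = 0} = {}" using knz by auto
    obtain d where d: "d > 0" "\<And>x y. x \<in> cball 0 psi3 \<Longrightarrow> y \<in> {z. k z = 0} \<Longrightarrow> d \<le> dist x y"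
      using separate_compact_closed[OF compact_cball cl disj] by blast
    show ?thesis
    proof (intro exI[of _ "psi3 + d"] conjI allI impI notI)
      fix z assume z: "norm z < psi3 + d" "k z = 0"
      then have gt: "norm z > psi3" using knz[of z] by force
      have "z \<noteq> 0" using gt psi3(1) by force
      \<comment> \<open>The radial projection of z to the disc is only norm z - \<open>psi3\<close>
        < d away from the zero z.\<close>
      let ?x = "of_real (psi3 / norm z) * z"
      have "?x \<in> cball 0 psi3" using \<open>z \<noteq> 0\<close> psi3(1) by (auto simp: norm_mult norm_divide)
      then have "d \<le> dist ?x z" using d(2) z(2) by auto
      also have "dist ?x z = norm (of_real (psi3 / norm z - 1) * z)"
        by (simp add: dist_norm algebra_simps)
      also have "\<dots> = norm z - psi3" using gt psi3(1) \<open>z \<noteq> 0\<close>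
        by (simp only: norm_mult norm_of_real) (simp add: abs_if field_simps)
      finally show False using z by simp
    qed (use d in simp)
  qed
  then obtain r where r: "r > psi3" "\<And>z. norm z < r \<Longrightarrow> k z \<noteq> 0" by blast
  define g where "g = (\<lambda>z. 1 / k z)"
  have hg: "g holomorphic_on eball 0 (ereal r)"
    unfolding g_def using r(2) holomorphic_on_subset[OF hk, of "ball 0 r"]
    by (auto intro!: holomorphic_intros)
  define V where "V = fps_expansion g 0"
  have rV: "ereal r \<le> fps_conv_radius V" unfolding V_def by (rule conv_radius_fps_expansion[OF hg])
  have eV: "eval_fps V z = g z" if "norm z < r" for z
    using eval_fps_expansion'[OF hg, of z] that by (simp add: V_def)
  have "V * rfps prd = rfps (fps_X - fps_const psi3)"
  proof (rule eval_fps_eqD)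
    have "ereal r \<le> fps_conv_radius (V * rfps prd)"
      using fps_conv_radius_mult[of V "rfps prd"] rV by (simp add: min_def split: if_splits)
    then show "0 < fps_conv_radius (V * rfps prd)"
      by (rule less_le_trans[rotated]) (use r(1) psi3(1) in simp)
    show "0 < fps_conv_radius (rfps (fps_X - fps_const psi3) :: complex fps)"
      using fps_conv_radius_diff[of fps_X "fps_const psi3"] by simp
    have "\<forall>\<^sub>F z in nhds 0. z \<in> ball 0 (r::real)"
      using r(1) psi3(1) by (intro eventually_nhds_in_open) auto
    then show "\<forall>\<^sub>F z in nhds 0. eval_fps (V * rfps prd) z = eval_fps (rfps (fps_X - fps_const psi3)) z"
    proof eventually_elim
      case (elim z)
      then have z: "norm z < r" by simp
      have "ereal (norm z) < fps_conv_radius V"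
        using less_le_trans[of "ereal (norm z)" "ereal r"] z rV by simp
      then have "eval_fps (V * rfps prd) z = g z * Prd z"
        using z by (subst eval_fps_mult) (auto simp: eV Prd_def)
      also have "\<dots> = z - ?p" using keq[of z] r(2)[OF z] by (simp add: g_def field_simps)
      also have "\<dots> = eval_fps (rfps (fps_X - fps_const psi3)) z"
        by (simp add: rfps_diff eval_fps_diff)
      finally show ?case .
    qed
  qed
  also have "\<dots> = rfps prd_inv * rfps prd" by (simp add: prd_inv_mult flip: rfps_mult)
  finally have "V = rfps prd_inv"
  proof -
    assume "V * rfps prd = rfps prd_inv * rfps prd"
    moreover have "(rfps prd :: complex fps) \<noteq> 0"
      by (metis fps_zero_nth of_real_1 one_neq_zero prd_coeff_0 prd_nth rfps_nth)
    ultimately show ?thesis by simp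
  qed
  then show "\<exists>r > psi3. ereal r \<le> fps_conv_radius prd_inv"
    using rV r(1) by (intro exI[of _ r]) simp
  have "of_real (eval_fps prd_inv psi3) = eval_fps V ?p"
    using \<open>V = rfps prd_inv\<close> rV r(1) psi3(1)
    by (simp add: eval_rfps_of_real less_le_trans[of _ "ereal r"])
  also have "\<dots> = g ?p" using r(1) psi3(1) by (intro eV) simp
  also have "\<dots> \<noteq> 0" unfolding g_def using knz[of ?p] psi3(1) by simp
  finally show "eval_fps prd_inv psi3 \<noteq> 0" by auto
qed

section \<open>Geometry of the gasket\<close>

lemma three_eq_0: "(3::3) = 0"
  by simp

lemma exhaust_3': "k = 0 \<or> k = 1 \<or> k = (2::3)"
  using exhaust_3[of k] by auto

lemma UNIV_3': "(UNIV :: 3 set) = {0, 1, 2}"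
proof (rule UNIV_eq_I)
  fix k :: 3
  show "k \<in> {0, 1, 2}" using exhaust_3'[of k] by simp
qed

lemma neq_3 [simp]: "(0::3) \<noteq> 1" "(0::3) \<noteq> 2" "(1::3) \<noteq> 0" "(1::3) \<noteq> 2" "(2::3) \<noteq> 0" "(2::3) \<noteq> 1"
  by simp_all

lemma sum_3': "sum f (UNIV :: 3 set) = f 0 + f 1 + f 2"
  for f :: "3 \<Rightarrow> 'a::comm_monoid_add"
  by (simp only: sum_3 three_eq_0 add_ac)

locale gasket =
  fixes q :: "3 \<Rightarrow> real^2"
  assumes equilateral: "equilateral q"
begin

abbreviation F :: "3 \<Rightarrow> real^2 \<Rightarrow> real^2" where "F \<equiv> sg_map q"

abbreviation V :: "nat \<Rightarrow> (real^2) set" where "V \<equiv> sg_vertices q"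

definition side2 :: real where "side2 = (dist (q 0) (q 1))\<^sup>2"

text \<open>Barycentric coordinates as inner products around the centroid c. The formula is right
  for an equilateral triangle, where (q j - c) \<bullet> (q i - c) is \<open>side2\<close> times 1/3
  or -1/6.\<close>

definition bary :: "3 \<Rightarrow> real^2 \<Rightarrow> real" where
  "bary i x = 1/3 + 2 / side2 * ((x - (1/3) *\<^sub>R (q 0 + q 1 + q 2)) \<bullet> (q i - (1/3) *\<^sub>R (q 0 + q 1 + q 2)))"

lemma side2_pos: "side2 > 0"
proof -
  obtain s where s: "s > 0" "\<forall>i j. i \<noteq> j \<longrightarrow> dist (q i) (q j) = s"
    using equilateral unfolding equilateral_def by auto
  have "dist (q 0) (q 1) = s" using s(2)[rule_format, OF neq_3(1)] .
  then have "dist (q 0) (q 1) > 0" using s(1) by simp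
  then show ?thesis by (simp add: side2_def)
qed

lemma bary_vertex [simp]: "bary i (q j) = of_bool (i = j)"
proof -
  obtain s where s: "\<And>i j. i \<noteq> j \<Longrightarrow> dist (q i) (q j) = s"
    using equilateral unfolding equilateral_def by blast
  have d: "q i \<bullet> q i + q j \<bullet> q j - 2 * (q i \<bullet> q j) = side2" if "i \<noteq> j" for i j
  proof -
    have "side2 = (q i - q j) \<bullet> (q i - q j)"
      using s[OF that] s[of 0 1] power2_norm_eq_inner[of "q i - q j"]
      by (simp add: side2_def dist_norm)
    then show ?thesis by (simp add: inner_diff inner_commute)
  qed
  have "(q j - (1/3) *\<^sub>R (q 0 + q 1 + q 2)) \<bullet> (q i - (1/3) *\<^sub>R (q 0 + q 1 + q 2))
     = side2 * (of_bool (i = j) / 2 - 1/6)"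
    using exhaust_3'[of i] exhaust_3'[of j] d[of 0 1] d[of 0 2] d[of 1 2]
    by (elim disjE) (simp_all add: inner_diff inner_add inner_commute field_simps)
  then show ?thesis using side2_pos by (simp add: bary_def field_simps)
qed

lemma bary_F [simp]: "bary i (F k x) = (bary i x + of_bool (i = k)) / 2"
proof -
  have "F k x - c = (1/2) *\<^sub>R ((x - c) + (q k - c))" for c
    by (simp add: sg_map_def vec_eq_iff field_simps)
  moreover have "1/3 + t * ((1/2) * (a + b)) = ((1/3 + t * a) + (1/3 + t * b)) / 2" for t a b :: real
    by (simp add: field_simps)
  ultimately have "bary i (F k x) = (bary i x + bary i (q k)) / 2"
    unfolding bary_def by (simp only: inner_scaleR_left inner_add_left)
  then show ?thesis by simp
qed

lemma continuous_on_bary [continuous_intros]: "continuous_on A (bary i)"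
  unfolding bary_def[abs_def]
  by (intro continuous_on_add continuous_on_mult continuous_on_const continuous_on_inner
      continuous_on_diff continuous_on_id)

lemma sum_bary: "bary 0 x + bary 1 x + bary 2 x = 1"
proof -
  let ?c = "(1/3) *\<^sub>R (q 0 + q 1 + q 2)"
  have "(q 0 - ?c) + (q 1 - ?c) + (q 2 - ?c) = 0" by (simp add: vec_eq_iff field_simps)
  then have "(x - ?c) \<bullet> (q 0 - ?c) + (x - ?c) \<bullet> (q 1 - ?c) + (x - ?c) \<bullet> (q 2 - ?c) = 0"
    by (simp only: inner_add_right[symmetric]) (simp only: inner_zero_right)
  moreover have "1/3 + t * a + (1/3 + t * b) + (1/3 + t * c) = 1 + t * (a + b + c)" for t a b c :: real
    by (simp add: algebra_simps)
  ultimately show ?thesis unfolding bary_def by (simp only: mult_zero_right add_0_right)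
qed

lemma F_inject [simp]: "F k x = F k y \<longleftrightarrow> x = y"
  by (simp add: sg_map_def)

lemma F_vertex [simp]: "F k (q k) = q k"
  by (simp add: sg_map_def)

lemma F_vertex_commute: "F k (q j) = F j (q k)"
  by (simp add: sg_map_def add.commute)

lemma F_inverse: "2 *\<^sub>R F k x - q k = x"
  by (simp add: sg_map_def)

lemma continuous_on_F [continuous_intros]: "continuous_on A (F k)"
  unfolding sg_map_def[abs_def] by (intro continuous_intros)

lemma dist_F: "dist (F k x) (F k y) = dist x y / 2"
proof -
  have "F k x - F k y = (1/2) *\<^sub>R (x - y)" by (simp add: sg_map_def algebra_simps)
  then show ?thesis by (simp add: dist_norm)
qed

section \<open>The gasket as the closure of its vertices\<close>

lemma vertices_mono_Suc: "V m \<subseteq> V (Suc m)"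
proof (induction m)
  case 0
  have "q k \<in> F k ` range q" for k
    using imageI[of "q k" "range q" "F k"] by simp
  then show ?case by auto
next
  case (Suc m)
  show ?case
  proof
    fix x assume "x \<in> V (Suc m)"
    then obtain k y where y: "x = F k y" "y \<in> V m" by auto
    then have "y \<in> V (Suc m)" using Suc by blast
    then show "x \<in> V (Suc (Suc m))"
      unfolding y by (subst sg_vertices.simps(2)) (auto simp del: sg_vertices.simps)
  qed
qed

lemma vertices_mono: "m \<le> n \<Longrightarrow> V m \<subseteq> V n"
  by (rule lift_Suc_mono_le[of V, OF vertices_mono_Suc])

lemma finite_vertices: "finite (V m)"
  by (induction m) auto

text \<open>Each \<open>F i\<close> halves distances, so a point of K farthest from L would have a
  preimage in K at least twice as far away. This gives the uniqueness of the attractor and carries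
  closed properties stable under the maps over to the gasket.\<close>

lemma attractor_subset:
  assumes "compact K" "K \<subseteq> (\<Union>i. F i ` K)" "closed L" "L \<noteq> {}" "\<And>i. F i ` L \<subseteq> L"
  shows "K \<subseteq> L"
proof (cases "K = {}")
  case False
  have "continuous_on K (\<lambda>x. infdist x L)" by (intro continuous_intros)
  then obtain x where x: "x \<in> K" "\<And>y. y \<in> K \<Longrightarrow> infdist y L \<le> infdist x L"
    using continuous_attains_sup[OF assms(1) False, of "\<lambda>x. infdist x L"] by blast
  obtain i y where y: "y \<in> K" "x = F i y" using x(1) assms(2) by blast
  obtain l where l: "l \<in> L" "infdist y L = dist y l"
    using infdist_attains_inf[OF assms(3,4)] by metis
  have "infdist x L \<le> dist x (F i l)" using l(1) assms(5) by (intro infdist_le) auto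
  also have "\<dots> = infdist y L / 2" by (simp add: y l dist_F)
  finally have "infdist x L \<le> 0" using x(2)[OF y(1)] by simp
  then have "infdist z L = 0" if "z \<in> K" for z
    using x(2)[OF that] infdist_nonneg[of z L] by linarith
  then show ?thesis using in_closed_iff_infdist_zero[OF assms(3,4)] by blast
qed auto

lemma SG_char: "SG q = closure (\<Union>m. V m)" "compact (SG q)" "SG q = (\<Union>i. F i ` SG q)"
proof -
  let ?U = "\<Union>m. V m"
  define B where "B = Max (range (\<lambda>i. norm (q i)))"
  have B: "norm (q i) \<le> B" for i unfolding B_def by (rule Max_ge) auto
  have "norm x \<le> B" if "x \<in> V m" for x m
    using that
  proof (induction m arbitrary: x)
    case 0
    then show ?case using B by auto
  next
    case (Suc m)
    then obtain i y where y: "x = F i y" "y \<in> V m" by auto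
    have "norm x \<le> (norm y + norm (q i)) / 2"
      unfolding y sg_map_def using norm_triangle_ineq[of y "q i"] by simp
    then show ?case using Suc.IH[OF y(2)] B[of i] by simp
  qed
  then have "bounded ?U" by (auto simp: bounded_iff)
  then have comp: "compact (closure ?U)" by (simp add: compact_closure)
  have inv: "(\<Union>i. F i ` ?U) \<subseteq> ?U" using sg_vertices.simps(2) by blast
  have sub: "?U \<subseteq> (\<Union>i. F i ` ?U)"
  proof
    fix x assume "x \<in> ?U"
    then obtain m where "x \<in> V (Suc m)" using vertices_mono_Suc by blast
    then show "x \<in> (\<Union>i. F i ` ?U)" by auto
  qed
  have 1: "F i ` closure ?U \<subseteq> closure ?U" for i
  proof (rule image_closure_subset[OF continuous_on_F closed_closure])
    show "F i ` ?U \<subseteq> closure ?U" using inv closure_subset[of ?U] by blast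
  qed
  have "closed (F i ` closure ?U)" for i
    by (intro compact_imp_closed compact_continuous_image continuous_on_F comp)
  then have "closed (\<Union>i. F i ` closure ?U)" by (intro closed_UN) auto
  moreover have "?U \<subseteq> (\<Union>i. F i ` closure ?U)"
    by (rule order.trans[OF sub]) (intro UN_mono image_mono closure_subset order_refl)
  ultimately have 2: "closure ?U \<subseteq> (\<Union>i. F i ` closure ?U)" by (rule closure_minimal[rotated])
  have eq: "closure ?U = (\<Union>i. F i ` closure ?U)"
    by (rule subset_antisym[OF 2 UN_least[OF 1]])
  have ne: "closure ?U \<noteq> {}" using closure_subset[of ?U] by (auto intro: exI[of _ "0::nat"])
  have SG: "SG q = closure ?U"
    unfolding SG_def
  proof (rule the_equality)
    show "closure ?U \<noteq> {} \<and> compact (closure ?U) \<and> closure ?U = (\<Union>i. F i ` closure ?U)"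
      by (intro conjI eq ne comp)
  next
    fix K assume K: "K \<noteq> {} \<and> compact K \<and> K = (\<Union>i. F i ` K)"
    note K1 = conjunct1[OF K] and K2 = conjunct1[OF conjunct2[OF K]]
      and K3 = conjunct2[OF conjunct2[OF K]]
    show "K = closure ?U"
    proof
      show "K \<subseteq> closure ?U"
        by (rule attractor_subset[OF K2 equalityD1[OF K3] closed_closure ne 1])
      show "closure ?U \<subseteq> K"
        by (rule attractor_subset[OF comp 2 compact_imp_closed[OF K2] K1])
          (use equalityD2[OF K3] in blast)
    qed
  qed
  show "SG q = closure ?U" "compact (SG q)" "SG q = (\<Union>i. F i ` SG q)"
    unfolding SG by (rule refl comp eq)+
qed

lemma vertices_subset_SG: "V m \<subseteq> SG q"
  unfolding SG_char(1) by (rule order.trans[OF UN_upper closure_subset]) simp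

lemma vertex_in_SG [simp]: "q i \<in> SG q"
  by (rule subsetD[OF vertices_subset_SG[of 0]]) simp

lemma F_in_SG [simp]: "x \<in> SG q \<Longrightarrow> F k x \<in> SG q"
  by (rule subsetD[OF equalityD2[OF SG_char(3)]], rule UN_I[OF UNIV_I], rule imageI)

lemma SG_cases:
  assumes "x \<in> SG q" obtains k y where "x = F k y" "y \<in> SG q"
  using subsetD[OF equalityD1[OF SG_char(3)] assms] that by (elim UN_E imageE)

text \<open>Both properties are closed and stable under every \<open>F k\<close>, so
  \<open>attractor_subset\<close> applies. Points of the gasket can then be compared by
  coordinates.\<close>

lemma SG_bary:
  assumes "x \<in> SG q"
  shows "bary i x \<ge> 0" and "x = (\<Sum>i\<in>UNIV. bary i x *\<^sub>R q i)"
proof -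
  let ?L = "{x. (\<forall>i. bary i x \<ge> 0) \<and> x = (\<Sum>i\<in>UNIV. bary i x *\<^sub>R q i)}"
  have cl: "closed ?L"
    by (intro closed_Collect_conj closed_Collect_all closed_Collect_le closed_Collect_eq
        continuous_intros)
  have mem: "q 0 \<in> ?L" by (simp add: sum_3')
  have inv: "F k ` ?L \<subseteq> ?L" for k
  proof safe
    fix x assume x: "\<forall>i. bary i x \<ge> 0" "x = (\<Sum>i\<in>UNIV. bary i x *\<^sub>R q i)"
    show "bary i (F k x) \<ge> 0" for i using x(1) by simp
    have "(\<Sum>i\<in>UNIV. bary i (F k x) *\<^sub>R q i)
        = (1/2) *\<^sub>R ((\<Sum>i\<in>UNIV. bary i x *\<^sub>R q i) + (\<Sum>i\<in>UNIV. of_bool (i = k) *\<^sub>R q i))"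
      by (simp add: scaleR_right_distrib scaleR_right.sum sum.distrib scaleR_add_left add_divide_distrib)
    also have "(\<Sum>i\<in>UNIV. of_bool (i = k) *\<^sub>R q i) = q k"
      using exhaust_3'[of k] by (auto simp: sum_3')
    also have "(\<Sum>i\<in>UNIV. bary i x *\<^sub>R q i) = x" by (rule x(2)[symmetric])
    finally show "F k x = (\<Sum>i\<in>UNIV. bary i (F k x) *\<^sub>R q i)"
      by (simp add: sg_map_def)
  qed
  have "?L \<noteq> {}" using mem by blast
  then have "SG q \<subseteq> ?L"
    by (rule attractor_subset[OF SG_char(2) equalityD1[OF SG_char(3)] cl _ inv])
  then show "bary i x \<ge> 0" "x = (\<Sum>i\<in>UNIV. bary i x *\<^sub>R q i)" using assms by auto
qed

lemma SG_eqI: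
  assumes "x \<in> SG q" "y \<in> SG q" "\<And>i. bary i x = bary i y"
  shows "x = y"
proof -
  have "x = (\<Sum>i\<in>UNIV. bary i x *\<^sub>R q i)" by (rule SG_bary(2)[OF assms(1)])
  also have "\<dots> = (\<Sum>i\<in>UNIV. bary i y *\<^sub>R q i)" by (simp add: assms(3))
  also have "\<dots> = y" by (rule SG_bary(2)[OF assms(2), symmetric])
  finally show ?thesis .
qed

lemma bary_le_1:
  assumes "x \<in> SG q" shows "bary i x \<le> 1"
proof -
  have "bary 0 x \<ge> 0" "bary 1 x \<ge> 0" "bary 2 x \<ge> 0" using SG_bary(1)[OF assms] by auto
  then show ?thesis
    using sum_bary[of x] exhaust_3'[of i] by (elim disjE; simp)
qed

lemma bary_eq_1_imp:
  assumes "x \<in> SG q" "bary i x = 1" shows "x = q i"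
proof (rule SG_eqI[OF assms(1)])
  fix j
  have "bary 0 x \<ge> 0" "bary 1 x \<ge> 0" "bary 2 x \<ge> 0" using SG_bary(1)[OF assms(1)] by auto
  then show "bary j x = bary j (q i)"
    using sum_bary[of x] assms(2) exhaust_3'[of i] exhaust_3'[of j]
    by (elim disjE; simp)
qed auto

lemma F_eq_vertex_iff: "x \<in> SG q \<Longrightarrow> F k x = q i \<longleftrightarrow> k = i \<and> x = q i"
proof
  assume x: "x \<in> SG q" "F k x = q i"
  have "(bary i x + of_bool (i = k)) / 2 = 1" using x(2) bary_F[of i k x] by simp
  then have "i = k" "bary i x = 1" using bary_le_1[OF x(1), of i] by (cases "i = k"; simp)+
  then show "k = i \<and> x = q i" using bary_eq_1_imp x by auto
qed auto

text \<open>The j-th coordinate is at least 1/2 on cell j and at most 1/2 on the other cells. At a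
  common point it is 1/2, which forces the preimage in the other cell to be the corner j.\<close>

lemma F_eq_F_imp:
  assumes "x \<in> SG q" "y \<in> SG q" "F k x = F j y" "k \<noteq> j"
  shows "x = q j" "y = q k"
proof -
  have e: "bary i x + of_bool (i = k) = bary i y + of_bool (i = j)" for i
    using arg_cong[OF assms(3), of "bary i"] by simp
  have "bary j x = 1" using e[of j] assms(4) SG_bary(1)[OF assms(2), of j] bary_le_1[OF assms(1), of j]
    by simp
  then show "x = q j" using bary_eq_1_imp assms by simp
  have "bary k y = 1" using e[of k] assms(4) SG_bary(1)[OF assms(1), of k] bary_le_1[OF assms(2), of k]
    by simp
  then show "y = q k" using bary_eq_1_imp assms by simp
qed

lemma F_mem_vertices_Suc: "x \<in> V m \<Longrightarrow> F k x \<in> V (Suc m)"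
  by auto

lemma vertex_mem [simp]: "q i \<in> V m"
  using vertices_mono[of 0 m] by auto

lemma F_mem_vertices_iff: "x \<in> SG q \<Longrightarrow> F k x \<in> V (Suc m) \<longleftrightarrow> x \<in> V m"
proof
  assume x: "x \<in> SG q" "F k x \<in> V (Suc m)"
  then obtain j y where y: "F k x = F j y" "y \<in> V m" by auto
  have "y \<in> SG q" using y(2) vertices_subset_SG by blast
  then show "x \<in> V m"
    using F_eq_F_imp(1)[OF x(1) _ y(1)] y vertices_mono[of 0 m] by (cases "k = j") auto
qed auto

lemma F_not_vertex: "x \<in> SG q \<Longrightarrow> x \<notin> V 0 \<Longrightarrow> F k x \<notin> V 0"
  using F_eq_vertex_iff by auto

lemma junction_not_vertex: "k \<noteq> j \<Longrightarrow> F k (q j) \<notin> V 0"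
proof
  assume "k \<noteq> j" "F k (q j) \<in> V 0"
  then obtain i where "F k (q j) = q i" by auto
  then have "k = i \<and> q j = q i" using F_eq_vertex_iff vertex_in_SG by blast
  then show False using \<open>k \<noteq> j\<close> bary_vertex[of i j] bary_vertex[of i i] by auto
qed

lemma q_inject [simp]: "q i = q j \<longleftrightarrow> i = j"
  by (metis F_eq_vertex_iff F_vertex vertex_in_SG)

text \<open>The three kinds of vertices behave differently under subdivision: only at a junction do
  two cells contribute to the discrete operators.\<close>

lemma vertices_Suc_cases [consumes 1, case_names interior corner junction]:
  assumes "x \<in> V (Suc m)"
  obtains k y where "x = F k y" "y \<in> V m" "y \<notin> V 0"
    | k where "x = q k"
    | k j where "x = F k (q j)" "k \<noteq> j"
proof -
  obtain k y where y: "x = F k y" "y \<in> V m" using assms by auto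
  show thesis
  proof (cases "y \<in> V 0")
    case True
    then obtain j where j: "x = F k (q j)" using y(1) by auto
    show ?thesis
    proof (cases "k = j")
      case True
      then show ?thesis using that(2)[of j] j by simp
    next
      case False
      then show ?thesis using that(3)[OF j] by simp
    qed
  qed (rule that(1)[OF y])
qed

lemma dense_vertices:
  assumes "continuous_on (SG q) u" "continuous_on (SG q) v"
    "\<And>m x. x \<in> V m \<Longrightarrow> u x = v x" "x \<in> SG q"
  shows "u x = (v x :: real)"
proof -
  have "closed {x \<in> SG q. u x = v x}"
    using continuous_closed_preimage_constant[of "SG q" "\<lambda>x. u x - v x" 0] SG_char(2)
    by (simp add: continuous_on_diff assms compact_imp_closed)
  moreover have "(\<Union>m. V m) \<subseteq> {x \<in> SG q. u x = v x}"
    using vertices_subset_SG assms(3) by auto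
  ultimately have "closure (\<Union>m. V m) \<subseteq> {x \<in> SG q. u x = v x}" by (rule closure_minimal[rotated])
  then show ?thesis using assms(4) SG_char(1) by auto
qed

lemma F_pow_tendsto: "(\<lambda>m. (F k ^^ m) x) \<longlonglongrightarrow> q k"
proof -
  have "dist ((F k ^^ m) x) (q k) = dist x (q k) / 2 ^ m" for m
  proof (induction m)
    case (Suc m)
    have "dist ((F k ^^ Suc m) x) (q k) = dist (F k ((F k ^^ m) x)) (F k (q k))" by simp
    also have "\<dots> = dist x (q k) / 2 ^ Suc m" unfolding dist_F Suc by simp
    finally show ?case .
  qed simp
  then have "(\<lambda>m. dist ((F k ^^ m) x) (q k)) = (\<lambda>m. dist x (q k) * (1/2) ^ m)"
    by (simp add: power_divide)
  moreover have "(\<lambda>m. dist x (q k) * (1/2) ^ m) \<longlonglongrightarrow> 0"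
    by (intro tendsto_mult_right_zero LIMSEQ_power_zero) simp
  ultimately show ?thesis by (subst tendsto_dist_iff) simp
qed

text \<open>The Laplacian is controlled only off \<open>V 0\<close>. A corner q k is the limit of
  the points (F k ^^ m) (q (k + 1)), which are not corners for m > 0.\<close>

lemma dense_interior_vertices:
  assumes "continuous_on (SG q) u" "continuous_on (SG q) v"
    "\<And>m x. x \<in> V m \<Longrightarrow> x \<notin> V 0 \<Longrightarrow> u x = v x" "x \<in> SG q"
  shows "u x = (v x :: real)"
proof (rule dense_vertices[OF assms(1,2) _ assms(4)])
  fix m x assume x: "x \<in> V m"
  show "u x = v x"
  proof (cases "x \<in> V 0")
    case True
    then obtain k where k: "x = q k" by auto
    have mem: "(F k ^^ m) (q (k + 1)) \<in> V m" for m by (induction m) auto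
    have ni: "(F k ^^ m) (q (k + 1)) \<notin> V 0" if "m > 0" for m
      using that
    proof (induction m)
      case (Suc m)
      then show ?case
        using F_not_vertex[OF vertices_subset_SG[THEN subsetD, OF mem[of m]]] junction_not_vertex[of k "k + 1"]
        by (cases m) auto
    qed simp
    have lim: "(\<lambda>m. w ((F k ^^ m) (q (k + 1)))) \<longlonglongrightarrow> w (q k)" if "continuous_on (SG q) w" for w :: "real^2 \<Rightarrow> real"
      by (intro continuous_on_tendsto_compose[OF that F_pow_tendsto] always_eventually allI
          subsetD[OF vertices_subset_SG mem] vertex_in_SG)
    have "\<forall>\<^sub>F m in sequentially. u ((F k ^^ m) (q (k + 1))) = v ((F k ^^ m) (q (k + 1)))"
      using eventually_gt_at_top[of 0] by eventually_elim (use assms(3) mem ni in blast)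
    then have "(\<lambda>m. v ((F k ^^ m) (q (k + 1)))) \<longlonglongrightarrow> u (q k)"
      using lim[OF assms(1)] by (rule Lim_transform_eventually[rotated])
    then show ?thesis using lim[OF assms(2)] k LIMSEQ_unique by blast
  qed (use x assms(3) in blast)
qed

end

section \<open>Discrete Laplacians under subdivision\<close>

lemma sum_neq_3:
  fixes f :: "3 \<Rightarrow> 'a::comm_monoid_add"
  shows "sum f (UNIV - {0}) = f 1 + f 2" "sum f (UNIV - {1}) = f 0 + f 2" "sum f (UNIV - {2}) = f 0 + f 1"
proof -
  have "UNIV - {0} = {1, 2::3}" "UNIV - {1} = {0, 2::3}" "UNIV - {2} = {0, 1::3}"
    unfolding UNIV_3' by auto
  then show "sum f (UNIV - {0}) = f 1 + f 2" "sum f (UNIV - {1}) = f 0 + f 2" "sum f (UNIV - {2}) = f 0 + f 1"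
    by simp_all
qed

context gasket
begin

section \<open>Adjacency under subdivision\<close>

lemma word_map_Nil [simp]: "sg_word_map q [] = id"
  by (simp add: sg_word_map_def)

lemma word_map_Cons [simp]: "sg_word_map q (k # w) x = F k (sg_word_map q w x)"
  by (simp add: sg_word_map_def)

lemma word_map_in_SG: "x \<in> SG q \<Longrightarrow> sg_word_map q w x \<in> SG q"
  by (induction w) auto

lemma adj_Suc:
  "sg_adj q (Suc m) x y \<longleftrightarrow> (\<exists>k x' y'. x = F k x' \<and> y = F k y' \<and> sg_adj q m x' y')"
proof
  assume a: "sg_adj q (Suc m) x y"
  then obtain w where w: "length w = Suc m" "x \<in> sg_word_map q w ` SG q" "y \<in> sg_word_map q w ` SG q"
    unfolding sg_adj_def by blast
  then obtain k w' where kw: "w = k # w'" "length w' = m" by (cases w) auto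
  obtain s where s: "s \<in> SG q" "x = F k (sg_word_map q w' s)" using w(2) kw(1) by auto
  obtain t where t: "t \<in> SG q" "y = F k (sg_word_map q w' t)" using w(3) kw(1) by auto
  have "sg_word_map q w' s \<in> V m"
    using a s F_mem_vertices_iff[OF word_map_in_SG[OF s(1)], of k w' m] by (simp add: sg_adj_def)
  moreover have "sg_word_map q w' t \<in> V m"
    using a t F_mem_vertices_iff[OF word_map_in_SG[OF t(1)], of k w' m] by (simp add: sg_adj_def)
  ultimately have "sg_adj q m (sg_word_map q w' s) (sg_word_map q w' t)"
    using a s t kw(2) unfolding sg_adj_def by auto
  then show "\<exists>k x' y'. x = F k x' \<and> y = F k y' \<and> sg_adj q m x' y'" using s(2) t(2) by blast
next
  assume "\<exists>k x' y'. x = F k x' \<and> y = F k y' \<and> sg_adj q m x' y'"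
  then obtain k x' y' where xy: "x = F k x'" "y = F k y'" "sg_adj q m x' y'" by blast
  then obtain w where w: "length w = m" "x' \<in> sg_word_map q w ` SG q" "y' \<in> sg_word_map q w ` SG q"
    unfolding sg_adj_def by blast
  have "length (k # w) = Suc m" "x \<in> sg_word_map q (k # w) ` SG q" "y \<in> sg_word_map q (k # w) ` SG q"
    using w xy(1,2) by auto
  moreover have "x \<in> V (Suc m)" "y \<in> V (Suc m)" "x \<noteq> y"
    using xy by (auto simp: sg_adj_def)
  ultimately show "sg_adj q (Suc m) x y" unfolding sg_adj_def by blast
qed

lemma adj_0: "sg_adj q 0 (q i) y \<longleftrightarrow> y \<in> q ` (UNIV - {i})"
  by (auto simp: sg_adj_def)

lemma adj_mem: "sg_adj q m x y \<Longrightarrow> x \<in> SG q \<and> y \<in> SG q \<and> x \<noteq> y"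
  using vertices_subset_SG unfolding sg_adj_def by blast

lemma finite_adj [simp]: "finite {y. sg_adj q m x y}"
  by (rule finite_subset[OF _ finite_vertices[of m]]) (auto simp: sg_adj_def)

lemma adj_Suc_interior:
  assumes "x \<in> V m" "x \<notin> V 0"
  shows "{y. sg_adj q (Suc m) (F k x) y} = F k ` {y. sg_adj q m x y}"
proof -
  have "j = k \<and> x' = x" if "F k x = F j x'" "x' \<in> SG q" for j x'
    using F_eq_F_imp(1)[OF subsetD[OF vertices_subset_SG assms(1)] that(2,1)] that assms(2)
    by (cases "k = j") auto
  then show ?thesis unfolding adj_Suc using adj_mem by blast
qed

lemma adj_Suc_corner: "{y. sg_adj q (Suc m) (q k) y} = F k ` {y. sg_adj q m (q k) y}"
proof -
  have "j = k \<and> x' = q k" if "q k = F j x'" "x' \<in> SG q" for j x'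
    using iffD1[OF F_eq_vertex_iff[OF that(2)] that(1)[symmetric]] .
  moreover have "q k = F k (q k)" by simp
  ultimately show ?thesis unfolding adj_Suc using adj_mem by blast
qed

lemma adj_Suc_junction:
  assumes "k \<noteq> j"
  shows "{y. sg_adj q (Suc m) (F k (q j)) y}
       = F k ` {y. sg_adj q m (q j) y} \<union> F j ` {y. sg_adj q m (q k) y}"
    and "F k ` {y. sg_adj q m (q j) y} \<inter> F j ` {y. sg_adj q m (q k) y} = {}"
proof -
  have *: "(i = k \<and> x' = q j) \<or> (i = j \<and> x' = q k)" if "F k (q j) = F i x'" "x' \<in> SG q" for i x'
  proof (cases "i = k")
    case False
    then have "q j = q i" "x' = q k" using F_eq_F_imp[OF vertex_in_SG that(2,1)] by auto
    then show ?thesis by simp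
  qed (use that in simp)
  show "{y. sg_adj q (Suc m) (F k (q j)) y}
       = F k ` {y. sg_adj q m (q j) y} \<union> F j ` {y. sg_adj q m (q k) y}" (is "?L = ?R")
  proof
    show "?L \<subseteq> ?R"
    proof
      fix y assume "y \<in> ?L"
      then obtain i x' y' where i: "F k (q j) = F i x'" "y = F i y'" "sg_adj q m x' y'"
        unfolding adj_Suc by blast
      show "y \<in> ?R" using *[OF i(1)] adj_mem[OF i(3)] i(2,3) by blast
    qed
    show "?R \<subseteq> ?L"
    proof
      fix y assume "y \<in> ?R"
      then consider y' where "y = F k y'" "sg_adj q m (q j) y'" | y' where "y = F j y'" "sg_adj q m (q k) y'"
        by blast
      then show "y \<in> ?L"
      proof cases
        case 1
        then show ?thesis unfolding adj_Suc by blast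
      next
        case 2
        then show ?thesis unfolding adj_Suc F_vertex_commute[of k j] by blast
      qed
    qed
  qed
  show "F k ` {y. sg_adj q m (q j) y} \<inter> F j ` {y. sg_adj q m (q k) y} = {}"
  proof (rule ccontr)
    assume "\<not> ?thesis"
    then obtain y y' where y: "sg_adj q m (q j) y" "sg_adj q m (q k) y'" "F k y = F j y'" by blast
    then have "y = q j" using F_eq_F_imp(1)[of y y' k j] adj_mem assms by blast
    then show False using adj_mem[OF y(1)] by blast
  qed
qed

definition lap :: "nat \<Rightarrow> (real^2 \<Rightarrow> 'a::comm_ring_1) \<Rightarrow> real^2 \<Rightarrow> 'a" where
  "lap m u x = (\<Sum>y | sg_adj q m x y. u y - u x)"

lemma inj_F: "inj_on (F k) A"
  by (auto simp: inj_on_def)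

lemma lap_0: "lap 0 u (q i) = (\<Sum>j\<in>UNIV - {i}. u (q j) - u (q i))"
proof -
  have "{y. sg_adj q 0 (q i) y} = q ` (UNIV - {i})" using adj_0 by blast
  moreover have "inj_on q (UNIV - {i})" by (auto simp: inj_on_def)
  ultimately show ?thesis by (simp add: lap_def sum.reindex)
qed

lemma lap_Suc_interior:
  "x \<in> V m \<Longrightarrow> x \<notin> V 0 \<Longrightarrow> lap (Suc m) u (F k x) = lap m (u \<circ> F k) x"
  by (simp add: lap_def adj_Suc_interior sum.reindex inj_F)

lemma lap_Suc_corner: "lap (Suc m) u (q k) = lap m (u \<circ> F k) (q k)"
  by (simp add: lap_def adj_Suc_corner sum.reindex inj_F)

lemma lap_Suc_junction:
  assumes "k \<noteq> j"
  shows "lap (Suc m) u (F k (q j)) = lap m (u \<circ> F k) (q j) + lap m (u \<circ> F j) (q k)"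
  by (simp add: lap_def adj_Suc_junction[OF assms] sum.union_disjoint sum.reindex inj_F
      F_vertex_commute[of j k])

text \<open>
  Boundary vertices carry weight 1 and the others weight 2, so that \<open>dlt m z u = 0\<close> on all of
  \<open>V m\<close> says that \<open>u\<close> is a discrete Neumann eigenfunction for the eigenvalue \<open>z\<close>.
\<close>

definition dlt :: "nat \<Rightarrow> 'a \<Rightarrow> (real^2 \<Rightarrow> 'a::comm_ring_1) \<Rightarrow> real^2 \<Rightarrow> 'a" where
  "dlt m z u x = 2 * lap m u x + (if x \<in> V 0 then 1 else 2) * z * u x"

lemma dlt_Suc_interior:
  assumes "x \<in> V m" "x \<notin> V 0"
  shows "dlt (Suc m) z u (F k x) = dlt m z (u \<circ> F k) x"
  using assms F_not_vertex[OF subsetD[OF vertices_subset_SG assms(1)] assms(2), of k]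
  by (simp add: dlt_def lap_Suc_interior)

lemma dlt_Suc_corner: "dlt (Suc m) z u (q k) = dlt m z (u \<circ> F k) (q k)"
  by (simp add: dlt_def lap_Suc_corner)

text \<open>A junction has weight 2 and is a corner, of weight 1, in each of its two cells. This
  makes the operator additive over cells.\<close>

lemma dlt_Suc_junction:
  assumes "k \<noteq> j"
  shows "dlt (Suc m) z u (F k (q j)) = dlt m z (u \<circ> F k) (q j) + dlt m z (u \<circ> F j) (q k)"
  using junction_not_vertex[OF assms]
  by (simp add: dlt_def lap_Suc_junction[OF assms] F_vertex_commute[of j k] algebra_simps)

lemmas F_commute = F_vertex_commute[of 1 0] F_vertex_commute[of 2 0] F_vertex_commute[of 2 1]

lemma dlt_0: "dlt 0 z u (q k) = 2 * (\<Sum>j\<in>UNIV - {k}. u (q j) - u (q k)) + z * u (q k)"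
  by (simp add: dlt_def lap_0)

lemma dlt_1_corner: "dlt (Suc 0) z u (q k) = 2 * (\<Sum>j\<in>UNIV - {k}. u (F k (q j)) - u (q k)) + z * u (q k)"
  by (simp add: dlt_Suc_corner dlt_0)

lemma dlt_1_junction:
  assumes "k \<noteq> j"
  shows "dlt (Suc 0) z u (F k (q j)) = 2 * (\<Sum>i\<in>UNIV - {j}. u (F k (q i)) - u (F k (q j)))
     + 2 * (\<Sum>i\<in>UNIV - {k}. u (F j (q i)) - u (F k (q j))) + 2 * z * u (F k (q j))"
  by (simp add: dlt_Suc_junction[OF assms] dlt_0 F_vertex_commute[of j k])

text \<open>Spectral decimation on one cell as a linear identity: the right-hand side contains only
  the residuals at junctions, those adjacent to the corner (i = k in the proof) with an extra
  multiple. Being free of divisions, it serves numbers, approximate solutions and power series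
  alike.\<close>

lemma dlt_cell_identity:
  fixes y :: "'a::comm_ring_1"
  shows "\<exists>i j l. i \<noteq> j \<and> i \<noteq> l \<and> j \<noteq> l \<and>
    (6 - y) * dlt 0 (y * (5 - y)) u (q k) - (2 - y) * (5 - y) * dlt (Suc 0) y u (q k)
    = 2 * (dlt (Suc 0) y u (F i (q j)) + dlt (Suc 0) y u (F i (q l)) + dlt (Suc 0) y u (F j (q l)))
      + (2 - y) * (dlt (Suc 0) y u (F i (q j)) + dlt (Suc 0) y u (F i (q l)))"
proof -
  consider "k = 0" | "k = 1" | "k = 2" using exhaust_3'[of k] by blast
  then show ?thesis
  proof cases
    case 1
    show ?thesis unfolding 1
      by (rule exI[of _ 0], rule exI[of _ 1], rule exI[of _ 2])
        (simp add: dlt_0 dlt_1_corner dlt_1_junction sum_neq_3 F_commute algebra_simps)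
  next
    case 2
    show ?thesis unfolding 2
      by (rule exI[of _ 1], rule exI[of _ 0], rule exI[of _ 2])
        (simp add: dlt_0 dlt_1_corner dlt_1_junction sum_neq_3 F_commute algebra_simps)
  next
    case 3
    show ?thesis unfolding 3
      by (rule exI[of _ 2], rule exI[of _ 0], rule exI[of _ 1])
        (simp add: dlt_0 dlt_1_corner dlt_1_junction sum_neq_3 F_commute algebra_simps)
  qed
qed

lemma new_vertex_F:
  assumes "z \<in> V (Suc m)" "z \<notin> V m"
  shows "z \<notin> V 0" "F k z \<in> V (Suc (Suc m))" "F k z \<notin> V (Suc m)"
proof -
  show "z \<notin> V 0" using assms(2) vertices_mono[of 0 m] by blast
  show "F k z \<in> V (Suc (Suc m))" using assms(1) by (rule F_mem_vertices_Suc)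
  have "z \<in> SG q" using assms(1) vertices_subset_SG by blast
  then show "F k z \<notin> V (Suc m)" using F_mem_vertices_iff assms(2) by metis
qed

lemma new_junction:
  assumes "a \<noteq> b"
  shows "F a (q b) \<in> V (Suc 0)" "F a (q b) \<notin> V 0"
  using F_mem_vertices_Suc[OF vertex_mem[of b 0]] junction_not_vertex[OF assms] by blast+

text \<open>With abstract predicates one induction yields both the exact descent (residuals are
  zero) and the quantitative one (residuals are bounded).\<close>

lemma dlt_descend_corner:
  assumes prem: "\<And>x. x \<in> V (Suc m) \<Longrightarrow> x \<notin> V m \<Longrightarrow> P (dlt (Suc m) y u x)"
    and PQ: "\<And>a b c. P a \<Longrightarrow> P b \<Longrightarrow> P c \<Longrightarrow> Q (2 * (a + b + c) + (2 - y) * (a + b))"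
  shows "Q ((6 - y) * dlt m (y * (5 - y)) u (q k) - (2 - y) * (5 - y) * dlt (Suc m) y u (q k))"
  using prem
proof (induction m arbitrary: u)
  case 0
  obtain i j l where ne: "i \<noteq> j" "i \<noteq> l" "j \<noteq> l"
    and e: "(6 - y) * dlt 0 (y * (5 - y)) u (q k) - (2 - y) * (5 - y) * dlt (Suc 0) y u (q k)
    = 2 * (dlt (Suc 0) y u (F i (q j)) + dlt (Suc 0) y u (F i (q l)) + dlt (Suc 0) y u (F j (q l)))
      + (2 - y) * (dlt (Suc 0) y u (F i (q j)) + dlt (Suc 0) y u (F i (q l)))"
    using dlt_cell_identity[of y u k] by blast
  have "P (dlt (Suc 0) y u (F a (q b)))" if "a \<noteq> b" for a b
    using new_junction[OF that] by (rule 0)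
  from PQ[OF this[OF ne(1)] this[OF ne(2)] this[OF ne(3)]] show ?case unfolding e .
next
  case (Suc m)
  have "P (dlt (Suc m) y (u \<circ> F k) x)" if x: "x \<in> V (Suc m)" "x \<notin> V m" for x
    using Suc.prems[OF new_vertex_F(2,3)[OF x, of k]]
    unfolding dlt_Suc_interior[OF x(1) new_vertex_F(1)[OF x]] .
  from Suc.IH[OF this] show ?case unfolding dlt_Suc_corner .
qed

text \<open>At a junction the expressions of two cells are added, hence a third predicate R.\<close>

lemma dlt_descend_interior:
  assumes prem: "\<And>x. x \<in> V (Suc m) \<Longrightarrow> x \<notin> V m \<Longrightarrow> P (dlt (Suc m) y u x)"
    and PQ: "\<And>a b c. P a \<Longrightarrow> P b \<Longrightarrow> P c \<Longrightarrow> Q (2 * (a + b + c) + (2 - y) * (a + b))"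
    and QR: "\<And>a b. Q a \<Longrightarrow> Q b \<Longrightarrow> R (a + b)"
    and x: "x \<in> V m" "x \<notin> V 0"
  shows "R ((6 - y) * dlt m (y * (5 - y)) u x - (2 - y) * (5 - y) * dlt (Suc m) y u x)"
  using prem x
proof (induction m arbitrary: u x)
  case 0
  then show ?case by simp
next
  case (Suc m)
  have prem': "P (dlt (Suc m) y (u \<circ> F k) z)" if z: "z \<in> V (Suc m)" "z \<notin> V m" for k z
    using Suc.prems(1)[OF new_vertex_F(2,3)[OF z, of k]]
    unfolding dlt_Suc_interior[OF z(1) new_vertex_F(1)[OF z]] .
  from Suc.prems(2) show ?case
  proof (cases rule: vertices_Suc_cases)
    case (interior k z)
    show ?thesis
      using Suc.IH[OF prem' interior(2,3)]
      unfolding interior(1) dlt_Suc_interior[OF interior(2,3)]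
        dlt_Suc_interior[OF subsetD[OF vertices_mono_Suc interior(2)] interior(3)] .
  next
    case (corner k)
    then show ?thesis using Suc.prems(3) by simp
  next
    case (junction k j)
    have "Q ((6 - y) * dlt m (y * (5 - y)) (u \<circ> F a) (q b) - (2 - y) * (5 - y) * dlt (Suc m) y (u \<circ> F a) (q b))" for a b
      by (rule dlt_descend_corner[where P = P and Q = Q, OF prem' PQ])
    from QR[OF this[of k j] this[of j k]] show ?thesis
      unfolding junction(1) by (simp add: dlt_Suc_junction[OF junction(2)] algebra_simps)
  qed
qed

text \<open>The factors show the exceptional values: y = 6 gives no information on the coarse level,
  y = 2 and y = 5 give none on the fine one.\<close>

lemma dlt_descend_exact:
  assumes prem: "\<And>x. x \<in> V (Suc m) \<Longrightarrow> x \<notin> V m \<Longrightarrow> dlt (Suc m) y u x = 0" and x: "x \<in> V m"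
  shows "(6 - y) * dlt m (y * (5 - y)) u x = (2 - y) * (5 - y) * dlt (Suc m) y u x"
proof (cases "x \<in> V 0")
  case True
  then obtain k where "x = q k" by auto
  then show ?thesis
    using dlt_descend_corner[where P = "\<lambda>a. a = 0" and Q = "\<lambda>a. a = 0", OF prem, of k] by simp
next
  case False
  then show ?thesis
    using dlt_descend_interior[where P = "\<lambda>a. a = 0" and Q = "\<lambda>a. a = 0" and R = "\<lambda>a. a = 0", OF prem _ _ x False]
    by simp
qed

text \<open>The two cells at a junction contribute (10 - 2 y) G each and the fine residual (2 - y)
  (5 - y) G, together (6 - y) (5 - y) G. The resulting factor 5 - y, close to 5 on fine levels,
  matches the scaling 5^m of the Laplacian.\<close>

lemma dlt_descend_bound:
  fixes y G :: real
  assumes y: "y < 2" and G: "\<And>x. x \<in> V (Suc m) \<Longrightarrow> x \<notin> V 0 \<Longrightarrow> \<bar>dlt (Suc m) y u x\<bar> \<le> G"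
    and x: "x \<in> V m" "x \<notin> V 0"
  shows "\<bar>dlt m (y * (5 - y)) u x\<bar> \<le> (5 - y) * G"
proof -
  have "\<bar>(6 - y) * dlt m (y * (5 - y)) u x - (2 - y) * (5 - y) * dlt (Suc m) y u x\<bar>
      \<le> (10 - 2 * y) * G + (10 - 2 * y) * G"
  proof (rule dlt_descend_interior[where P = "\<lambda>a. \<bar>a\<bar> \<le> G" and Q = "\<lambda>a. \<bar>a\<bar> \<le> (10 - 2 * y) * G"])
    show "\<bar>dlt (Suc m) y u z\<bar> \<le> G" if "z \<in> V (Suc m)" "z \<notin> V m" for z
      using that vertices_mono[of 0 m] by (intro G) auto
    show "\<bar>2 * (a + b + c) + (2 - y) * (a + b)\<bar> \<le> (10 - 2 * y) * G"
      if "\<bar>a\<bar> \<le> G" "\<bar>b\<bar> \<le> G" "\<bar>c\<bar> \<le> G" for a b c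
    proof -
      have "\<bar>(2 - y) * (a + b)\<bar> \<le> (2 - y) * (2 * G)"
        unfolding abs_mult using that y by (intro mult_mono) auto
      moreover have "\<bar>a + b + c\<bar> \<le> 3 * G" using that by (simp add: abs_le_iff)
      then have "\<bar>2 * (a + b + c)\<bar> \<le> 6 * G" by (simp only: abs_mult) simp
      ultimately show ?thesis by (simp add: algebra_simps)
    qed
    show "\<bar>a + b\<bar> \<le> (10 - 2 * y) * G + (10 - 2 * y) * G"
      if "\<bar>a\<bar> \<le> (10 - 2 * y) * G" "\<bar>b\<bar> \<le> (10 - 2 * y) * G" for a b
      using that abs_triangle_ineq[of a b] by linarith
  qed (rule x)+
  moreover have "\<bar>(2 - y) * (5 - y) * dlt (Suc m) y u x\<bar> \<le> (2 - y) * (5 - y) * G"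
  proof -
    have "\<bar>(2 - y) * (5 - y)\<bar> = (2 - y) * (5 - y)" using y by (intro abs_of_nonneg) auto
    moreover have "\<bar>dlt (Suc m) y u x\<bar> \<le> G" by (rule G[OF subsetD[OF vertices_mono_Suc x(1)] x(2)])
    ultimately show ?thesis using y unfolding abs_mult[of "(2 - y) * (5 - y)"]
      by (simp only:) (intro mult_left_mono, auto)
  qed
  ultimately have "\<bar>(6 - y) * dlt m (y * (5 - y)) u x\<bar>
      \<le> (10 - 2 * y) * G + (10 - 2 * y) * G + (2 - y) * (5 - y) * G"
    by linarith
  also have "\<dots> = (6 - y) * ((5 - y) * G)" by (simp add: algebra_simps)
  finally show ?thesis using y by (simp add: abs_mult)
qed

text \<open>With zero corners the junction equations have the matrix (5 - y) I - J, where J has all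
  entries 1; its eigenvalues are 5 - y, twice, and 2 - y.\<close>

lemma cell_zero:
  fixes y :: real
  assumes "y \<noteq> 2" "y \<noteq> 5" "\<And>i. u (q i) = 0"
    "\<And>k j. k \<noteq> j \<Longrightarrow> dlt (Suc 0) y u (F k (q j)) = 0"
  shows "u (F k (q j)) = 0"
proof -
  define a b c where "a = u (F 0 (q 1))" and "b = u (F 0 (q 2))" and "c = u (F 1 (q 2))"
  have e: "(4 - y) * a = b + c" "(4 - y) * b = a + c" "(4 - y) * c = a + b"
    using assms(4)[of 0 1] assms(4)[of 0 2] assms(4)[of 1 2]
    by (simp_all add: dlt_1_junction sum_neq_3 F_commute assms(3) a_def b_def c_def algebra_simps)
  have "(2 - y) * (a + b + c) = 0" using e by (simp add: algebra_simps)
  then have s: "a + b + c = 0" using assms(1) by simp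
  have "(5 - y) * a = a + b + c" "(5 - y) * b = a + b + c" "(5 - y) * c = a + b + c"
    using e by (simp_all add: algebra_simps)
  then have "a = 0" "b = 0" "c = 0" using assms(2) unfolding s by simp_all
  then show ?thesis
    using exhaust_3'[of k] exhaust_3'[of j] assms(3)
    by (elim disjE) (simp_all add: a_def b_def c_def F_commute)
qed

text \<open>By \<open>cell_zero\<close> the three subcells inherit zero corners; the induction
  applies to them with the eigenvalue sequence shifted by one level.\<close>

lemma vertices_zero:
  fixes y :: "nat \<Rightarrow> real"
  assumes "\<And>m. y (Suc m) \<noteq> 2" "\<And>m. y (Suc m) \<noteq> 5" "\<And>i. u (q i) = 0"
    "\<And>m x. x \<in> V (Suc m) \<Longrightarrow> x \<notin> V m \<Longrightarrow> dlt (Suc m) (y (Suc m)) u x = 0"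
    "x \<in> V m"
  shows "u x = 0"
  using assms
proof (induction m arbitrary: u y x)
  case (Suc m)
  obtain k z where z: "x = F k z" "z \<in> V m" using Suc.prems(5) by auto
  have "(u \<circ> F k) z = 0"
  proof (rule Suc.IH[of "\<lambda>m. y (Suc m)" "u \<circ> F k" z])
    fix i
    have "dlt (Suc 0) (y (Suc 0)) u (F a (q b)) = 0" if "a \<noteq> b" for a b
      using new_junction[OF that] by (rule Suc.prems(4))
    from cell_zero[OF Suc.prems(1) Suc.prems(2) Suc.prems(3) this]
    show "(u \<circ> F k) (q i) = 0" by simp
  next
    fix m' z assume z: "z \<in> V (Suc m')" "z \<notin> V m'"
    show "dlt (Suc m') (y (Suc (Suc m'))) (u \<circ> F k) z = 0"
      using Suc.prems(4)[OF new_vertex_F(2,3)[OF z, of k]]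
      unfolding dlt_Suc_interior[OF z(1) new_vertex_F(1)[OF z]] .
  qed (rule Suc.prems z)+
  then show ?case using z by simp
qed auto

end

section \<open>Solutions with a formal spectral parameter\<close>

text \<open>A weighted l1 norm, truncated at K so that it is finite for every series. Bounds that do
  not depend on K give coefficient bounds and radii of convergence.\<close>

definition nrm :: "nat \<Rightarrow> real \<Rightarrow> real fps \<Rightarrow> real" where
  "nrm K R A = (\<Sum>n\<le>K. \<bar>fps_nth A n\<bar> * R ^ n)"

lemma nrm_add: "R \<ge> 0 \<Longrightarrow> nrm K R (A + B) \<le> nrm K R A + nrm K R B"
  unfolding nrm_def sum.distrib[symmetric]
  by (intro sum_mono) (simp add: distrib_right[symmetric] mult_right_mono abs_triangle_ineq)

lemma nrm_minus: "nrm K R (- A) = nrm K R A"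
  by (simp add: nrm_def)

lemma nrm_diff: "R \<ge> 0 \<Longrightarrow> nrm K R (A - B) \<le> nrm K R A + nrm K R B"
  using nrm_add[of R K A "- B"] by (simp add: nrm_minus)

lemma nrm_nonneg: "R \<ge> 0 \<Longrightarrow> 0 \<le> nrm K R A"
  unfolding nrm_def by (intro sum_nonneg) auto

lemma nrm_cmult: "nrm K R (fps_const c * A) = \<bar>c\<bar> * nrm K R A"
  by (simp add: nrm_def abs_mult sum_distrib_left mult.assoc)

lemma nrm_coeff: "R \<ge> 0 \<Longrightarrow> n \<le> K \<Longrightarrow> \<bar>fps_nth A n\<bar> * R ^ n \<le> nrm K R A"
  unfolding nrm_def by (rule member_le_sum[of n "{..K}" "\<lambda>n. \<bar>fps_nth A n\<bar> * R ^ n"]) auto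

lemma nrm_mult:
  assumes "R \<ge> 0"
  shows "nrm K R (A * B) \<le> nrm K R A * nrm K R B"
proof -
  let ?a = "\<lambda>n. \<bar>fps_nth A n\<bar> * R ^ n" and ?b = "\<lambda>n. \<bar>fps_nth B n\<bar> * R ^ n"
  have "nrm K R (A * B) \<le> (\<Sum>n\<le>K. \<Sum>i\<le>n. ?a i * ?b (n - i))"
    unfolding nrm_def
  proof (rule sum_mono)
    fix n
    have "\<bar>fps_nth (A * B) n\<bar> \<le> (\<Sum>i\<le>n. \<bar>fps_nth A i\<bar> * \<bar>fps_nth B (n - i)\<bar>)"
      unfolding fps_mult_nth atLeast0AtMost abs_mult[symmetric] by (rule sum_abs)
    then have "\<bar>fps_nth (A * B) n\<bar> * R ^ n \<le> (\<Sum>i\<le>n. \<bar>fps_nth A i\<bar> * \<bar>fps_nth B (n - i)\<bar>) * R ^ n"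
      using assms by (intro mult_right_mono) auto
    also have "\<dots> = (\<Sum>i\<le>n. ?a i * ?b (n - i))"
      unfolding sum_distrib_right
    proof (rule sum.cong[OF refl])
      fix i assume "i \<in> {..n}"
      then have "R ^ n = R ^ i * R ^ (n - i)" by (simp flip: power_add)
      then show "\<bar>fps_nth A i\<bar> * \<bar>fps_nth B (n - i)\<bar> * R ^ n = ?a i * ?b (n - i)" by simp
    qed
    finally show "\<bar>fps_nth (A * B) n\<bar> * R ^ n \<le> (\<Sum>i\<le>n. ?a i * ?b (n - i))" .
  qed
  also have "\<dots> = (\<Sum>(n, i)\<in>(SIGMA n:{..K}. {..n}). ?a i * ?b (n - i))"
    by (rule sum.Sigma) auto
  also have "\<dots> = (\<Sum>(i, j)\<in>{(i, j). i + j \<le> K}. ?a i * ?b j)"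
    by (rule sum.reindex_bij_witness[where i = "\<lambda>(i, j). (i + j, i)" and j = "\<lambda>(n, i). (i, n - i)"]) auto
  also have "\<dots> \<le> (\<Sum>(i, j)\<in>{..K} \<times> {..K}. ?a i * ?b j)"
    using assms by (intro sum_mono2) auto
  also have "\<dots> = nrm K R A * nrm K R B"
    unfolding nrm_def by (simp add: sum_product sum.cartesian_product)
  finally show ?thesis .
qed

text \<open>The discrete eigenvalue on level s for the formal \<lambda> = \<open>fps_X\<close>. The
  factor 2/3 undoes the 3/2 in the definition of the Laplacian.\<close>

definition lev :: "nat \<Rightarrow> real fps" where
  "lev s = fps_scale (2 / 3 / 5 ^ s) psi"

lemma lev_Suc: "lev s = lev (Suc s) * (5 - lev (Suc s))"
proof -
  have "lev s = fps_scale (2 / 3 / 5 ^ Suc s) (fps_scale 5 psi)"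
    by (simp add: lev_def field_simps)
  then show ?thesis
    by (simp add: psi_scale lev_def fps_scale_mult fps_scale_diff)
qed

lemma lev_nth: "fps_nth (lev s) n = (2 / 3 / 5 ^ s) ^ n * psi_coeff n"
  by (simp add: lev_def)

lemma lev_nth_le: "\<bar>fps_nth (lev s) n\<bar> * R ^ n \<le> \<bar>psi_coeff n\<bar> * (2 / 3 * R) ^ n / 5 ^ s" if "R \<ge> 0"
proof (cases "n = 0")
  case False
  have "(5::real) ^ s \<le> (5 ^ s) ^ n"
    using False power_increasing[of 1 n "(5::real) ^ s"] by simp
  then have "\<bar>psi_coeff n\<bar> * (2 / 3 * R) ^ n / (5 ^ s) ^ n \<le> \<bar>psi_coeff n\<bar> * (2 / 3 * R) ^ n / 5 ^ s"
    using that by (intro divide_left_mono) auto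
  then show ?thesis using that
    by (simp add: lev_nth abs_mult power_divide power_mult_distrib mult_ac)
qed (simp add: lev_nth)

lemma psi_summable: "summable (\<lambda>n. \<bar>psi_coeff n\<bar> * R ^ n)"
  if "R \<ge> 0" for R :: real
proof -
  have "summable (\<lambda>n. norm (fps_nth psi n * R ^ n))"
    by (rule norm_summable_fps) simp
  then show ?thesis using that by (simp add: abs_mult)
qed

lemma nrm_lev_bound:
  assumes "R \<ge> 0"
  shows "nrm K R (lev s) \<le> (\<Sum>n. \<bar>psi_coeff n\<bar> * (2 / 3 * R) ^ n) / 5 ^ s"
proof -
  have "nrm K R (lev s) \<le> (\<Sum>n\<le>K. \<bar>psi_coeff n\<bar> * (2 / 3 * R) ^ n / 5 ^ s)"
    unfolding nrm_def by (intro sum_mono lev_nth_le assms)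
  also have "\<dots> = (\<Sum>n\<le>K. \<bar>psi_coeff n\<bar> * (2 / 3 * R) ^ n) / 5 ^ s"
    by (simp add: sum_divide_distrib)
  also have "\<dots> \<le> (\<Sum>n. \<bar>psi_coeff n\<bar> * (2 / 3 * R) ^ n) / 5 ^ s"
    using assms by (intro divide_right_mono sum_le_suminf psi_summable) auto
  finally show ?thesis .
qed

text \<open>In the radius 1/10 the eigenvalue is as small as \<open>nrm_mid_dev\<close> requires
  already on level 0. This small radius is enough for the convergence of each coefficient.\<close>

lemma nrm_lev_small: "nrm K (1/10) (lev s) \<le> 1 / 10 / 5 ^ s"
proof -
  have "(\<Sum>n. \<bar>psi_coeff n\<bar> * (2 / 3 * (1 / 10)) ^ n) \<le> (\<Sum>n. if n = 0 then 0 else (1 / 15) ^ n)"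
  proof (rule suminf_le)
    show "summable (\<lambda>n. \<bar>psi_coeff n\<bar> * (2 / 3 * (1 / 10)) ^ n)" by (rule psi_summable) simp
    show "summable (\<lambda>n. if n = 0 then 0 else (1 / 15::real) ^ n)"
      by (rule summable_comparison_test'[OF summable_geometric[of "1/15::real"], where N = 0]) auto
    fix n
    show "\<bar>psi_coeff n\<bar> * (2 / 3 * (1 / 10)) ^ n \<le> (if n = 0 then 0 else (1 / 15) ^ n)"
      using mult_right_mono[OF psi_coeff_le_1[of n], of "(1 / 15) ^ n"] by simp
  qed
  also have "(\<Sum>n. if n = 0 then 0 else (1 / 15::real) ^ n) = 1 / 14"
  proof -
    have "(\<lambda>n. (1 / 15::real) * (1 / 15) ^ n) sums (1 / 15 * (1 / (1 - 1 / 15)))"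
      by (intro sums_mult geometric_sums) simp
    then have "(\<lambda>n. if Suc n = 0 then 0 else (1 / 15::real) ^ Suc n) sums (1 / 14)" by simp
    then have "(\<lambda>n. if n = 0 then 0 else (1 / 15::real) ^ n) sums (1 / 14 + 0)"
      by (subst (asm) sums_Suc_iff) simp
    then show ?thesis by (simp add: sums_iff)
  qed
  finally have *: "(\<Sum>n. \<bar>psi_coeff n\<bar> * (2 / 3 * (1 / 10)) ^ n) \<le> 1 / 14" .
  have "nrm K (1/10) (lev s) \<le> (\<Sum>n. \<bar>psi_coeff n\<bar> * (2 / 3 * (1 / 10)) ^ n) / 5 ^ s"
    by (rule nrm_lev_bound) simp
  also have "\<dots> \<le> 1 / 10 / 5 ^ s"
    using * by (intro divide_right_mono) auto
  finally show ?thesis .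
qed

text \<open>The solution of the three junction equations for the eigenvalue \<open>y\<close> and corner values \<open>T\<close>.\<close>

definition mid :: "real fps \<Rightarrow> (3 \<Rightarrow> real fps) \<Rightarrow> 3 \<Rightarrow> 3 \<Rightarrow> real fps" where
  "mid y T k i = ((2 - y) * (T k + T i) + 2 * (T 0 + T 1 + T 2)) * inverse ((2 - y) * (5 - y))"

text \<open>Corner values of subcell k, one level deeper. Its corner i \<noteq> k is the junction of
  the subcells k and i.\<close>

definition sub :: "nat \<Rightarrow> (3 \<Rightarrow> real fps) \<Rightarrow> 3 \<Rightarrow> 3 \<Rightarrow> real fps" where
  "sub s T k i = (if i = k then T k else mid (lev (Suc s)) T k i)"

lemma lev_nth_0 [simp]: "fps_nth (lev s) 0 = 0"
  by (simp add: lev_nth)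

lemma decimation_unit: "fps_nth ((2 - lev s) * (5 - lev s)) 0 \<noteq> 0"
  by simp

lemma decimation_nz: "(2 - lev s) * (5 - lev s) \<noteq> 0"
proof
  assume "(2 - lev s) * (5 - lev s) = 0"
  then have "fps_nth ((2 - lev s) * (5 - lev s)) 0 = 0" by (simp only: fps_zero_nth)
  with decimation_unit show False by blast
qed

lemma mid_eq: "(2 - lev s) * (5 - lev s) * mid (lev s) T k i = (2 - lev s) * (T k + T i) + 2 * (T 0 + T 1 + T 2)"
proof -
  have "inverse ((2 - lev s) * (5 - lev s)) * ((2 - lev s) * (5 - lev s)) = 1"
    by (rule inverse_mult_eq_1[OF decimation_unit])
  then have "Z * (N * inverse Z) = N" if "Z = (2 - lev s) * (5 - lev s)" for Z N
    using that by (metis mult.commute mult.left_commute mult.right_neutral)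
  then show ?thesis unfolding mid_def by blast
qed

lemma mid_commute: "mid y T k i = mid y T i k"
  by (simp add: mid_def add.commute)

lemma sub_commute: "i \<noteq> k \<Longrightarrow> sub s T k i = sub s T i k"
  by (simp add: sub_def mid_commute)

lemma sub_same [simp]: "sub s T k k = T k"
  by (simp add: sub_def)

text \<open>The case y = 0 of \<open>mid\<close>: harmonic extension with the weights 2/5, 2/5,
  1/5.\<close>

definition harmv :: "(3 \<Rightarrow> real fps) \<Rightarrow> 3 \<Rightarrow> 3 \<Rightarrow> real fps" where
  "harmv T k i = fps_const (1/5) * (T k + T i + (T 0 + T 1 + T 2))"

lemma nrm_harm:
  assumes "R \<ge> 0" "k \<noteq> i" "\<And>i. nrm K R (T i) \<le> M"
  shows "nrm K R (harmv T k i) \<le> M"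
proof -
  have "nrm K R (T k + T i + (T 0 + T 1 + T 2)) \<le> 5 * M"
    using nrm_add[OF assms(1), of K "T k + T i" "T 0 + T 1 + T 2"] nrm_add[OF assms(1), of K "T k" "T i"]
      nrm_add[OF assms(1), of K "T 0 + T 1" "T 2"] nrm_add[OF assms(1), of K "T 0" "T 1"]
      assms(3)[of k] assms(3)[of i] assms(3)[of 0] assms(3)[of 1] assms(3)[of 2]
    by linarith
  then show ?thesis by (simp add: harmv_def nrm_cmult)
qed

text \<open>Clearing denominators gives 10 (m - h) = (7 y - y^2) m - y (T k + T i), of order \<eta>
  M on the right. The excess of m over h is absorbed on the left because \<eta> \<le> 1/10.\<close>

lemma nrm_mid_dev:
  assumes "R \<ge> 0" "k \<noteq> i" "\<And>i. nrm K R (T i) \<le> M" "nrm K R (lev s) \<le> \<eta>" "\<eta> \<le> 1/10"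
  shows "nrm K R (mid (lev s) T k i - harmv T k i) \<le> \<eta> * M"
proof -
  let ?y = "lev s" and ?m = "mid (lev s) T k i" and ?h = "harmv T k i"
  let ?D = "nrm K R (?m - ?h)"
  have M: "0 \<le> M" using nrm_nonneg[OF assms(1), of K "T 0"] assms(3)[of 0] by linarith
  have eta: "0 \<le> \<eta>" using nrm_nonneg[OF assms(1), of K ?y] assms(4) by linarith
  have "10 * ?m = (2 - ?y) * (T k + T i) + 2 * (T 0 + T 1 + T 2) + (7 * ?y - ?y * ?y) * ?m"
    using mid_eq[of s T k i] by (simp add: algebra_simps)
  moreover have "10 * ?h = 2 * (T k + T i) + 2 * (T 0 + T 1 + T 2)"
  proof -
    have "10 * ?h = (10 * fps_const (1/5)) * (T k + T i + (T 0 + T 1 + T 2))"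
      by (simp add: harmv_def mult.assoc)
    also have "10 * fps_const (1/5) = (2 :: real fps)"
      by (simp add: fps_numeral_fps_const)
    finally show ?thesis by (simp add: algebra_simps)
  qed
  ultimately have e: "10 * (?m - ?h) = (7 * ?y - ?y * ?y) * ?m - ?y * (T k + T i)"
    by (simp add: algebra_simps)
  have n10: "nrm K R (10 * A) = 10 * nrm K R A" for A
    using nrm_cmult[of K R 10 A] by (simp add: fps_numeral_fps_const)
  have n7: "nrm K R (7 * A) = 7 * nrm K R A" for A
    using nrm_cmult[of K R 7 A] by (simp add: fps_numeral_fps_const)
  have "nrm K R (?y * ?y) \<le> \<eta> * \<eta>"
    using nrm_mult[OF assms(1), of K ?y ?y] mult_mono[OF assms(4,4) eta nrm_nonneg[OF assms(1)]] by linarith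
  also have "\<dots> \<le> 1/10 * \<eta>" using mult_right_mono[OF assms(5) eta] .
  finally have "nrm K R (7 * ?y - ?y * ?y) \<le> 71/10 * \<eta>"
    using nrm_diff[OF assms(1), of K "7 * ?y" "?y * ?y"] n7[of ?y] assms(4) by linarith
  moreover have "nrm K R ?m \<le> M + ?D"
    using nrm_add[OF assms(1), of K "?m - ?h" ?h] nrm_harm[where T = T, OF assms(1,2,3)]
    by simp
  ultimately have 1: "nrm K R ((7 * ?y - ?y * ?y) * ?m) \<le> 71/10 * \<eta> * (M + ?D)"
    using eta nrm_mult[OF assms(1), of K "7 * ?y - ?y * ?y" ?m]
    by (elim order.trans[OF _ mult_mono]) (auto intro: nrm_nonneg assms)
  have "nrm K R (T k + T i) \<le> 2 * M"
    using nrm_add[OF assms(1), of K "T k" "T i"] assms(3)[of k] assms(3)[of i] by linarith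
  then have 2: "nrm K R (?y * (T k + T i)) \<le> \<eta> * (2 * M)"
    by (intro order.trans[OF nrm_mult[OF assms(1)]] mult_mono assms(4) eta nrm_nonneg[OF assms(1)])
  have "10 * ?D \<le> 71/10 * \<eta> * (M + ?D) + \<eta> * (2 * M)"
    using 1 2 nrm_diff[OF assms(1), of K "(7 * ?y - ?y * ?y) * ?m" "?y * (T k + T i)"]
    unfolding n10[symmetric] e by linarith
  moreover have "\<eta> * ?D \<le> 1/10 * ?D"
    by (rule mult_right_mono[OF assms(5) nrm_nonneg[OF assms(1)]])
  moreover have "0 \<le> \<eta> * M" using eta M by simp
  moreover have "71/10 * \<eta> * (M + ?D) + \<eta> * (2 * M)
      = 71/10 * (\<eta> * M) + 71/10 * (\<eta> * ?D) + 2 * (\<eta> * M)"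
    by (simp add: distrib_left)
  ultimately show ?thesis by linarith
qed

lemma nrm_sub:
  assumes "R \<ge> 0" "\<And>i. nrm K R (T i) \<le> M" "nrm K R (lev (Suc s)) \<le> \<eta>" "\<eta> \<le> 1/10"
  shows "nrm K R (sub s T k i) \<le> (1 + \<eta>) * M"
proof (cases "i = k")
  case True
  have "0 \<le> M" using nrm_nonneg[OF assms(1), of K "T 0"] assms(2)[of 0] by linarith
  moreover have "0 \<le> \<eta>" using nrm_nonneg[OF assms(1), of K "lev (Suc s)"] assms(3) by linarith
  ultimately have "0 \<le> \<eta> * M" by simp
  then show ?thesis using True assms(2)[of k] by (simp add: distrib_right)
next
  case False
  then have "k \<noteq> i" by simp
  have "nrm K R (mid (lev (Suc s)) T k i) \<le> \<eta> * M + M"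
    using nrm_add[OF assms(1), of K "mid (lev (Suc s)) T k i - harmv T k i" "harmv T k i"]
      nrm_mid_dev[where T = T, OF assms(1) \<open>k \<noteq> i\<close> assms(2-4)] nrm_harm[where T = T, OF assms(1) \<open>k \<noteq> i\<close> assms(2)]
    by simp
  then show ?thesis using False by (simp add: sub_def distrib_right)
qed

lemma third_exists: "k \<noteq> i \<Longrightarrow> \<exists>l. l \<noteq> k \<and> l \<noteq> i \<and> f 0 + f 1 + f 2 = f k + f i + f l"
  for f :: "3 \<Rightarrow> 'a::comm_monoid_add"
proof -
  assume ne: "k \<noteq> i"
  have "\<exists>l. l \<noteq> k \<and> l \<noteq> i" using exhaust_3'[of k] exhaust_3'[of i] by (metis neq_3)
  then obtain l where l: "l \<noteq> k" "l \<noteq> i" by blast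
  have "f 0 + f 1 + f 2 = f k + f i + f l"
    using exhaust_3'[of k] exhaust_3'[of i] exhaust_3'[of l] ne l
    by (elim disjE) (simp_all add: add_ac)
  with l show ?thesis by blast
qed

text \<open>Harmonic extension contracts oscillations by 3/5, as a junction value minus a corner
  value is (2 (T i - T k) + (T l - T k)) / 5. Each deviation from it costs \<eta> M.\<close>

lemma nrm_sub_osc:
  assumes "R \<ge> 0" "\<And>i. nrm K R (T i) \<le> M" "\<And>i j. nrm K R (T i - T j) \<le> O'"
    "nrm K R (lev (Suc s)) \<le> \<eta>" "\<eta> \<le> 1/10"
  shows "nrm K R (sub s T k i - sub s T k j) \<le> 3/5 * O' + 2 * \<eta> * M"
proof -
  have M: "0 \<le> M" using nrm_nonneg[OF assms(1), of K "T 0"] assms(2)[of 0] by linarith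
  have eta: "0 \<le> \<eta>" using nrm_nonneg[OF assms(1), of K "lev (Suc s)"] assms(4) by linarith
  have O': "0 \<le> O'" using nrm_nonneg[OF assms(1), of K "T 0 - T 0"] assms(3)[of 0 0] by linarith
  have em: "0 \<le> \<eta> * M" using eta M by simp
  note dev = nrm_mid_dev[where T = T, OF assms(1) _ assms(2) assms(4,5)]
  have corner: "nrm K R (mid (lev (Suc s)) T k i - T k) \<le> 3/5 * O' + \<eta> * M" if ki: "k \<noteq> i" for k i
  proof -
    obtain l where l: "T 0 + T 1 + T 2 = T k + T i + T l" using third_exists[OF ki, of T] by blast
    have "harmv T k i - T k = fps_const (1/5) * ((T i - T k) + (T i - T k) + (T l - T k))"
    proof -
      have "T k = fps_const (1/5) * (5 * T k)"
        unfolding mult.assoc[symmetric] by (simp add: fps_numeral_fps_const)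
      then have "harmv T k i - T k = harmv T k i - fps_const (1/5) * (5 * T k)" by simp
      also have "\<dots> = fps_const (1/5) * ((T i - T k) + (T i - T k) + (T l - T k))"
        unfolding harmv_def l right_diff_distrib[symmetric] by (simp add: algebra_simps)
      finally show ?thesis .
    qed
    moreover have "nrm K R ((T i - T k) + (T i - T k) + (T l - T k)) \<le> 3 * O'"
      using nrm_add[OF assms(1), of K "(T i - T k) + (T i - T k)" "T l - T k"]
        nrm_add[OF assms(1), of K "T i - T k" "T i - T k"] assms(3)[of i k] assms(3)[of l k] by linarith
    ultimately have "nrm K R (harmv T k i - T k) \<le> 3/5 * O'" by (simp add: nrm_cmult)
    then show ?thesis
      using nrm_add[OF assms(1), of K "mid (lev (Suc s)) T k i - harmv T k i" "harmv T k i - T k"] dev[OF ki]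
      by simp
  qed
  show ?thesis
  proof (cases "i = k \<or> j = k \<or> i = j")
    case True
    have sw: "nrm K R (A - B) = nrm K R (B - A)" for A B
      using nrm_minus[of K R "A - B"] by simp
    consider "i = j" | "i = k" "j \<noteq> k" | "j = k" "i \<noteq> k" using True by blast
    then show ?thesis
    proof cases
      case 1
      then show ?thesis using O' em by (simp add: nrm_def)
    next
      case 2
      then show ?thesis using corner[of k j] em sw[of "T k"] by (simp add: sub_def)
    next
      case 3
      then show ?thesis using corner[of k i] em by (simp add: sub_def)
    qed
  next
    case False
    then have ne: "k \<noteq> i" "k \<noteq> j" by auto
    have "harmv T k i - harmv T k j = fps_const (1/5) * (T i - T j)"
      unfolding harmv_def right_diff_distrib[symmetric] by (simp add: algebra_simps)
    then have h: "nrm K R (harmv T k i - harmv T k j) \<le> 1/5 * O'"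
      using assms(3)[of i j] by (simp add: nrm_cmult)
    let ?a = "mid (lev (Suc s)) T k i - harmv T k i" and ?b = "mid (lev (Suc s)) T k j - harmv T k j"
    have "sub s T k i - sub s T k j = (?a - ?b) + (harmv T k i - harmv T k j)"
      using False by (simp add: sub_def)
    then show ?thesis
      using nrm_add[OF assms(1), of K "?a - ?b" "harmv T k i - harmv T k j"]
        nrm_diff[OF assms(1), of K ?a ?b] dev[OF ne(1)] dev[OF ne(2)] h O'
      by simp
  qed
qed

section \<open>Extension of corner values to the gasket\<close>

context gasket
begin

text \<open>At a junction either choice leads to the same interpolated value, because both cells
  assign it the same corner value (\<open>ext_F\<close>).\<close>

definition idx :: "real^2 \<Rightarrow> 3" where
  "idx x = (SOME k. x \<in> F k ` SG q)"

text \<open>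
  Affine interpolation after \<open>n\<close> subdivisions of a cell of level \<open>s\<close> with corner values \<open>T\<close>.
\<close>

primrec ext :: "nat \<Rightarrow> nat \<Rightarrow> (3 \<Rightarrow> real fps) \<Rightarrow> real^2 \<Rightarrow> real fps" where
  "ext 0 s T x = (\<Sum>i\<in>UNIV. fps_const (bary i x) * T i)"
| "ext (Suc n) s T x = ext n (Suc s) (sub s T (idx x)) (2 *\<^sub>R x - q (idx x))"

lemma idx_F: "x \<in> SG q \<Longrightarrow> F k x \<in> F (idx (F k x)) ` SG q"
  unfolding idx_def by (rule someI[of "\<lambda>j. F k x \<in> F j ` SG q" k]) (rule imageI)

lemma idx_vertex: "idx (q i) = i"
proof -
  have "q i \<in> F (idx (q i)) ` SG q" using idx_F[of "q i" i] by simp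
  then obtain y where "q i = F (idx (q i)) y" "y \<in> SG q" by (rule imageE)
  then show ?thesis using F_eq_vertex_iff[of y "idx (q i)" i] by simp
qed

lemma ext_vertex: "ext n s T (q i) = T i"
proof (induction n arbitrary: s T)
  case 0
  have "ext 0 s T (q i) = (\<Sum>j\<in>{i}. fps_const (bary j (q i)) * T j)"
    unfolding ext.simps by (rule sum.mono_neutral_right) auto
  then show ?case by simp
next
  case (Suc n)
  have "2 *\<^sub>R q i - q i = q i" by (simp add: scaleR_2)
  then show ?case by (simp only: ext.simps idx_vertex Suc sub_same)
qed

lemma ext_F:
  assumes "x \<in> SG q"
  shows "ext (Suc n) s T (F k x) = ext n (Suc s) (sub s T k) x"
proof -
  let ?j = "idx (F k x)"
  obtain y where y: "F k x = F ?j y" "y \<in> SG q" using idx_F[OF assms, of k] by blast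
  have e: "ext (Suc n) s T (F k x) = ext n (Suc s) (sub s T ?j) y"
    unfolding ext.simps using F_inverse[of ?j y] y(1) by metis
  show ?thesis
  proof (cases "?j = k")
    case True
    then show ?thesis using e y(1) by simp
  next
    case False
    then have xy: "x = q ?j" "y = q k" using F_eq_F_imp[OF assms y(2) y(1)] by auto
    have "ext n (Suc s) (sub s T ?j) y = sub s T ?j k" using xy(2) ext_vertex by metis
    also have "\<dots> = sub s T k ?j" using False by (intro sub_commute) auto
    also have "\<dots> = ext n (Suc s) (sub s T k) x" using xy(1) ext_vertex by metis
    finally show ?thesis using e by simp
  qed
qed

lemma closed_cell: "closed (F k ` SG q)"
  by (intro compact_imp_closed compact_continuous_image continuous_on_F SG_char(2))

lemma continuous_on_cells:
  fixes u :: "real^2 \<Rightarrow> real"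
  assumes "\<And>k. continuous_on (SG q) (u \<circ> F k)"
  shows "continuous_on (SG q) u"
proof -
  have c: "continuous_on (F k ` SG q) u" for k
  proof -
    have "continuous_on (F k ` SG q) ((u \<circ> F k) \<circ> (\<lambda>x. 2 *\<^sub>R x - q k))"
    proof (rule continuous_on_compose)
      show "continuous_on (F k ` SG q) (\<lambda>x. 2 *\<^sub>R x - q k)"
        by (intro continuous_on_diff continuous_on_scaleR continuous_on_const continuous_on_id)
      have "(\<lambda>x. 2 *\<^sub>R x - q k) ` F k ` SG q = SG q"
        by (simp add: image_image F_inverse)
      then show "continuous_on ((\<lambda>x. 2 *\<^sub>R x - q k) ` F k ` SG q) (u \<circ> F k)" using assms by simp
    qed
    then show ?thesis
      by (rule continuous_on_eq) (auto simp: F_inverse)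
  qed
  have "continuous_on (F 0 ` SG q \<union> F 1 ` SG q \<union> F 2 ` SG q) u"
    by (intro continuous_on_closed_Un closed_Un closed_cell c)
  moreover have "SG q = F 0 ` SG q \<union> F 1 ` SG q \<union> F 2 ` SG q"
  proof
    show "SG q \<subseteq> F 0 ` SG q \<union> F 1 ` SG q \<union> F 2 ` SG q"
    proof
      fix x assume "x \<in> SG q"
      then obtain k y where "x = F k y" "y \<in> SG q" by (rule SG_cases)
      then show "x \<in> F 0 ` SG q \<union> F 1 ` SG q \<union> F 2 ` SG q" using exhaust_3'[of k] by blast
    qed
    show "F 0 ` SG q \<union> F 1 ` SG q \<union> F 2 ` SG q \<subseteq> SG q"
      by (intro Un_least image_subsetI F_in_SG)
  qed
  ultimately show ?thesis by metis
qed

lemma continuous_on_ext: "continuous_on (SG q) (\<lambda>x. fps_nth (ext n s T x) j)"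
proof (induction n arbitrary: s T)
  case 0
  have "(\<lambda>x. fps_nth (ext 0 s T x) j) = (\<lambda>x. \<Sum>i\<in>UNIV. bary i x * fps_nth (T i) j)"
    by (simp add: fps_sum_nth)
  then show ?case
    by (simp only:) (intro continuous_on_sum continuous_on_mult continuous_on_bary continuous_on_const)
next
  case (Suc n)
  show ?case
  proof (rule continuous_on_cells)
    fix k
    show "continuous_on (SG q) ((\<lambda>x. fps_nth (ext (Suc n) s T x) j) \<circ> F k)"
      using Suc.IH[of "Suc s" "sub s T k"] by (rule continuous_on_eq) (simp only: comp_def ext_F)
  qed
qed

lemma nrm_sum_bary:
  assumes "R \<ge> 0" "x \<in> SG q" "\<And>i. nrm K R (A i) \<le> M"
  shows "nrm K R (\<Sum>i\<in>UNIV. fps_const (bary i x) * A i) \<le> M"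
proof -
  have b: "nrm K R (fps_const (bary i x) * A i) \<le> bary i x * M" for i
    using SG_bary(1)[OF assms(2), of i] assms(3)[of i] by (simp add: nrm_cmult mult_left_mono)
  have "nrm K R (\<Sum>i\<in>UNIV. fps_const (bary i x) * A i) \<le> bary 0 x * M + bary 1 x * M + bary 2 x * M"
    unfolding sum_3'
    using nrm_add[OF assms(1), of K "fps_const (bary 0 x) * A 0 + fps_const (bary 1 x) * A 1" "fps_const (bary 2 x) * A 2"]
      nrm_add[OF assms(1), of K "fps_const (bary 0 x) * A 0" "fps_const (bary 1 x) * A 1"] b[of 0] b[of 1] b[of 2]
    by linarith
  also have "\<dots> = M" using sum_bary[of x] by (metis distrib_right mult_1)
  finally show ?thesis .
qed

lemma ext_diff_0:
  assumes "R \<ge> 0" "x \<in> SG q" "\<And>i. nrm K R (T i) \<le> M" "\<And>i j. nrm K R (T i - T j) \<le> O'"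
    "nrm K R (lev (Suc s)) \<le> \<eta>" "\<eta> \<le> 1/10"
  shows "nrm K R (ext (Suc 0) s T x - ext 0 s T x) \<le> 2 * O' + 2 * \<eta> * M"
proof -
  obtain k y where x: "x = F k y" "y \<in> SG q" using assms(2) by (rule SG_cases)
  have M: "0 \<le> M" using nrm_nonneg[OF assms(1), of K "T 0"] assms(3)[of 0] by linarith
  have eta: "0 \<le> \<eta>" using nrm_nonneg[OF assms(1), of K "lev (Suc s)"] assms(5) by linarith
  have O': "0 \<le> O'" using nrm_nonneg[OF assms(1), of K "T 0 - T 0"] assms(4)[of 0 0] by linarith
  let ?A = "\<lambda>i. sub s T k i - fps_const (1/2) * (T k + T i)"
  have "ext 0 s T x = (\<Sum>i\<in>UNIV. fps_const (bary i y) * (fps_const (1/2) * (T k + T i)))"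
  proof -
    have c: "c0 + c1 + c2 = (1::real) \<Longrightarrow> fps_const c0 * t + fps_const c1 * t + fps_const c2 * t = t"
      for c0 c1 c2 t by (simp flip: distrib_right fps_const_add)
    have "(\<Sum>i\<in>UNIV. fps_const (bary i y) * (fps_const (1/2) * (T k + T i)))
       = fps_const (1/2) * ((fps_const (bary 0 y) * T k + fps_const (bary 1 y) * T k + fps_const (bary 2 y) * T k)
         + (\<Sum>i\<in>UNIV. fps_const (bary i y) * T i))"
      unfolding sum_3' by (simp add: algebra_simps del: fps_const_mult fps_const_add)
    also have "\<dots> = fps_const (1/2) * (T k + (\<Sum>i\<in>UNIV. fps_const (bary i y) * T i))"
      using c[OF sum_bary[of y]] by simp
    also have "\<dots> = (\<Sum>i\<in>UNIV. fps_const (bary i x) * T i)"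
    proof -
      have "fps_const (bary i x) * T i = fps_const (1/2) * (fps_const (of_bool (i = k)) * T i + fps_const (bary i y) * T i)" for i
        unfolding x(1) bary_F
        by (simp add: distrib_right[symmetric] mult.assoc[symmetric] add.commute)
      then have "(\<Sum>i\<in>UNIV. fps_const (bary i x) * T i)
          = fps_const (1/2) * ((\<Sum>i\<in>UNIV. fps_const (of_bool (i = k)) * T i) + (\<Sum>i\<in>UNIV. fps_const (bary i y) * T i))"
        by (simp only: sum_distrib_left[symmetric] sum.distrib[symmetric])
      moreover have "(\<Sum>i\<in>UNIV. fps_const (of_bool (i = k)) * T i) = T k"
      proof -
        have "(\<Sum>i\<in>UNIV. fps_const (of_bool (i = k)) * T i) = (\<Sum>i\<in>{k}. fps_const (of_bool (i = k)) * T i)"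
          by (rule sum.mono_neutral_right) auto
        then show ?thesis by simp
      qed
      ultimately show ?thesis by simp
    qed
    finally show ?thesis by simp
  qed
  moreover have "ext (Suc 0) s T x = (\<Sum>i\<in>UNIV. fps_const (bary i y) * sub s T k i)"
    unfolding x(1) ext_F[OF x(2)] by simp
  ultimately have e: "ext (Suc 0) s T x - ext 0 s T x = (\<Sum>i\<in>UNIV. fps_const (bary i y) * ?A i)"
    by (simp only: right_diff_distrib sum_subtractf)
  have "nrm K R (?A i) \<le> 2 * O' + 2 * \<eta> * M" for i
  proof (cases "i = k")
    case True
    have "fps_const (1/2) * (T k + T k) = T k"
      by (simp only: mult_2[symmetric] mult.assoc[symmetric]) (simp add: fps_numeral_fps_const)
    then have "?A i = 0" using True by simp
    moreover have "0 \<le> \<eta> * M" using eta M by simp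
    ultimately show ?thesis using O' by (simp add: nrm_def)
  next
    case False
    have A: "?A i = (sub s T k i - sub s T k k) + fps_const (1/2) * (T k - T i)"
    proof -
      have "T k = fps_const (1/2) * (T k + T k)"
        by (simp only: mult_2[symmetric] mult.assoc[symmetric]) (simp add: fps_numeral_fps_const)
      then have "sub s T k i - T k + fps_const (1/2) * (T k - T i)
          = sub s T k i - fps_const (1/2) * (T k + T k) + fps_const (1/2) * (T k - T i)"
        by simp
      also have "\<dots> = ?A i" by (simp only: right_diff_distrib distrib_left) simp
      finally show ?thesis by simp
    qed
    have "nrm K R (fps_const (1/2) * (T k - T i)) \<le> 1/2 * O'"
      using assms(4)[of k i] by (simp add: nrm_cmult)
    moreover have "nrm K R (sub s T k i - sub s T k k) \<le> 3/5 * O' + 2 * \<eta> * M"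
      by (rule nrm_sub_osc[OF assms(1,3,4,5,6)])
    ultimately show ?thesis
      using nrm_add[OF assms(1), of K "sub s T k i - sub s T k k" "fps_const (1/2) * (T k - T i)"] O'
      unfolding A by linarith
  qed
  then show ?thesis unfolding e by (rule nrm_sum_bary[OF assms(1) x(2)])
qed

text \<open>The quantity O' + M / 5^s shrinks by 4/5 in each subdivision: the oscillation by 3/5 up
  to an error of order M / 5^s, and M / 5^s by nearly 1/5 because the level increases.\<close>

lemma ext_diff:
  assumes "x \<in> SG q" "\<And>i. nrm K (1/10) (T i) \<le> M" "\<And>i j. nrm K (1/10) (T i - T j) \<le> O'"
  shows "nrm K (1/10) (ext (Suc n) s T x - ext n s T x) \<le> 2 * (4/5) ^ n * (O' + M / 5 ^ s)"
  using assms
proof (induction n arbitrary: s T x M O')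
  case 0
  have M: "0 \<le> M" using nrm_nonneg[of "1/10" K "T 0"] 0(2)[of 0] by linarith
  have le: "(1::real) / 10 / 5 ^ Suc s \<le> 1 / 10" by (simp add: field_simps power_Suc[symmetric] del: power_Suc)
  have "nrm K (1/10) (ext (Suc 0) s T x - ext 0 s T x) \<le> 2 * O' + 2 * (1 / 10 / 5 ^ Suc s) * M"
    by (rule ext_diff_0[OF _ 0 nrm_lev_small le]) simp
  also have "2 * (1 / 10 / 5 ^ Suc s) * M \<le> 2 * (M / 5 ^ s)"
    using M by (simp add: field_simps)
  finally show ?case by simp
next
  case (Suc n)
  obtain k y where x: "x = F k y" "y \<in> SG q" using Suc.prems(1) by (rule SG_cases)
  have M: "0 \<le> M" using nrm_nonneg[of "1/10" K "T 0"] Suc.prems(2)[of 0] by linarith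
  have O': "0 \<le> O'" using nrm_nonneg[of "1/10" K "T 0 - T 0"] Suc.prems(3)[of 0 0] by linarith
  have le: "(1::real) / 10 / 5 ^ Suc s \<le> 1 / 10" by (simp add: field_simps power_Suc[symmetric] del: power_Suc)
  let ?eta = "(1::real) / 10 / 5 ^ Suc s"
  have 1: "nrm K (1/10) (sub s T k i) \<le> (1 + ?eta) * M" for i
    by (rule nrm_sub[OF _ Suc.prems(2) nrm_lev_small le]) simp
  have 2: "nrm K (1/10) (sub s T k i - sub s T k j) \<le> 3/5 * O' + 2 * ?eta * M" for i j
    by (rule nrm_sub_osc[OF _ Suc.prems(2,3) nrm_lev_small le]) simp
  have "nrm K (1/10) (ext (Suc (Suc n)) s T x - ext (Suc n) s T x)
      = nrm K (1/10) (ext (Suc n) (Suc s) (sub s T k) y - ext n (Suc s) (sub s T k) y)"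
    unfolding x(1) by (simp only: ext_F[OF x(2)])
  also have "\<dots> \<le> 2 * (4/5) ^ n * ((3/5 * O' + 2 * ?eta * M) + (1 + ?eta) * M / 5 ^ Suc s)"
    by (rule Suc.IH[OF x(2) 1 2])
  also have "\<dots> \<le> 2 * (4/5) ^ n * (4/5 * (O' + M / 5 ^ s))"
  proof (intro mult_left_mono)
    have "1 + ?eta \<le> 11/10" using le by linarith
    then have "(1 + ?eta) * (M / 5 ^ Suc s) \<le> 11/10 * (M / 5 ^ Suc s)"
      using M by (intro mult_right_mono) auto
    moreover have "2 * ?eta * M = 1/5 * (M / 5 ^ Suc s)" by simp
    moreover have "M / 5 ^ Suc s = 1/5 * (M / 5 ^ s)" by simp
    moreover have "0 \<le> M / 5 ^ s" using M by simp
    moreover have "a \<le> 11/10 * t \<Longrightarrow> b = 1/5 * t \<Longrightarrow> t = 1/5 * u \<Longrightarrow> 0 \<le> u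
        \<Longrightarrow> (3/5 * O' + b) + a \<le> 4/5 * (O' + u)" for a b t u :: real
      using O' by (simp add: distrib_left)
    ultimately show "(3/5 * O' + 2 * ?eta * M) + (1 + ?eta) * M / 5 ^ Suc s \<le> 4/5 * (O' + M / 5 ^ s)"
      unfolding times_divide_eq_right[symmetric, of "1 + ?eta" M] by blast
  qed simp
  also have "\<dots> = 2 * (4/5) ^ Suc n * (O' + M / 5 ^ s)" by (simp only: power_Suc mult_ac)
  finally show ?case .
qed

text \<open>The limit is taken coefficient by coefficient. The value 0 off the gasket is the one
  prescribed by \<open>laplacian\<close> and \<open>monomial\<close>.\<close>

definition sol :: "nat \<Rightarrow> (3 \<Rightarrow> real fps) \<Rightarrow> real^2 \<Rightarrow> real fps" where
  "sol s T x = (if x \<in> SG q then Abs_fps (\<lambda>j. lim (\<lambda>n. fps_nth (ext n s T x) j)) else 0)"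

lemma ext_uniform_limit:
  "uniform_limit (SG q) (\<lambda>n x. fps_nth (ext n s T x) j) (\<lambda>x. fps_nth (sol s T x) j) sequentially"
proof -
  define M where "M = Max (range (\<lambda>i. nrm j (1/10) (T i)))"
  have M: "nrm j (1/10) (T i) \<le> M" for i unfolding M_def by (rule Max_ge) auto
  have M0: "0 \<le> M" using nrm_nonneg[of "1/10" j "T 0"] M[of 0] by linarith
  have O': "nrm j (1/10) (T i - T k) \<le> 2 * M" for i k
    using nrm_diff[of "1/10" j "T i" "T k"] M[of i] M[of k] by linarith
  let ?d = "\<lambda>n x. fps_nth (ext (Suc n) s T x) j - fps_nth (ext n s T x) j"
  define B where "B = 2 * M + M / 5 ^ s"
  let ?C = "10 ^ j * (2 * B)"
  have bd: "norm (?d n x) \<le> ?C * (4/5) ^ n" if "x \<in> SG q" for n x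
  proof -
    have "\<bar>?d n x\<bar> * (1/10) ^ j \<le> nrm j (1/10) (ext (Suc n) s T x - ext n s T x)"
      using nrm_coeff[of "1/10" j j "ext (Suc n) s T x - ext n s T x"]
      by (simp only: fps_sub_nth order_refl)
    also have "\<dots> \<le> 2 * (4/5) ^ n * B" unfolding B_def by (rule ext_diff[OF that M O'])
    finally have "10 ^ j * (\<bar>?d n x\<bar> * (1/10) ^ j) \<le> 10 ^ j * (2 * (4/5) ^ n * B)"
      by (intro mult_left_mono) auto
    then show ?thesis by (simp add: power_divide mult_ac del: ext.simps)
  qed
  have "summable (\<lambda>n. ?C * (4/5::real) ^ n)"
    by (intro summable_mult summable_geometric) simp
  then have "uniform_limit (SG q) (\<lambda>n x. \<Sum>i<n. ?d i x) (\<lambda>x. suminf (\<lambda>i. ?d i x)) sequentially"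
    by (intro Weierstrass_m_test[where M = "\<lambda>n. ?C * (4/5) ^ n"] bd)
  then have "uniform_limit (SG q) (\<lambda>n x. fps_nth (ext 0 s T x) j + (\<Sum>i<n. ?d i x))
      (\<lambda>x. fps_nth (ext 0 s T x) j + suminf (\<lambda>i. ?d i x)) sequentially"
    by (intro uniform_limit_add uniform_limit_const)
  moreover have "fps_nth (ext 0 s T x) j + (\<Sum>i<n. ?d i x) = fps_nth (ext n s T x) j" for n x
    by (simp only: sum_lessThan_telescope[of "\<lambda>i. fps_nth (ext i s T x) j"] add_diff_cancel_left' diff_add_cancel add.commute)
  ultimately have ul: "uniform_limit (SG q) (\<lambda>n x. fps_nth (ext n s T x) j)
      (\<lambda>x. fps_nth (ext 0 s T x) j + suminf (\<lambda>i. ?d i x)) sequentially"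
    by (simp only:)
  show ?thesis
  proof (rule uniform_limit_cong'[THEN iffD1, OF _ _ ul])
    fix x assume x: "x \<in> SG q"
    have "(\<lambda>n. fps_nth (ext n s T x) j) \<longlonglongrightarrow> fps_nth (ext 0 s T x) j + suminf (\<lambda>i. ?d i x)"
      by (rule tendsto_uniform_limitI[OF ul x])
    then show "fps_nth (ext 0 s T x) j + suminf (\<lambda>i. ?d i x) = fps_nth (sol s T x) j"
      using x by (simp add: sol_def limI del: ext.simps)
  qed (rule refl)
qed

lemma ext_tendsto: "x \<in> SG q \<Longrightarrow> (\<lambda>n. fps_nth (ext n s T x) j) \<longlonglongrightarrow> fps_nth (sol s T x) j"
  by (rule tendsto_uniform_limitI[OF ext_uniform_limit])

lemma continuous_on_sol: "continuous_on (SG q) (\<lambda>x. fps_nth (sol s T x) j)"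
  by (rule uniform_limit_theorem[OF _ ext_uniform_limit])
    (simp_all add: continuous_on_ext del: ext.simps)

lemma sol_vertex [simp]: "sol s T (q i) = T i"
proof (rule fps_ext)
  fix j
  have "(\<lambda>n. fps_nth (T i) j) \<longlonglongrightarrow> fps_nth (sol s T (q i)) j"
    using ext_tendsto[OF vertex_in_SG, of s T i j] by (simp only: ext_vertex)
  then show "fps_nth (sol s T (q i)) j = fps_nth (T i) j" by (simp add: LIMSEQ_const_iff)
qed

lemma sol_F: "x \<in> SG q \<Longrightarrow> sol s T (F k x) = sol (Suc s) (sub s T k) x"
proof (rule fps_ext)
  fix j assume x: "x \<in> SG q"
  have "(\<lambda>n. fps_nth (ext (Suc n) s T (F k x)) j) \<longlonglongrightarrow> fps_nth (sol s T (F k x)) j"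
    by (rule LIMSEQ_Suc[OF ext_tendsto[OF F_in_SG[OF x]]])
  then have "(\<lambda>n. fps_nth (ext n (Suc s) (sub s T k) x) j) \<longlonglongrightarrow> fps_nth (sol s T (F k x)) j"
    by (simp only: ext_F[OF x])
  then show "fps_nth (sol s T (F k x)) j = fps_nth (sol (Suc s) (sub s T k) x) j"
    using ext_tendsto[OF x] LIMSEQ_unique by blast
qed

lemma sol_outside: "x \<notin> SG q \<Longrightarrow> sol s T x = 0"
  by (simp add: sol_def)

lemma lap_cong:
  assumes "\<And>x. x \<in> SG q \<Longrightarrow> u x = v x" "x \<in> SG q"
  shows "lap m u x = lap m v x"
  unfolding lap_def using assms adj_mem by (intro sum.cong) auto

lemma dlt_cong:
  assumes "\<And>x. x \<in> SG q \<Longrightarrow> u x = v x" "x \<in> SG q"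
  shows "dlt m z u x = dlt m z v x"
  unfolding dlt_def using lap_cong[OF assms] assms by simp

text \<open>After multiplication by (2 - y) (5 - y) this is a polynomial identity, and power series
  have no zero divisors.\<close>

lemma mid_equation:
  assumes "S = a + b + c"
    "(2 - y) * (5 - y) * mab = (2 - y) * (a + b) + 2 * S"
    "(2 - y) * (5 - y) * mac = (2 - y) * (a + c) + 2 * S"
    "(2 - y) * (5 - y) * mbc = (2 - y) * (b + c) + 2 * S"
    "(2 - y) * (5 - y) \<noteq> 0"
  shows "a + b + mac + mbc - (4 - y) * mab = (0 :: real fps)"
proof -
  have "(2 - y) * (5 - y) * (a + b + mac + mbc - (4 - y) * mab)
      = (2 - y) * (5 - y) * (a + b) + (2 - y) * (5 - y) * mac + (2 - y) * (5 - y) * mbc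
        - (4 - y) * ((2 - y) * (5 - y) * mab)"
    by (simp add: algebra_simps)
  also have "\<dots> = 0" unfolding assms(2-4) unfolding assms(1)
    by (simp add: algebra_simps)
  finally show ?thesis using assms(5) by (metis mult_eq_0_iff)
qed

lemma sol_junction:
  assumes "k \<noteq> j"
  shows "dlt (Suc 0) (lev (Suc s)) (sol s T) (F k (q j)) = 0"
proof -
  obtain l where l: "l \<noteq> k" "l \<noteq> j" "T 0 + T 1 + T 2 = T k + T j + T l"
    using third_exists[OF assms, of T] by blast
  let ?y = "lev (Suc s)"
  have e: "T k + T j + mid ?y T k l + mid ?y T j l - (4 - ?y) * mid ?y T k j = 0"
    by (rule mid_equation[OF l(3) mid_eq mid_eq mid_eq decimation_nz])
  have UN: "sum f (UNIV - {a}) = f b + f l" if "a \<noteq> b" "l \<noteq> a" "l \<noteq> b" for f :: "3 \<Rightarrow> real fps" and a b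
    using exhaust_3'[of a] exhaust_3'[of b] exhaust_3'[of l] that
    by (elim disjE) (simp_all add: sum_neq_3 add.commute)
  have v: "sol s T (F a (q b)) = sub s T a b" for a b
    by (simp add: sol_F)
  have s: "sub s T k j = mid ?y T k j" "sub s T k l = mid ?y T k l" "sub s T j l = mid ?y T j l"
    using assms l(1,2) by (simp_all add: sub_def)
  have "dlt (Suc 0) ?y (sol s T) (F k (q j))
      = 2 * (T k + T j + mid ?y T k l + mid ?y T j l - (4 - ?y) * mid ?y T k j)"
    unfolding dlt_1_junction[OF assms] UN[OF assms l(1,2)] UN[OF assms[symmetric] l(2,1)] v sub_same s
    by (simp add: algebra_simps)
  then show ?thesis using e by simp
qed

lemma sol_new_vertex:
  assumes "x \<in> V (Suc m)" "x \<notin> V m"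
  shows "dlt (Suc m) (lev (s + Suc m)) (sol s T) x = 0"
  using assms
proof (induction m arbitrary: s T x)
  case 0
  from 0(1) show ?case
  proof (cases rule: vertices_Suc_cases)
    case (junction k j)
    then show ?thesis using sol_junction[OF junction(2), of s T] by simp
  qed (use 0 in auto)
next
  case (Suc m)
  obtain k y where y: "x = F k y" "y \<in> V (Suc m)" using Suc.prems(1) by auto
  have "y \<notin> V m" using Suc.prems(2) y(1) F_mem_vertices_Suc by blast
  note nv = new_vertex_F[OF y(2) this]
  have "dlt (Suc (Suc m)) (lev (s + Suc (Suc m))) (sol s T) x
      = dlt (Suc m) (lev (s + Suc (Suc m))) (sol s T \<circ> F k) y"
    unfolding y(1) by (rule dlt_Suc_interior[OF y(2) nv(1)])
  also have "\<dots> = dlt (Suc m) (lev (s + Suc (Suc m))) (sol (Suc s) (sub s T k)) y"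
    by (rule dlt_cong[OF _ subsetD[OF vertices_subset_SG y(2)]]) (simp only: comp_def sol_F)
  also have "\<dots> = 0" using Suc.IH[OF y(2) \<open>y \<notin> V m\<close>, of "Suc s"] by simp
  finally show ?case .
qed

text \<open>New vertices satisfy the equation by construction. At an old vertex the descent identity
  links two levels, and (2 - y) (5 - y), a nonzero series, can be cancelled.\<close>

lemma sol_dlt:
  assumes "x \<in> V m" "x \<notin> V 0"
  shows "dlt m (lev (s + m)) (sol s T) x = 0"
  using assms
proof (induction m)
  case (Suc m)
  show ?case
  proof (cases "x \<in> V m")
    case True
    have e: "lev (s + Suc m) * (5 - lev (s + Suc m)) = lev (s + m)"
      using lev_Suc[of "s + m"] by (simp only: add_Suc_right)
    have "(6 - lev (s + Suc m)) * dlt m (lev (s + m)) (sol s T) x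
        = (2 - lev (s + Suc m)) * (5 - lev (s + Suc m)) * dlt (Suc m) (lev (s + Suc m)) (sol s T) x"
      using dlt_descend_exact[OF sol_new_vertex[where s = s and T = T] True] unfolding e .
    then show ?thesis
      using Suc.IH[OF True Suc.prems(2)] decimation_nz[of "s + Suc m"] by (metis mult_eq_0_iff)
  next
    case False
    then show ?thesis using sol_new_vertex Suc.prems(1) by blast
  qed
qed auto

lemma sol_lap:
  assumes "x \<in> V m" "x \<notin> V 0"
  shows "lap m (sol s T) x = - lev (s + m) * sol s T x"
proof -
  have "2 * (lap m (sol s T) x + lev (s + m) * sol s T x) = 0"
    using sol_dlt[OF assms, of s T] assms(2)
    by (simp add: dlt_def distrib_left mult.assoc del: sg_vertices.simps)
  moreover have "(2 :: real fps) \<noteq> 0" by simp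
  ultimately have "lap m (sol s T) x + lev (s + m) * sol s T x = 0"
    by (metis mult_eq_0_iff)
  then show ?thesis by (simp add: add_eq_0_iff2)
qed

end

section \<open>Entire corner data and the growth of solutions\<close>

definition ent :: "real fps \<Rightarrow> bool" where
  "ent A \<longleftrightarrow> fps_conv_radius A = \<infinity>"

lemma ent_add: "ent A \<Longrightarrow> ent B \<Longrightarrow> ent (A + B)"
  using fps_conv_radius_add[of A B] by (simp add: ent_def)

lemma ent_diff: "ent A \<Longrightarrow> ent B \<Longrightarrow> ent (A - B)"
  using fps_conv_radius_diff[of A B] by (simp add: ent_def)

lemma ent_mult: "ent A \<Longrightarrow> ent B \<Longrightarrow> ent (A * B)"
  using fps_conv_radius_mult[of A B] by (simp add: ent_def)

lemma ent_const: "ent (fps_const c)"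
  by (simp add: ent_def)

lemma ent_numeral: "ent (numeral k)" "ent 0" "ent 1"
  by (simp_all add: ent_def)

lemma ent_scale:
  assumes "ent A" "c > 0" shows "ent (fps_scale c A)"
  unfolding ent_def
proof (rule fps_conv_radius_infI[where c = "1 / c" and q = 2])
  fix n
  have "ereal (2 ^ n / c) \<le> fps_conv_radius (fps_scale c A)"
    using assms by (intro fps_conv_radius_scale_ge) (auto simp: ent_def)
  then show "ereal (1 / c * 2 ^ n) \<le> fps_conv_radius (fps_scale c A)" by simp
qed (use assms in auto)

lemma ent_lev: "ent (lev s)"
  unfolding lev_def by (rule ent_scale) (simp_all add: ent_def)

lemmas ent_intros = ent_add ent_diff ent_mult ent_const ent_numeral ent_lev

lemma nrm_bounded:
  assumes "ereal R < fps_conv_radius A" "R \<ge> 0"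
  shows "\<exists>C. \<forall>K. nrm K R A \<le> C"
proof -
  have "summable (\<lambda>n. norm (fps_nth A n * R ^ n))"
    using assms by (intro norm_summable_fps) simp
  then have s: "summable (\<lambda>n. \<bar>fps_nth A n\<bar> * R ^ n)" using assms by (simp add: abs_mult)
  have "nrm K R A \<le> (\<Sum>n. \<bar>fps_nth A n\<bar> * R ^ n)" for K
    unfolding nrm_def by (rule sum_le_suminf[OF s]) (use assms in auto)
  then show ?thesis by blast
qed

text \<open>
  A corner triple of this shape stays of this shape under subdivision, although the decimation rule
  divides by \<open>(2 - y) * (5 - y)\<close>: where \<open>lev s = 6\<close> its sum vanishes, and where \<open>lev s = 0\<close> it is
  constant, and these are exactly the values at which \<open>y\<close> may be 2 or 5. So no poles arise.
\<close>

definition regular :: "nat \<Rightarrow> (3 \<Rightarrow> real fps) \<Rightarrow> bool" where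
  "regular s T \<longleftrightarrow> (\<exists>\<rho> \<epsilon>. ent \<rho> \<and> (\<forall>i. ent (\<epsilon> i)) \<and> \<epsilon> 0 + \<epsilon> 1 + \<epsilon> 2 = 0 \<and>
     (\<forall>i. T i = (6 - lev s) * \<rho> + lev s * \<epsilon> i))"

lemma sub_eqI:
  assumes "i \<noteq> k" "(2 - lev (Suc s)) * (5 - lev (Suc s)) * A = (2 - lev (Suc s)) * (T k + T i) + 2 * (T 0 + T 1 + T 2)"
  shows "sub s T k i = A"
proof -
  have "(2 - lev (Suc s)) * (5 - lev (Suc s)) * mid (lev (Suc s)) T k i = (2 - lev (Suc s)) * (5 - lev (Suc s)) * A"
    unfolding mid_eq assms(2) ..
  then have "mid (lev (Suc s)) T k i = A"
    using decimation_nz[of "Suc s"] by (metis mult_left_cancel)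
  then show ?thesis using assms(1) by (simp add: sub_def)
qed

lemma sub_cmult: "sub s (\<lambda>i. c * T i) k i = c * sub s T k i"
  by (simp add: sub_def mid_def distrib_left distrib_right mult_ac)

text \<open>For corner values of the regular shape the numerator of \<open>mid\<close> is divisible
  by (2 - y) (5 - y), with a quotient that has this shape on the next level.\<close>

lemma regular_identity:
  fixes y :: "real fps"
  assumes "S = 9 * (6 - y * (5 - y)) * \<rho>"
    "a = 3 * (6 - y * (5 - y)) * \<rho> + 3 * (y * (5 - y)) * ek"
    "b = 3 * (6 - y * (5 - y)) * \<rho> + 3 * (y * (5 - y)) * eb"
  shows "(2 - y) * (5 - y) * ((6 - y) * ((3 - y) * \<rho> + y * ek) + y * ((3 - y) * \<rho> + 3 * eb - (3 - y) * ek))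
    = (2 - y) * (a + b) + 2 * S"
  unfolding assms by (simp add: algebra_simps)

lemma regular_sub:
  assumes "regular s T" shows "regular (Suc s) (sub s T k)"
proof -
  obtain \<rho>0 \<epsilon>0 where r0: "ent \<rho>0" "\<And>i. ent (\<epsilon>0 i)" "\<epsilon>0 0 + \<epsilon>0 1 + \<epsilon>0 2 = 0"
      "\<And>i. T i = (6 - lev s) * \<rho>0 + lev s * \<epsilon>0 i"
    using assms unfolding regular_def by blast
  \<comment> \<open>Taking out the factor 1/3 makes the coefficients in the new data
    integers.\<close>
  define \<rho> where "\<rho> = fps_const (1/3) * \<rho>0"
  define \<epsilon> where "\<epsilon> = (\<lambda>i. fps_const (1/3) * \<epsilon>0 i)"
  have three: "3 * (fps_const (1/3) * A) = A" for A :: "real fps"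
    unfolding mult.assoc[symmetric] by (simp add: fps_numeral_fps_const)
  have ent: "ent \<rho>" "\<And>i. ent (\<epsilon> i)" unfolding \<rho>_def \<epsilon>_def by (intro ent_intros r0)+
  have s0: "\<epsilon> 0 + \<epsilon> 1 + \<epsilon> 2 = 0"
    unfolding \<epsilon>_def using r0(3) by (simp flip: distrib_left)
  let ?y = "lev (Suc s)"
  have T: "T i = 3 * (6 - ?y * (5 - ?y)) * \<rho> + 3 * (?y * (5 - ?y)) * \<epsilon> i" for i
  proof -
    have "T i = (6 - lev s) * (3 * \<rho>) + lev s * (3 * \<epsilon> i)" unfolding r0(4) \<rho>_def \<epsilon>_def three ..
    then show ?thesis unfolding lev_Suc[of s] by (simp only: mult_ac)
  qed
  have S: "T 0 + T 1 + T 2 = 9 * (6 - ?y * (5 - ?y)) * \<rho>"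
  proof -
    have "T 0 + T 1 + T 2 = 9 * (6 - ?y * (5 - ?y)) * \<rho> + 3 * (?y * (5 - ?y)) * (\<epsilon> 0 + \<epsilon> 1 + \<epsilon> 2)"
      unfolding T by (simp add: algebra_simps)
    then show ?thesis unfolding s0 by simp
  qed
  \<comment> \<open>The sum of the new corner values must be 3 (6 - y) times this series, which
    determines it; the \<open>\<epsilon>'\<close> follow.\<close>
  define \<rho>' where "\<rho>' = (3 - ?y) * \<rho> + ?y * \<epsilon> k"
  define \<epsilon>' where "\<epsilon>' = (\<lambda>i. if i = k then (2 * ?y - 6) * \<rho> + (9 - 2 * ?y) * \<epsilon> k
     else (3 - ?y) * \<rho> + 3 * \<epsilon> i - (3 - ?y) * \<epsilon> k)"
  have "sub s T k i = (6 - ?y) * \<rho>' + ?y * \<epsilon>' i" for i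
  proof (cases "i = k")
    case True
    then show ?thesis by (simp add: T \<rho>'_def \<epsilon>'_def algebra_simps)
  next
    case False
    then show ?thesis
      unfolding \<rho>'_def \<epsilon>'_def
      by (intro sub_eqI[OF False]) (simp only: False if_False regular_identity[OF S T T])
  qed
  moreover have "\<epsilon>' 0 + \<epsilon>' 1 + \<epsilon>' 2 = 0"
  proof -
    obtain i where "i \<noteq> k" using exhaust_3'[of k] neq_3 by metis
    then obtain l where l: "l \<noteq> k" "l \<noteq> i" "\<epsilon>' 0 + \<epsilon>' 1 + \<epsilon>' 2 = \<epsilon>' k + \<epsilon>' i + \<epsilon>' l"
      using third_exists[of k i \<epsilon>'] by metis
    have "\<epsilon> 0 + \<epsilon> 1 + \<epsilon> 2 = \<epsilon> k + \<epsilon> i + \<epsilon> l"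
      using exhaust_3'[of k] exhaust_3'[of i] exhaust_3'[of l] \<open>i \<noteq> k\<close> l(1,2)
      by (elim disjE) (simp_all add: add_ac)
    then have "\<epsilon> k + \<epsilon> i + \<epsilon> l = 0" using s0 by simp
    moreover have "\<epsilon> l = (\<epsilon> k + \<epsilon> i + \<epsilon> l) - \<epsilon> k - \<epsilon> i" by simp
    ultimately have el: "\<epsilon> l = - \<epsilon> k - \<epsilon> i" by simp
    have "\<epsilon>' k + \<epsilon>' i + \<epsilon>' l = 0"
      using \<open>i \<noteq> k\<close> l(1) unfolding \<epsilon>'_def by (simp add: el algebra_simps)
    then show ?thesis using l(3) by simp
  qed
  moreover have "ent \<rho>'" unfolding \<rho>'_def by (intro ent_intros ent)
  moreover have "ent (\<epsilon>' i)" for i unfolding \<epsilon>'_def by (cases "i = k") (simp_all add: ent_intros ent)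
  ultimately show ?thesis unfolding regular_def by blast
qed

lemma regular_ent: "regular s T \<Longrightarrow> ent (T i)"
  unfolding regular_def using ent_intros by metis

context gasket
begin

text \<open>A subdivision enlarges the corner values by at most 1 + C / 5^(s+1), and the product of
  these factors over all deeper levels stays below exp (C / 5^s).\<close>

lemma sol_nrm_deep:
  assumes "R \<ge> 0" "\<And>K s. nrm K R (lev s) \<le> C / 5 ^ s" "C / 5 ^ s \<le> 1/10" "x \<in> V m"
    "\<And>i. nrm K R (T i) \<le> M"
  shows "nrm K R (sol s T x) \<le> M * exp (C / 5 ^ s)"
  using assms(3-5)
proof (induction m arbitrary: s T M x)
  case 0
  then obtain i where x: "x = q i" by auto
  have C: "0 \<le> C / 5 ^ s" using nrm_nonneg[OF assms(1), of K "lev s"] assms(2)[of K s] by linarith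
  have "0 \<le> M" using nrm_nonneg[OF assms(1), of K "T 0"] 0(3)[of 0] by linarith
  then have "M * 1 \<le> M * exp (C / 5 ^ s)" using C by (intro mult_left_mono) auto
  then show ?case using 0(3)[of i] by (simp add: x)
next
  case (Suc m)
  obtain k z where x: "x = F k z" "z \<in> V m" using Suc.prems(2) by auto
  have M: "0 \<le> M" using nrm_nonneg[OF assms(1), of K "T 0"] Suc.prems(3)[of 0] by linarith
  have C: "0 \<le> C / 5 ^ s" using nrm_nonneg[OF assms(1), of K "lev s"] assms(2)[of K s] by linarith
  have C5: "C / 5 ^ Suc s = C / 5 ^ s / 5" by simp
  have h: "t / 5 \<le> 1/10" "2 * (t / 5) \<le> t" if "0 \<le> t" "t \<le> 1/10" for t :: real
    using that by linarith+
  have le: "C / 5 ^ Suc s \<le> 1/10" unfolding C5 by (rule h(1)[OF C Suc.prems(1)])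
  have "nrm K R (sub s T k i) \<le> (1 + C / 5 ^ Suc s) * M" for i
    by (rule nrm_sub[OF assms(1) Suc.prems(3) assms(2) le])
  from Suc.IH[OF le x(2) this] have
    "nrm K R (sol (Suc s) (sub s T k) z) \<le> (1 + C / 5 ^ Suc s) * M * exp (C / 5 ^ Suc s)" .
  also have "\<dots> \<le> exp (C / 5 ^ Suc s) * M * exp (C / 5 ^ Suc s)"
    using M by (intro mult_right_mono exp_ge_add_one_self) auto
  also have "\<dots> = M * exp (2 * (C / 5 ^ Suc s))" by (simp add: mult_exp_exp mult_ac)
  also have "\<dots> \<le> M * exp (C / 5 ^ s)"
  proof -
    have "2 * (C / 5 ^ Suc s) \<le> C / 5 ^ s" unfolding C5 by (rule h(2)[OF C Suc.prems(1)])
    then show ?thesis using M by (intro mult_left_mono) auto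
  qed
  finally show ?case
    using sol_F[OF subsetD[OF vertices_subset_SG x(2)], of s T k] unfolding x(1) by simp
qed

lemma sol_nrm_cells:
  assumes "\<And>k. \<exists>C. \<forall>K m. \<forall>x\<in>V m. nrm K R (sol (Suc s) (sub s T k) x) \<le> C"
  shows "\<exists>C. \<forall>K m. \<forall>x\<in>V m. nrm K R (sol s T x) \<le> C"
proof -
  obtain C where C: "\<And>k K m x. x \<in> V m \<Longrightarrow> nrm K R (sol (Suc s) (sub s T k) x) \<le> C k"
    using assms by metis
  have "nrm K R (sol s T x) \<le> Max (range C)" if "x \<in> V m" for K m x
  proof -
    have "x \<in> V (Suc m)" using that vertices_mono_Suc by blast
    then obtain k z where x: "x = F k z" "z \<in> V m" by auto
    have "nrm K R (sol s T x) \<le> C k"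
      using C[OF x(2), of K k] sol_F[OF subsetD[OF vertices_subset_SG x(2)], of s T k] unfolding x(1) by simp
    also have "\<dots> \<le> Max (range C)" by (rule Max_ge) auto
    finally show ?thesis .
  qed
  then show ?thesis by blast
qed

text \<open>For large R the deep estimate starts only on a level where \<open>lev\<close> is small
  in this radius. Above it there are finitely many cells, whose corner values are entire by
  regularity and so have finite norm.\<close>

lemma sol_nrm_bound:
  assumes "R \<ge> 0" "regular s T"
  shows "\<exists>C. \<forall>K m. \<forall>x\<in>V m. nrm K R (sol s T x) \<le> C"
proof -
  define C where "C = (\<Sum>n. \<bar>psi_coeff n\<bar> * (2 / 3 * R) ^ n)"
  have C: "nrm K R (lev s) \<le> C / 5 ^ s" for K s
    unfolding C_def by (rule nrm_lev_bound[OF assms(1)])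
  obtain s0 where s0: "10 * C < 5 ^ s0" using real_arch_pow[of 5 "10 * C"] by auto
  have "\<exists>C. \<forall>K m. \<forall>x\<in>V m. nrm K R (sol s T x) \<le> C" if "s + d \<ge> s0" "regular s T" for d
    using that
  proof (induction d arbitrary: s T)
    case 0
    have "(5::real) ^ s0 \<le> 5 ^ s" using 0(1) by (intro power_increasing) auto
    then have "10 * C \<le> 5 ^ s" using s0 by linarith
    then have le: "C / 5 ^ s \<le> 1/10" by (simp add: field_simps)
    have "\<exists>c. \<forall>K. nrm K R (T i) \<le> c" for i
      using regular_ent[OF 0(2), of i] by (intro nrm_bounded assms(1)) (simp add: ent_def)
    then obtain c where c: "\<And>i K. nrm K R (T i) \<le> c i" by metis
    have "nrm K R (T i) \<le> Max (range c)" for i K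
      using c[of K i] by (rule order.trans) (rule Max_ge, auto)
    then show ?case using sol_nrm_deep[OF assms(1) C le] by blast
  next
    case (Suc d)
    show ?case
    proof (rule sol_nrm_cells)
      fix k
      show "\<exists>C. \<forall>K m. \<forall>x\<in>V m. nrm K R (sol (Suc s) (sub s T k) x) \<le> C"
        using Suc.prems by (intro Suc.IH regular_sub) auto
    qed
  qed
  then show ?thesis using assms(2) by (meson le_add2)
qed

lemma sol_cmult:
  assumes "x \<in> V m"
  shows "sol s (\<lambda>i. c * T i) x = c * sol s T x"
  using assms
proof (induction m arbitrary: s T x)
  case 0
  then obtain i where "x = q i" by auto
  then show ?case by simp
next
  case (Suc m)
  obtain k z where x: "x = F k z" "z \<in> V m" using Suc.prems by auto
  have z: "z \<in> SG q" using x(2) vertices_subset_SG by blast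
  have "sub s (\<lambda>i. c * T i) k = (\<lambda>i. c * sub s T k i)" by (rule ext) (rule sub_cmult)
  then show ?case unfolding x(1) sol_F[OF z] using Suc.IH[OF x(2)] by simp
qed

section \<open>Symmetry under the reflection\<close>

definition refl :: "3 \<Rightarrow> 3" where
  "refl k = (if k = 1 then 2 else if k = 2 then 1 else 0)"

lemma refl_simps [simp]: "refl 0 = 0" "refl 1 = 2" "refl 2 = 1"
  by (simp_all add: refl_def)

lemma refl_inj [simp]: "refl i = refl j \<longleftrightarrow> i = j"
  using exhaust_3'[of i] exhaust_3'[of j] by (elim disjE) simp_all

lemma rho0_vertex: "rho0 q (q k) = q (refl k)"
  using exhaust_3'[of k] rho0_vertices[OF equilateral] by (elim disjE) simp_all

lemma rho0_F: "rho0 q (F k x) = F (refl k) (rho0 q x)"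
proof -
  let ?v = "q 2 - q 1"
  have "rho0 q (F k x) = (1/2) *\<^sub>R (rho0 q x + rho0 q (q k))"
  proof -
    have e: "F k x - q 0 = (1/2) *\<^sub>R ((x - q 0) + (q k - q 0))"
      by (simp add: sg_map_def vec_eq_iff field_simps)
    have c: "2 * ((1/2) * (a + b)) / n = (1/2) * (2 * a / n + 2 * b / n)" for a b n :: real
      by (simp add: add_divide_distrib distrib_left)
    have g: "F k x - ((1/2) * (a + b)) *\<^sub>R v = (1/2) *\<^sub>R ((x - a *\<^sub>R v) + (q k - b *\<^sub>R v))"
      for a b and v :: "real^2"
      by (simp add: sg_map_def vec_eq_iff field_simps)
    show ?thesis
      unfolding rho0_def Let_def e inner_scaleR_left inner_add_left c by (rule g)
  qed
  then show ?thesis by (simp add: rho0_vertex sg_map_def)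
qed

lemma rho0_mem_vertices: "x \<in> V m \<Longrightarrow> rho0 q x \<in> V m"
proof (induction m arbitrary: x)
  case (Suc m)
  obtain k z where x: "x = F k z" "z \<in> V m" using Suc.prems by auto
  show ?case unfolding x(1) rho0_F by (rule F_mem_vertices_Suc[OF Suc.IH[OF x(2)]])
qed (auto simp: rho0_vertex)

lemma sub_refl: "sub s (T \<circ> refl) k i = sub s T (refl k) (refl i)"
  by (simp add: sub_def mid_def add_ac)

lemma sol_refl:
  assumes "x \<in> V m"
  shows "sol s T (rho0 q x) = sol s (T \<circ> refl) x"
  using assms
proof (induction m arbitrary: s T x)
  case 0
  then obtain i where "x = q i" by auto
  then show ?case by (simp add: rho0_vertex)
next
  case (Suc m)
  obtain k z where x: "x = F k z" "z \<in> V m" using Suc.prems by auto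
  have z: "z \<in> SG q" using x(2) vertices_subset_SG by blast
  have z': "rho0 q z \<in> SG q" using rho0_mem_vertices[OF x(2)] vertices_subset_SG by blast
  have "sub s (T \<circ> refl) k = sub s T (refl k) \<circ> refl" by (rule ext) (simp add: sub_refl)
  then show ?case unfolding x(1) rho0_F sol_F[OF z] sol_F[OF z'] by (simp only: Suc.IH[OF x(2)])
qed

lemma abs_le_on_SG:
  fixes u :: "real^2 \<Rightarrow> real"
  assumes "continuous_on (SG q) u" "\<And>m x. x \<in> V m \<Longrightarrow> \<bar>u x\<bar> \<le> C" "x \<in> SG q"
  shows "\<bar>u x\<bar> \<le> C"
proof -
  have "closed (SG q \<inter> u -` {-C..C})"
    by (rule continuous_closed_preimage[OF assms(1) compact_imp_closed[OF SG_char(2)] closed_atLeastAtMost])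
  moreover have "(\<Union>m. V m) \<subseteq> SG q \<inter> u -` {-C..C}"
  proof
    fix x assume "x \<in> (\<Union>m. V m)"
    then obtain m where m: "x \<in> V m" by blast
    have "- C \<le> u x" "u x \<le> C" using assms(2)[OF m] by linarith+
    then show "x \<in> SG q \<inter> u -` {-C..C}" using m vertices_subset_SG by auto
  qed
  ultimately have "closure (\<Union>m. V m) \<subseteq> SG q \<inter> u -` {-C..C}" by (rule closure_minimal[rotated])
  then have "u x \<in> {-C..C}" using assms(3) SG_char(1) by blast
  then show ?thesis by (simp add: abs_le_iff)
qed

end

section \<open>The families of the monomials\<close>

lemma fps_const_numeral_mult: "numeral k * fps_const (c::real) = fps_const (numeral k * c)"
  by (simp add: fps_numeral_fps_const)

lemma fps_scale_lev: "fps_scale (1 / 5 ^ m) (lev s) = lev (s + m)"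
  by (simp add: lev_def power_add field_simps)

text \<open>\<open>T1\<close> generates the \<open>P_{j1}\<close>: its solution is the sum of the \<open>(-lambda)^j P_{j1}\<close>.\<close>

definition T1 :: "nat \<Rightarrow> 3 \<Rightarrow> real fps" where
  "T1 s i = (if i = 0 then 1 else 1 - fps_const (1/4) * lev s)"

lemma regular_T1: "regular s (T1 s)"
  unfolding regular_def
proof (intro exI[of _ "fps_const (1/6)"] exI[of _ "\<lambda>i. if i = 0 then fps_const (1/6) else fps_const (-1/12)"] conjI allI)
  have six: "6 * fps_const (1/6::real) = 1" by (simp add: fps_const_numeral_mult)
  fix i :: 3
  show "T1 s i = (6 - lev s) * fps_const (1/6) + lev s * (if i = 0 then fps_const (1/6) else fps_const (-1/12))"
  proof (cases "i = 0")
    case True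
    then show ?thesis using six by (simp add: T1_def left_diff_distrib)
  next
    case False
    have "(6 - lev s) * fps_const (1/6) + lev s * fps_const (-1/12)
        = 6 * fps_const (1/6) - lev s * (fps_const (1/6) - fps_const (-1/12))"
      by (simp only: left_diff_distrib right_diff_distrib) simp
    also have "\<dots> = 1 - lev s * fps_const (1/4)" unfolding six by simp
    finally show ?thesis using False by (simp add: T1_def mult.commute)
  qed
next
  fix i :: 3
  show "ent (if i = 0 then fps_const (1/6) else fps_const (-1/12))" by (simp add: ent_const)
qed (simp_all add: ent_const)

text \<open>The Neumann equation 4 (b - 1) + z = 0 at \<open>q 0\<close> demands the value b = 1 - z
  / 4 at its neighbours. It has the same form on all levels.\<close>

lemma sub_T1: "sub s (T1 s) 0 = T1 (Suc s)"
proof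
  fix i :: 3
  show "sub s (T1 s) 0 i = T1 (Suc s) i"
  proof (cases "i = 0")
    case True
    then show ?thesis by (simp add: T1_def)
  next
    case False
    let ?t = "fps_const (1/4) :: real fps" and ?y = "lev (Suc s)"
    have t: "4 * ?t = 1" by (simp add: fps_const_numeral_mult)
    have z: "lev s = ?y * (5 - ?y)" by (rule lev_Suc)
    have p: "a * 8 * r = a * 2" if "4 * r = 1" for a r :: "real fps"
    proof -
      have "a * 8 * r = a * 2 * (4 * r)" by simp
      then show ?thesis using that by simp
    qed
    show ?thesis
    proof (rule sub_eqI[OF False])
      have "(2 - ?y) * (5 - ?y) * (1 - ?t * ?y) - ((2 - ?y) * (1 + (1 - ?t * (?y * (5 - ?y)))) + 2 * (1 + (1 - ?t * (?y * (5 - ?y))) + (1 - ?t * (?y * (5 - ?y)))))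
          = (5 - ?y) * ?y * (4 * ?t - 1)"
        by (simp add: algebra_simps)
      then have "(2 - ?y) * (5 - ?y) * (1 - ?t * ?y) = (2 - ?y) * (1 + (1 - ?t * (?y * (5 - ?y)))) + 2 * (1 + (1 - ?t * (?y * (5 - ?y))) + (1 - ?t * (?y * (5 - ?y))))"
        unfolding t by simp
      then show "(2 - ?y) * (5 - ?y) * T1 (Suc s) i = (2 - ?y) * (T1 s 0 + T1 s i) + 2 * (T1 s 0 + T1 s 1 + T1 s 2)"
        using False by (simp only: T1_def z if_False if_True neq_3 simp_thms)
    qed
  qed
qed

text \<open>
  \<open>TG\<close> generates the \<open>P_{j2}\<close>. Its corner values have poles in the spectral parameter, but they are
  \<open>-3/8\<close> times those of the entire family \<open>TH\<close> divided by \<open>fps_X * W 0\<close>, and \<open>lam2\<close> is the zero of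
  \<open>W 0\<close> of least modulus. The scaling by \<open>(3/5)^m\<close> in \<open>cG\<close> comes from the normal derivative.
\<close>

definition bH :: "nat \<Rightarrow> real fps" where
  "bH s = lev (Suc s) * ((2 - lev (Suc s)) * (5 - lev (Suc s)))"

definition TH :: "nat \<Rightarrow> 3 \<Rightarrow> real fps" where
  "TH s i = (if i = 0 then 0 else bH s)"

definition W :: "nat \<Rightarrow> real fps" where
  "W s = fps_scale (2 / 75 / 5 ^ s) prd"

definition bG :: "real fps" where
  "bG = fps_const (-3/8) * fps_shift 1 (bH 0) * inverse (W 0)"

definition cG :: "nat \<Rightarrow> real fps" where
  "cG m = fps_const ((3/5) ^ m) * fps_scale (1 / 5 ^ m) bG"

definition TG :: "nat \<Rightarrow> 3 \<Rightarrow> real fps" where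
  "TG m i = (if i = 0 then 0 else cG m)"

text \<open>Splits off the first factor of the product. It belongs to level s + 2 because 2/75 is
  2/3 divided by 25.\<close>

lemma W_Suc: "3 * W s = (3 - lev (s + 2)) * W (Suc s)"
proof -
  let ?c = "2 / 75 / 5 ^ s :: real"
  have "W s = fps_scale ?c ((1 - fps_const (1/3) * psi) * fps_scale (1/5) prd)"
    unfolding W_def by (subst prd_eq) (rule refl)
  also have "\<dots> = (1 - fps_const (1/3) * fps_scale ?c psi) * fps_scale (?c * (1/5)) prd"
    by (simp only: fps_scale_mult fps_scale_diff fps_scale_1 fps_scale_const fps_scale_scale)
  also have "fps_scale ?c psi = lev (s + 2)" by (simp add: lev_def power_add)
  also have "fps_scale (?c * (1/5)) prd = W (Suc s)" by (simp add: W_def)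
  finally have "3 * W s = 3 * ((1 - fps_const (1/3) * lev (s + 2)) * W (Suc s))" by simp
  also have "\<dots> = (3 - (3 * fps_const (1/3)) * lev (s + 2)) * W (Suc s)"
    by (simp only: mult.assoc[symmetric] right_diff_distrib mult_1_right)
  also have "3 * fps_const (1/3) = (1 :: real fps)" by (simp add: fps_const_numeral_mult)
  finally show ?thesis by simp
qed

lemma W_nth_0 [simp]: "fps_nth (W s) 0 = 1"
  by (simp add: W_def)

lemma W_nz: "W s \<noteq> 0"
  using W_nth_0[of s] by (metis fps_zero_nth zero_neq_one)

lemma bG_eq: "fps_X * bG * W 0 = fps_const (-3/8) * bH 0"
proof -
  have "fps_X * fps_shift 1 (bH 0) = bH 0"
    by (rule fps_ext) (simp add: bH_def)
  moreover have "inverse (W 0) * W 0 = 1" by (rule inverse_mult_eq_1) simp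
  moreover have "fps_X * bG * W 0 = fps_const (-3/8) * (fps_X * fps_shift 1 (bH 0)) * (inverse (W 0) * W 0)"
    unfolding bG_def by (simp only: mult_ac)
  ultimately show ?thesis by simp
qed

lemma cG_0: "cG 0 = bG"
  by (simp add: cG_def fps_eq_iff)

lemma cG_eq: "fps_X * cG m * W m = fps_const (-3/8 * 3 ^ m) * bH m"
proof -
  have b: "fps_scale (1 / 5 ^ m) (bH 0) = bH m"
    by (simp add: bH_def fps_scale_mult fps_scale_diff fps_scale_lev)
  have w: "fps_scale (1 / 5 ^ m) (W 0) = W m"
    by (simp add: W_def mult.commute)
  have "fps_const ((3::real) ^ m) * fps_scale (1 / 5 ^ m) (fps_X * bG * W 0)
      = fps_const (3 ^ m * (1 / 5 ^ m)) * (fps_X * fps_scale (1 / 5 ^ m) bG * W m)"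
    unfolding fps_scale_mult fps_scale_X w fps_const_mult[symmetric] by (simp only: mult_ac)
  also have "\<dots> = fps_X * cG m * W m"
    unfolding cG_def by (simp add: power_divide mult_ac)
  finally have "fps_const (3 ^ m) * (fps_const (-3/8) * bH m) = fps_X * cG m * W m"
    unfolding bG_eq fps_scale_mult b fps_scale_const .
  moreover have "fps_const (3 ^ m) * (fps_const (-3/8) * bH m) = fps_const (3 ^ m * (-3/8)) * bH m"
    by (simp only: mult.assoc[symmetric] fps_const_mult)
  moreover have "(3::real) ^ m * (-3/8) = -3/8 * 3 ^ m" by simp
  ultimately show ?thesis by metis
qed

text \<open>With Y = Z (5 - Z) one has 6 - Y = (3 - Z) (2 - Z). The factor 3 - Z is the quotient of
  \<open>3 * W m\<close> and \<open>W (Suc m)\<close>; the other factors are those of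
  \<open>bH\<close>.\<close>

lemma cG_Suc: "(2 - lev (Suc m)) * (5 - lev (Suc m)) * cG (Suc m) = (6 - lev (Suc m)) * cG m"
proof -
  let ?Y = "lev (Suc m)" and ?Z = "lev (m + 2)" and ?c = "fps_const (-3/8 * 3 ^ m) :: real fps"
  let ?N = "fps_X * W (Suc m) * (3 - ?Z)"
  have YZ: "?Y = ?Z * (5 - ?Z)" using lev_Suc[of "Suc m"] by simp
  have c3: "fps_const (-3/8 * 3 ^ Suc m) = 3 * ?c"
    by (simp add: fps_const_numeral_mult)
  have "?N * ((2 - ?Y) * (5 - ?Y) * cG (Suc m))
      = (3 - ?Z) * ((2 - ?Y) * (5 - ?Y)) * (fps_X * cG (Suc m) * W (Suc m))"
    by (simp only: mult_ac)
  also have "\<dots> = (3 - ?Z) * ((2 - ?Y) * (5 - ?Y)) * (3 * ?c * (?Z * ((2 - ?Z) * (5 - ?Z))))"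
    unfolding cG_eq c3 bH_def by simp
  also have "\<dots> = 3 * ?c * ((3 - ?Z) * (2 - ?Z)) * (?Z * (5 - ?Z)) * ((2 - ?Y) * (5 - ?Y))"
    by (simp only: mult_ac)
  also have "(3 - ?Z) * (2 - ?Z) = 6 - ?Y" unfolding YZ by (simp add: algebra_simps)
  also have "?Z * (5 - ?Z) = ?Y" by (rule YZ[symmetric])
  also have "3 * ?c * (6 - ?Y) * ?Y * ((2 - ?Y) * (5 - ?Y)) = 3 * (6 - ?Y) * (?c * bH m)"
    unfolding bH_def by (simp only: mult_ac)
  also have "\<dots> = (6 - ?Y) * (fps_X * cG m) * (3 * W m)"
    unfolding cG_eq[symmetric] by (simp only: mult_ac)
  also have "\<dots> = ?N * ((6 - ?Y) * cG m)"
    unfolding W_Suc by (simp only: mult_ac)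
  finally have "?N * ((2 - ?Y) * (5 - ?Y) * cG (Suc m)) = ?N * ((6 - ?Y) * cG m)" .
  moreover have "fps_nth (3 - ?Z) 0 \<noteq> 0" by simp
  then have "3 - ?Z \<noteq> 0" by (metis fps_zero_nth)
  then have "?N \<noteq> 0" using W_nz[of "Suc m"] by simp
  ultimately show ?thesis using mult_left_cancel by blast
qed

lemma sub_TG: "sub m (TG m) 0 = TG (Suc m)"
proof
  fix i :: 3
  show "sub m (TG m) 0 i = TG (Suc m) i"
  proof (cases "i = 0")
    case False
    show ?thesis
    proof (rule sub_eqI[OF False])
      have "(2 - lev (Suc m)) * (0 + c) + 2 * (0 + c + c) = (6 - lev (Suc m)) * c" for c
        by (simp add: algebra_simps)
      then show "(2 - lev (Suc m)) * (5 - lev (Suc m)) * TG (Suc m) i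
          = (2 - lev (Suc m)) * (TG m 0 + TG m i) + 2 * (TG m 0 + TG m 1 + TG m 2)"
        using False by (simp only: TG_def if_True if_False neq_3 simp_thms cG_Suc)
    qed
  qed (simp add: TG_def)
qed

text \<open>The lowest coefficient of the family has the normal derivative -2 times this number. The
  factor -3/8 in \<open>bG\<close> is chosen to make it 1, as \<open>bH 0\<close> has the linear
  coefficient 4/3.\<close>

lemma bG_nth_0: "fps_nth bG 0 = - 1/2"
proof -
  have "fps_nth (bH 0) (Suc 0) = 4/3"
    unfolding bH_def by (simp add: fps_mult_nth lev_nth)
  then show ?thesis unfolding bG_def by (simp add: fps_mult_nth)
qed

lemma regularI:
  assumes "ent \<rho>" "\<And>i. ent (\<epsilon> i)" "\<epsilon> 0 + \<epsilon> 1 + \<epsilon> 2 = 0"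
    "\<And>i. 3 * T i = (6 - lev s) * \<rho> + lev s * \<epsilon> i"
  shows "regular s T"
  unfolding regular_def
proof (intro exI[of _ "fps_const (1/3) * \<rho>"] exI[of _ "\<lambda>i. fps_const (1/3) * \<epsilon> i"] conjI allI)
  show "fps_const (1/3) * \<epsilon> 0 + fps_const (1/3) * \<epsilon> 1 + fps_const (1/3) * \<epsilon> 2 = 0"
    using assms(3) by (simp flip: distrib_left)
  fix i
  have "fps_const (1/3) * (3 * T i) = T i"
    by (simp add: fps_numeral_fps_const flip: mult.assoc)
  then have "T i = fps_const (1/3) * ((6 - lev s) * \<rho> + lev s * \<epsilon> i)" unfolding assms(4) by simp
  then show "T i = (6 - lev s) * (fps_const (1/3) * \<rho>) + lev s * (fps_const (1/3) * \<epsilon> i)"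
    by (simp only: distrib_left mult_ac)
qed (intro ent_intros assms)+

text \<open>The factor (2 - y) (5 - y) in \<open>bH\<close> cancels the denominator of the
  subdivision. The remaining 6 - y vanishes at \<open>lam2\<close>, which is why the limit function
  is 0 on the cell at \<open>q 0\<close>.\<close>

lemma sub_TH:
  assumes "i \<noteq> 0"
  shows "sub s (TH s) 0 i = lev (Suc s) * (6 - lev (Suc s))"
proof (rule sub_eqI[OF assms])
  let ?Y = "lev (Suc s)"
  have "(2 - ?Y) * (5 - ?Y) * (?Y * (6 - ?Y)) = (2 - ?Y) * (0 + c) + 2 * (0 + c + c)"
    if "c = ?Y * ((2 - ?Y) * (5 - ?Y))" for c
    unfolding that by (simp add: algebra_simps)
  then show "(2 - ?Y) * (5 - ?Y) * (?Y * (6 - ?Y)) = (2 - ?Y) * (TH s 0 + TH s i) + 2 * (TH s 0 + TH s 1 + TH s 2)"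
    using assms by (simp only: TH_def bH_def if_True if_False neq_3 simp_thms)
qed

text \<open>\<open>TH s\<close> itself is not regular: where \<open>lev (Suc s)\<close> is 3,
  \<open>lev s\<close> is 6 but the corner sum is not 0. The denominator is nonzero at 3, and the
  three subcells are regular.\<close>

lemma regular_TH: "regular (Suc s) (sub s (TH s) k)"
proof -
  let ?Y = "lev (Suc s)"
  note junction = sub_TH[of _ s]
  have opp: "sub s (TH s) i j = 2 * ?Y * (4 - ?Y)" if "i \<noteq> 0" "j \<noteq> 0" "j \<noteq> i" for i j
  proof (rule sub_eqI[OF that(3)])
    have "(2 - ?Y) * (5 - ?Y) * (2 * ?Y * (4 - ?Y)) = (2 - ?Y) * (c + c) + 2 * (0 + c + c)"
      if "c = ?Y * ((2 - ?Y) * (5 - ?Y))" for c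
      unfolding that by (simp add: algebra_simps)
    then show "(2 - ?Y) * (5 - ?Y) * (2 * ?Y * (4 - ?Y)) = (2 - ?Y) * (TH s i + TH s j) + 2 * (TH s 0 + TH s 1 + TH s 2)"
      using that by (simp only: TH_def bH_def if_True if_False neq_3 simp_thms)
  qed
  have other: "regular (Suc s) (sub s (TH s) i)" if ij: "i \<noteq> 0" "j \<noteq> 0" "j \<noteq> i" for i j
  \<comment> \<open>The corner values of this subcell sum to (6 - Y) (4 - Y) Y, which dictates
    \<rho>.\<close>
  proof (rule regularI[where \<rho> = "(4 - ?Y) * ?Y" and \<epsilon> = "\<lambda>l. if l = 0 then (6 - ?Y) * (?Y - 1)
      else if l = i then 3 * ((2 - ?Y) * (5 - ?Y)) - (6 - ?Y) * (4 - ?Y) else (4 - ?Y) * ?Y"])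
    fix l
    have v: "sub s (TH s) i 0 = ?Y * (6 - ?Y)"
      using sub_commute[of 0 i s "TH s"] junction[OF ij(1)] ij(1) by simp
    have vi: "sub s (TH s) i i = ?Y * ((2 - ?Y) * (5 - ?Y))"
      using ij(1) by (simp add: TH_def bH_def)
    show "3 * sub s (TH s) i l = (6 - ?Y) * ((4 - ?Y) * ?Y) + ?Y * (if l = 0 then (6 - ?Y) * (?Y - 1)
      else if l = i then 3 * ((2 - ?Y) * (5 - ?Y)) - (6 - ?Y) * (4 - ?Y) else (4 - ?Y) * ?Y)"
    proof (cases "l = 0 \<or> l = i")
      case True
      have "3 * (?Y * (6 - ?Y)) = (6 - ?Y) * ((4 - ?Y) * ?Y) + ?Y * ((6 - ?Y) * (?Y - 1))"
        "3 * (?Y * ((2 - ?Y) * (5 - ?Y)))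
          = (6 - ?Y) * ((4 - ?Y) * ?Y) + ?Y * (3 * ((2 - ?Y) * (5 - ?Y)) - (6 - ?Y) * (4 - ?Y))"
        by (simp_all add: algebra_simps)
      then show ?thesis using True ij(1) by (elim disjE) (simp_all only: v vi if_True if_False simp_thms)
    next
      case False
      then have o: "sub s (TH s) i l = 2 * ?Y * (4 - ?Y)" using opp[OF ij(1), of l] by simp
      have "3 * (2 * ?Y * (4 - ?Y)) = (6 - ?Y) * ((4 - ?Y) * ?Y) + ?Y * ((4 - ?Y) * ?Y)"
        by (simp add: algebra_simps)
      then show ?thesis using False by (simp only: o if_False de_Morgan_disj simp_thms)
    qed
  next
    show "(if (0::3) = 0 then (6 - ?Y) * (?Y - 1)
      else if 0 = i then 3 * ((2 - ?Y) * (5 - ?Y)) - (6 - ?Y) * (4 - ?Y) else (4 - ?Y) * ?Y)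
      + (if (1::3) = 0 then (6 - ?Y) * (?Y - 1)
      else if 1 = i then 3 * ((2 - ?Y) * (5 - ?Y)) - (6 - ?Y) * (4 - ?Y) else (4 - ?Y) * ?Y)
      + (if (2::3) = 0 then (6 - ?Y) * (?Y - 1)
      else if 2 = i then 3 * ((2 - ?Y) * (5 - ?Y)) - (6 - ?Y) * (4 - ?Y) else (4 - ?Y) * ?Y) = 0"
      using exhaust_3'[of i] ij(1) by (elim disjE) (simp_all add: algebra_simps)
  next
    fix l
    show "ent (if l = 0 then (6 - ?Y) * (?Y - 1)
      else if l = i then 3 * ((2 - ?Y) * (5 - ?Y)) - (6 - ?Y) * (4 - ?Y) else (4 - ?Y) * ?Y)"
      by (simp add: ent_intros)
  qed (intro ent_intros)
  have "regular (Suc s) (sub s (TH s) 0)"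
  proof (rule regularI[where \<rho> = "2 * ?Y" and \<epsilon> = "\<lambda>l. if l = 0 then - (2 * (6 - ?Y)) else 6 - ?Y"])
    fix l
    have v: "sub s (TH s) 0 0 = 0" by (simp add: TH_def)
    have "3 * (?Y * (6 - ?Y)) = (6 - ?Y) * (2 * ?Y) + ?Y * (6 - ?Y)"
      "3 * 0 = (6 - ?Y) * (2 * ?Y) + ?Y * - (2 * (6 - ?Y))"
      by (simp_all add: algebra_simps)
    then show "3 * sub s (TH s) 0 l = (6 - ?Y) * (2 * ?Y) + ?Y * (if l = 0 then - (2 * (6 - ?Y)) else 6 - ?Y)"
      using v junction[of l] by (cases "l = 0") (simp_all only: if_True if_False simp_thms)
    have "ent (0 - 2 * (6 - ?Y))" by (intro ent_intros)
    then show "ent (if l = 0 then - (2 * (6 - ?Y)) else 6 - ?Y)" by (simp add: ent_intros)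
  qed (simp_all add: ent_intros)
  then show ?thesis
    using other[of 1 2] other[of 2 1] exhaust_3'[of k] by (elim disjE) simp_all
qed

text \<open>Chosen such that the discrete eigenvalue is 3 on level 2 and hence 6 on level 1.
  \<open>lambda2_lam2\<close> identifies it with the second nonzero Neumann eigenvalue.\<close>

definition lam2 :: real where "lam2 = 75 / 2 * psi3"

text \<open>Equal to -3/8 (1 - \<lambda> / lam2) / \<open>W 0\<close>. The numerator removes the
  pole at \<open>lam2\<close>, so the radius of convergence exceeds \<open>lam2\<close>.\<close>

definition vG :: "real fps" where
  "vG = fps_const (3 / (8 * psi3)) * fps_scale (2 / 75) prd_inv"

lemma lam2_pos: "lam2 > 0"
  using psi3(1) by (simp add: lam2_def)

lemma vG_W: "vG * A = B * (1 - fps_const (1 / lam2) * fps_X)"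
  if "fps_const (-3/8) * A = W 0 * B"
proof -
  have "fps_scale (2 / 75) prd_inv * W 0 = fps_scale (2 / 75) (fps_X - fps_const psi3)"
    unfolding prd_inv_mult[symmetric] by (simp add: W_def fps_scale_mult)
  also have "\<dots> = fps_const (- psi3) * (1 - fps_const (1 / lam2) * fps_X)"
    using psi3(1) by (simp add: fps_scale_diff lam2_def right_diff_distrib mult.assoc[symmetric])
  finally have "vG * W 0 = fps_const (3 / (8 * psi3) * - psi3) * (1 - fps_const (1 / lam2) * fps_X)"
    unfolding vG_def by (simp only: mult.assoc fps_const_mult[symmetric])
  also have "3 / (8 * psi3) * - psi3 = - 3/8" using psi3(1) by simp
  finally have "vG * W 0 = fps_const (-3/8) * (1 - fps_const (1 / lam2) * fps_X)" .
  then have "vG * (W 0 * B) = fps_const (-3/8) * (B * (1 - fps_const (1 / lam2) * fps_X))"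
    by (simp only: mult.assoc[symmetric]) (simp only: mult_ac)
  then have "fps_const (-3/8) * (vG * A) = fps_const (-3/8) * (B * (1 - fps_const (1 / lam2) * fps_X))"
    unfolding that[symmetric] by (simp only: mult_ac)
  then show ?thesis by simp
qed

section \<open>Eigenfunctions of the Laplacian\<close>

text \<open>Iteration bounds a m by exp (suminf c) a n for all n \<ge> m. As the growth factors
  between levels have a convergent product, a residual that vanishes asymptotically vanishes
  exactly.\<close>

lemma decay_imp_zero:
  fixes a c :: "nat \<Rightarrow> real"
  assumes "\<And>n. 0 \<le> a n" "\<And>n. 0 \<le> c n" "summable c" "a \<longlonglongrightarrow> 0"
    "\<And>n. n \<ge> m \<Longrightarrow> a n \<le> exp (c n) * a (Suc n)"
  shows "a m = 0"
proof -
  have "a m \<le> exp (sum c {m..<n}) * a n" if "n \<ge> m" for n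
    using that
  proof (induction n rule: dec_induct)
    case (step n)
    have "exp (sum c {m..<n}) * a n \<le> exp (sum c {m..<n}) * (exp (c n) * a (Suc n))"
      using assms(5) step by (intro mult_left_mono) auto
    also have "\<dots> = exp (sum c {m..<Suc n}) * a (Suc n)"
      using step by (simp add: exp_add)
    finally show ?case using step by simp
  qed simp
  moreover have "exp (sum c {m..<n}) * a n \<le> exp (suminf c) * a n" for n
    using assms by (intro mult_right_mono) (auto intro!: sum_le_suminf)
  ultimately have le: "\<forall>n\<ge>m. a m \<le> exp (suminf c) * a n" by (meson order.trans)
  have "(\<lambda>n. exp (suminf c) * a n) \<longlonglongrightarrow> 0"
    by (intro tendsto_mult_right_zero assms)
  then have "a m \<le> 0" by (rule LIMSEQ_le_const) (use le in blast)
  then show ?thesis using assms(1)[of m] by simp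
qed

text \<open>The discrete eigenvalue on level m for a number l, the counterpart of the series
  \<open>lev m\<close>.\<close>

definition ev :: "real \<Rightarrow> nat \<Rightarrow> real" where
  "ev l m = Psi (2 / 3 * l / 5 ^ m)"

lemma ev_Suc: "ev l m = ev l (Suc m) * (5 - ev l (Suc m))"
  using Psi_div[of "2 / 3 * l / 5 ^ m"] by (simp add: ev_def mult.commute)

lemma ev_0 [simp]: "ev 0 m = 0"
  by (simp add: ev_def)

lemma ev_tendsto: "(\<lambda>m. 5 ^ m * ev l m) \<longlonglongrightarrow> 2 / 3 * l"
  unfolding ev_def by (rule pow5_Psi_tendsto)

lemma ev_bound: "\<exists>C. \<forall>m. \<bar>ev l m\<bar> \<le> C / 5 ^ m"
proof -
  have "Bseq (\<lambda>m. 5 ^ m * ev l m)" using ev_tendsto convergentI convergent_imp_Bseq by blast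
  then obtain C where "\<And>m. norm (5 ^ m * ev l m) \<le> C" unfolding Bseq_def by blast
  then have "\<bar>ev l m\<bar> \<le> C / 5 ^ m" for m by (simp add: abs_mult field_simps)
  then show ?thesis by blast
qed

lemma summable_ev: "summable (\<lambda>m. \<bar>ev l m\<bar>)"
proof -
  obtain C where C: "\<And>m. \<bar>ev l m\<bar> \<le> C / 5 ^ m" using ev_bound by blast
  have "summable (\<lambda>m. C * (1 / 5) ^ m)" by (intro summable_mult summable_geometric) simp
  then have "summable (\<lambda>m. C / 5 ^ m)" by (simp add: power_divide)
  then show ?thesis by (rule summable_comparison_test'[where N = 0]) (use C in simp)
qed

lemma ev_tendsto_0: "ev l \<longlonglongrightarrow> 0"
  using summable_LIMSEQ_zero[OF summable_ev] by (simp add: tendsto_rabs_zero_iff)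

context gasket
begin

section \<open>The Laplacian as an operator: uniqueness and linearity\<close>

lemma has_laplacian_iff:
  "has_laplacian q u f \<longleftrightarrow> continuous_on (SG q) u \<and> continuous_on (SG q) f \<and>
     (\<forall>e>0. \<exists>M. \<forall>m\<ge>M. \<forall>x. x \<in> V m \<longrightarrow> x \<notin> V 0 \<longrightarrow> \<bar>3/2 * 5 ^ m * lap m u x - f x\<bar> < e)"
  unfolding has_laplacian_def lap_def by blast

lemma has_laplacian_cong:
  assumes "has_laplacian q u f" "\<And>x. x \<in> SG q \<Longrightarrow> u x = u' x" "\<And>x. x \<in> SG q \<Longrightarrow> f x = f' x"
  shows "has_laplacian q u' f'"
proof -
  have 1: "continuous_on (SG q) u'" "continuous_on (SG q) f'"
    using assms(1) continuous_on_cong[OF refl, of "SG q" u u'] continuous_on_cong[OF refl, of "SG q" f f'] assms(2,3)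
    unfolding has_laplacian_iff by simp_all
  have "lap m u x = lap m u' x" "f x = f' x" if "x \<in> V m" for m x
  proof -
    have x: "x \<in> SG q" using that vertices_subset_SG by blast
    show "lap m u x = lap m u' x" by (rule lap_cong[OF assms(2) x])
    show "f x = f' x" by (rule assms(3)[OF x])
  qed
  then show ?thesis using assms(1) 1 unfolding has_laplacian_iff by metis
qed

lemma has_laplacian_tendsto:
  assumes "has_laplacian q u f" "x \<in> V k" "x \<notin> V 0"
  shows "(\<lambda>m. 3/2 * 5 ^ m * lap m u x) \<longlonglongrightarrow> f x"
proof (rule LIMSEQ_I)
  fix e :: real assume "e > 0"
  then obtain M where M: "\<And>m x. m \<ge> M \<Longrightarrow> x \<in> V m \<Longrightarrow> x \<notin> V 0 \<Longrightarrow> \<bar>3/2 * 5 ^ m * lap m u x - f x\<bar> < e"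
    using assms(1) unfolding has_laplacian_iff by blast
  have "norm (3/2 * 5 ^ m * lap m u x - f x) < e" if "m \<ge> max M k" for m
    using M[of m x] that assms(2,3) vertices_mono[of k m] by auto
  then show "\<exists>no. \<forall>n\<ge>no. norm (3/2 * 5 ^ n * lap n u x - f x) < e" by blast
qed

lemma has_laplacian_unique:
  assumes "has_laplacian q u f" "has_laplacian q u g" "x \<in> SG q"
  shows "f x = g x"
proof (rule dense_interior_vertices[OF _ _ _ assms(3)])
  show "continuous_on (SG q) f" "continuous_on (SG q) g"
    using assms(1,2) unfolding has_laplacian_iff by blast+
  fix m x assume "x \<in> V m" "x \<notin> V 0"
  then show "f x = g x"
    using has_laplacian_tendsto[OF assms(1)] has_laplacian_tendsto[OF assms(2)] LIMSEQ_unique by blast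
qed

lemma laplacian_eq:
  assumes "has_laplacian q u f"
  shows "laplacian q u = (\<lambda>x. if x \<in> SG q then f x else 0)"
  unfolding laplacian_def
proof (rule the_equality)
  show "has_laplacian q u (\<lambda>x. if x \<in> SG q then f x else 0)
      \<and> (\<forall>x. x \<notin> SG q \<longrightarrow> (if x \<in> SG q then f x else 0) = 0)"
    using has_laplacian_cong[OF assms, of u "\<lambda>x. if x \<in> SG q then f x else 0"] by simp
next
  fix g assume g: "has_laplacian q u g \<and> (\<forall>x. x \<notin> SG q \<longrightarrow> g x = 0)"
  show "g = (\<lambda>x. if x \<in> SG q then f x else 0)"
    using has_laplacian_unique[OF assms, of g] g by auto
qed

lemma has_laplacian_laplacian:
  assumes "u \<in> dom_laplacian q" shows "has_laplacian q u (laplacian q u)"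
proof -
  obtain f where f: "has_laplacian q u f" using assms unfolding dom_laplacian_def by blast
  show ?thesis unfolding laplacian_eq[OF f] by (rule has_laplacian_cong[OF f]) simp_all
qed

lemma lap_lincomb:
  "lap m (\<lambda>x. a * u x + b * v x) x = a * lap m u x + b * lap m v x"
  for u v :: "real^2 \<Rightarrow> real"
proof -
  have "lap m (\<lambda>x. a * u x + b * v x) x = (\<Sum>y | sg_adj q m x y. a * (u y - u x) + b * (v y - v x))"
    unfolding lap_def by (intro sum.cong refl) (simp add: algebra_simps)
  then show ?thesis by (simp add: lap_def sum.distrib sum_distrib_left)
qed

lemma has_laplacian_diff:
  assumes "has_laplacian q u f" "has_laplacian q v g"
  shows "has_laplacian q (\<lambda>x. u x - v x) (\<lambda>x. f x - g x)"
  unfolding has_laplacian_iff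
proof (intro conjI allI impI)
  show "continuous_on (SG q) (\<lambda>x. u x - v x)" "continuous_on (SG q) (\<lambda>x. f x - g x)"
    using assms unfolding has_laplacian_iff by (auto intro: continuous_on_diff)
  fix e :: real assume "e > 0"
  then have "e / 2 > 0" by simp
  then obtain M M' where
    M: "\<And>m x. m \<ge> M \<Longrightarrow> x \<in> V m \<Longrightarrow> x \<notin> V 0 \<Longrightarrow> \<bar>3/2 * 5 ^ m * lap m u x - f x\<bar> < e / 2" and
    M': "\<And>m x. m \<ge> M' \<Longrightarrow> x \<in> V m \<Longrightarrow> x \<notin> V 0 \<Longrightarrow> \<bar>3/2 * 5 ^ m * lap m v x - g x\<bar> < e / 2"
    using assms unfolding has_laplacian_iff by metis
  have "\<bar>3/2 * 5 ^ m * lap m (\<lambda>x. u x - v x) x - (f x - g x)\<bar> < e"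
    if "m \<ge> max M M'" "x \<in> V m" "x \<notin> V 0" for m x
  proof -
    have "lap m (\<lambda>x. u x - v x) x = lap m u x - lap m v x"
      using lap_lincomb[of m 1 u "-1" v x] by simp
    then have "3/2 * 5 ^ m * lap m (\<lambda>x. u x - v x) x - (f x - g x)
       = (3/2 * 5 ^ m * lap m u x - f x) - (3/2 * 5 ^ m * lap m v x - g x)"
      by (simp add: right_diff_distrib)
    then show ?thesis using M[of m x] M'[of m x] that by linarith
  qed
  then show "\<exists>M. \<forall>m\<ge>M. \<forall>x. x \<in> V m \<longrightarrow> x \<notin> V 0 \<longrightarrow> \<bar>3/2 * 5 ^ m * lap m (\<lambda>x. u x - v x) x - (f x - g x)\<bar> < e"
    by blast
qed

lemma bounded_on_SG:
  fixes u :: "real^2 \<Rightarrow> real"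
  assumes "continuous_on (SG q) u"
  obtains B where "B > 0" "\<And>x. x \<in> SG q \<Longrightarrow> \<bar>u x\<bar> \<le> B"
proof -
  have "bounded (u ` SG q)"
    by (intro compact_imp_bounded compact_continuous_image assms SG_char(2))
  then obtain B where "B > 0" "\<forall>y\<in>u ` SG q. norm y \<le> B" using bounded_pos by blast
  then show ?thesis using that by auto
qed

text \<open>The definition of the Laplacian says only that 5^m times the residual tends to 0. A
  coarser level multiplies the bound of the residual by 5 - y as long as y < 2, so
  \<open>decay_imp_zero\<close> turns this into exact equations.\<close>

lemma eigen_dlt_interior:
  assumes u: "has_laplacian q u (\<lambda>x. - l * u x)" and m0: "\<And>m. m \<ge> m0 \<Longrightarrow> ev l (Suc m) < 2"
    and m: "m \<ge> m0" and x: "x \<in> V m" "x \<notin> V 0"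
  shows "dlt m (ev l m) u x = 0"
proof -
  \<comment> \<open>The inserted 0 keeps the set nonempty at m = 0.\<close>
  define G where "G m = Max (insert 0 ((\<lambda>x. \<bar>dlt m (ev l m) u x\<bar>) ` (V m - V 0)))" for m
  have fin: "finite (insert 0 ((\<lambda>x. \<bar>dlt m (ev l m) u x\<bar>) ` (V m - V 0)))" for m
    using finite_vertices by blast
  have G: "\<bar>dlt m (ev l m) u x\<bar> \<le> G m" if "x \<in> V m" "x \<notin> V 0" for m x
    unfolding G_def using that by (intro Max_ge fin) blast
  have G0: "0 \<le> G m" for m unfolding G_def by (intro Max_ge fin) blast
  have Gle: "G m \<le> c" if "0 \<le> c" "\<And>x. x \<in> V m \<Longrightarrow> x \<notin> V 0 \<Longrightarrow> \<bar>dlt m (ev l m) u x\<bar> \<le> c" for m c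
    unfolding G_def by (subst Max_le_iff[OF fin]) (use that in auto)
  obtain B where B: "B > 0" "\<And>x. x \<in> SG q \<Longrightarrow> \<bar>u x\<bar> \<le> B"
    using u bounded_on_SG unfolding has_laplacian_iff by blast
  have "5 ^ m * G m = 0"
  proof (rule decay_imp_zero[where a = "\<lambda>m. 5 ^ m * G m" and c = "\<lambda>m. \<bar>ev l (Suc m)\<bar>" and m = m])
    show "summable (\<lambda>m. \<bar>ev l (Suc m)\<bar>)" using summable_ev by (subst summable_Suc_iff)
    show "0 \<le> 5 ^ n * G n" for n using G0 by simp
    show "5 ^ n * G n \<le> exp \<bar>ev l (Suc n)\<bar> * (5 ^ Suc n * G (Suc n))" if "n \<ge> m" for n
    proof -
      let ?y = "ev l (Suc n)"
      have y: "?y < 2" using m0[of n] m that by simp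
      have "G n \<le> (5 - ?y) * G (Suc n)"
      proof (rule Gle)
        show "0 \<le> (5 - ?y) * G (Suc n)" using y G0 by simp
        show "\<bar>dlt n (ev l n) u x\<bar> \<le> (5 - ?y) * G (Suc n)" if "x \<in> V n" "x \<notin> V 0" for x
          unfolding ev_Suc[of l n] by (rule dlt_descend_bound[OF y G that])
      qed
      also have "\<dots> \<le> (5 * exp \<bar>?y\<bar>) * G (Suc n)"
      proof (rule mult_right_mono[OF _ G0])
        have "1 + \<bar>?y\<bar> \<le> exp \<bar>?y\<bar>" by (rule exp_ge_add_one_self)
        then show "5 - ?y \<le> 5 * exp \<bar>?y\<bar>" by linarith
      qed
      finally have "5 ^ n * G n \<le> 5 ^ n * ((5 * exp \<bar>?y\<bar>) * G (Suc n))" by (intro mult_left_mono) auto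
      then show ?thesis by (simp add: mult_ac)
    qed
    show "(\<lambda>n. 5 ^ n * G n) \<longlonglongrightarrow> 0"
    proof (rule LIMSEQ_I)
      fix e :: real assume e: "e > 0"
      then have e4: "e / 4 > 0" by simp
      obtain M where M: "\<And>m x. m \<ge> M \<Longrightarrow> x \<in> V m \<Longrightarrow> x \<notin> V 0 \<Longrightarrow> \<bar>3/2 * 5 ^ m * lap m u x - - l * u x\<bar> < e / 4"
        using u e4 unfolding has_laplacian_iff by meson
      have "(\<lambda>m. 3/2 * (5 ^ m * ev l m) - l) \<longlonglongrightarrow> 3/2 * (2/3 * l) - l"
        by (intro tendsto_intros ev_tendsto)
      then have lim: "(\<lambda>m. 3/2 * (5 ^ m * ev l m) - l) \<longlonglongrightarrow> 0" by simp
      have eB: "e / 4 / B > 0" using e4 B(1) by simp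
      obtain N where N: "\<And>m. m \<ge> N \<Longrightarrow> norm (3/2 * (5 ^ m * ev l m) - l - 0) < e / 4 / B"
        using LIMSEQ_D[OF lim eB] by blast
      have "norm (5 ^ n * G n - 0) < e" if n: "n \<ge> max M N" for n
      proof -
        have "\<bar>dlt n (ev l n) u x\<bar> \<le> (2/3 * e) / 5 ^ n" if x: "x \<in> V n" "x \<notin> V 0" for x
        proof -
          have "x \<in> SG q" using x vertices_subset_SG by blast
          have d: "5 ^ n * dlt n (ev l n) u x
             = 4/3 * ((3/2 * 5 ^ n * lap n u x - - l * u x) + (3/2 * (5 ^ n * ev l n) - l) * u x)"
            unfolding dlt_def using x(2) by (simp add: algebra_simps)
          have "\<bar>(3/2 * (5 ^ n * ev l n) - l) * u x\<bar> \<le> (e / 4 / B) * B"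
            unfolding abs_mult using N[of n] n B(2)[OF \<open>x \<in> SG q\<close>] eB by (intro mult_mono) auto
          also have "\<dots> = e / 4" using B(1) by simp
          finally have b: "\<bar>(3/2 * (5 ^ n * ev l n) - l) * u x\<bar> \<le> e / 4" .
          have h: "\<bar>4/3 * (a + b)\<bar> \<le> 4/3 * (t + t)" if "\<bar>a\<bar> < t" "\<bar>b\<bar> \<le> t" for a b t :: real
            using that by (simp add: abs_mult)
          have "M \<le> n" using n by simp
          have "\<bar>5 ^ n * dlt n (ev l n) u x\<bar> \<le> 4/3 * (e / 4 + e / 4)"
            unfolding d by (rule h[OF M[OF \<open>M \<le> n\<close> x] b])
          then have "5 ^ n * \<bar>dlt n (ev l n) u x\<bar> \<le> 2/3 * e" by (simp add: abs_mult)
          then show ?thesis by (simp add: field_simps)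
        qed
        then have "G n \<le> (2/3 * e) / 5 ^ n" using e by (intro Gle) auto
        then have "5 ^ n * G n \<le> 2/3 * e" by (simp add: field_simps)
        then show ?thesis using e G0[of n] by simp
      qed
      then show "\<exists>no. \<forall>n\<ge>no. norm (5 ^ n * G n - 0) < e" by blast
    qed
  qed simp
  then have "G m = 0" by simp
  then show ?thesis using G[OF x] by simp
qed

lemma lap_corner:
  "lap m u (q k) = u ((F k ^^ m) (q (k + 1))) + u ((F k ^^ m) (q (k - 1))) - 2 * u (q k)"
  for u :: "real^2 \<Rightarrow> 'a::comm_ring_1"
proof (induction m arbitrary: u)
  case 0
  have e: "(0::3) + 1 = 1" "(0::3) - 1 = 2" "(1::3) + 1 = 2" "(1::3) - 1 = 0"
    "(2::3) + 1 = 0" "(2::3) - 1 = 1"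
    by simp_all
  from exhaust_3'[of k] show ?case
    unfolding lap_0 funpow_0 by (elim disjE) (simp_all only: e sum_neq_3, simp_all)
next
  case (Suc m)
  show ?case unfolding lap_Suc_corner Suc.IH by simp
qed

lemma has_normal_deriv_iff:
  "has_normal_deriv q u k d \<longleftrightarrow> (\<lambda>m. - ((5/3) ^ m * lap m u (q k))) \<longlonglongrightarrow> d"
proof -
  have "(5/3) ^ m * (2 * u (q k) - u ((F k ^^ m) (q (k + 1))) - u ((F k ^^ m) (q (k - 1))))
      = - ((5/3) ^ m * lap m u (q k))" for m
    unfolding lap_corner by (simp add: algebra_simps)
  then show ?thesis unfolding has_normal_deriv_def by simp
qed

lemma pow_ev_tendsto_0: "(\<lambda>m. (5/3) ^ m * ev l m) \<longlonglongrightarrow> 0"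
proof -
  have "(\<lambda>m. (1/3) ^ m * (5 ^ m * ev l m)) \<longlonglongrightarrow> 0 * (2 / 3 * l)"
    by (intro tendsto_mult LIMSEQ_power_zero ev_tendsto) simp
  then show ?thesis by (simp add: power_divide mult_ac)
qed

text \<open>The same argument with the scaling 5/3 of the normal derivative: the descent multiplies
  the corner residual by (2 - y) (5 - y) / (6 - y), at most 5/3 times exp of the summable
  |y|.\<close>

lemma eigen_dlt_corner:
  assumes nd: "has_normal_deriv q u k 0"
    and int: "\<And>m x. m \<ge> m0 \<Longrightarrow> x \<in> V m \<Longrightarrow> x \<notin> V 0 \<Longrightarrow> dlt m (ev l m) u x = 0"
    and m0: "\<And>m. m \<ge> m0 \<Longrightarrow> \<bar>ev l (Suc m)\<bar> \<le> 1/2"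
    and m: "m \<ge> m0"
  shows "dlt m (ev l m) u (q k) = 0"
proof -
  have "(5/3) ^ m * \<bar>dlt m (ev l m) u (q k)\<bar> = 0"
  proof (rule decay_imp_zero[where a = "\<lambda>m. (5/3) ^ m * \<bar>dlt m (ev l m) u (q k)\<bar>" and c = "\<lambda>m. \<bar>ev l (Suc m)\<bar>" and m = m])
    show "summable (\<lambda>m. \<bar>ev l (Suc m)\<bar>)" using summable_ev by (subst summable_Suc_iff)
    have "(\<lambda>m. - 2 * (- ((5/3) ^ m * lap m u (q k))) + ((5/3) ^ m * ev l m) * u (q k)) \<longlonglongrightarrow> - 2 * 0 + 0 * u (q k)"
      using nd unfolding has_normal_deriv_iff by (intro tendsto_intros pow_ev_tendsto_0)
    moreover have "- 2 * (- ((5/3) ^ m * lap m u (q k))) + ((5/3) ^ m * ev l m) * u (q k)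
        = (5/3) ^ m * dlt m (ev l m) u (q k)" for m
      by (simp add: dlt_def algebra_simps)
    ultimately have "(\<lambda>m. (5/3) ^ m * dlt m (ev l m) u (q k)) \<longlonglongrightarrow> 0" by simp
    then show "(\<lambda>m. (5/3) ^ m * \<bar>dlt m (ev l m) u (q k)\<bar>) \<longlonglongrightarrow> 0"
      using tendsto_rabs_zero[of "\<lambda>m. (5/3) ^ m * dlt m (ev l m) u (q k)"] by (simp add: abs_mult)
    fix n assume n: "n \<ge> m"
    let ?y = "ev l (Suc n)" and ?d = "dlt (Suc n) (ev l (Suc n)) u (q k)"
    have y: "\<bar>?y\<bar> \<le> 1/2" using m0[of n] m n by simp
    have "(6 - ?y) * dlt n (ev l n) u (q k) = (2 - ?y) * (5 - ?y) * ?d"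
      unfolding ev_Suc[of l n]
    proof (rule dlt_descend_exact)
      show "q k \<in> V n" by simp
      fix x assume x: "x \<in> V (Suc n)" "x \<notin> V n"
      then have "x \<notin> V 0" using vertices_mono[of 0 n] by blast
      then show "dlt (Suc n) ?y u x = 0" using int[of "Suc n" x] x m n by simp
    qed
    then have "\<bar>(6 - ?y) * dlt n (ev l n) u (q k)\<bar> = \<bar>(2 - ?y) * (5 - ?y) * ?d\<bar>" by simp
    then have e: "(6 - ?y) * \<bar>dlt n (ev l n) u (q k)\<bar> = ((2 - ?y) * (5 - ?y)) * \<bar>?d\<bar>"
      using y by (simp add: abs_mult)
    have "?y * ?y \<le> 1/2 * \<bar>?y\<bar>"
      using mult_right_mono[OF y abs_ge_zero[of ?y]] by (simp add: abs_mult_self_eq)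
    moreover have "?y * \<bar>?y\<bar> \<le> 1/2 * \<bar>?y\<bar>" using y by (intro mult_right_mono) auto
    ultimately have "(2 - ?y) * (5 - ?y) \<le> 5/3 * (1 + \<bar>?y\<bar>) * (6 - ?y)"
      using abs_ge_minus_self[of ?y] abs_ge_self[of ?y] by (simp add: algebra_simps)
    also have "\<dots> \<le> 5/3 * exp \<bar>?y\<bar> * (6 - ?y)"
      using y exp_ge_add_one_self[of "\<bar>?y\<bar>"] by (intro mult_right_mono mult_left_mono) auto
    finally have "((2 - ?y) * (5 - ?y)) * \<bar>?d\<bar> \<le> 5/3 * exp \<bar>?y\<bar> * (6 - ?y) * \<bar>?d\<bar>"
      by (intro mult_right_mono) auto
    then have "(6 - ?y) * \<bar>dlt n (ev l n) u (q k)\<bar> \<le> (6 - ?y) * (5/3 * exp \<bar>?y\<bar> * \<bar>?d\<bar>)"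
      unfolding e by (simp only: mult_ac)
    then have "\<bar>dlt n (ev l n) u (q k)\<bar> \<le> 5/3 * exp \<bar>?y\<bar> * \<bar>?d\<bar>"
      using y by (subst (asm) mult_le_cancel_left_pos) auto
    then have "(5/3) ^ n * \<bar>dlt n (ev l n) u (q k)\<bar> \<le> (5/3) ^ n * (5/3 * exp \<bar>?y\<bar> * \<bar>?d\<bar>)"
      by (intro mult_left_mono) auto
    then show "(5/3) ^ n * \<bar>dlt n (ev l n) u (q k)\<bar> \<le> exp \<bar>?y\<bar> * ((5/3) ^ Suc n * \<bar>?d\<bar>)"
      by (simp add: mult_ac)
  qed simp_all
  then show ?thesis by simp
qed

subsection \<open>Existence and uniqueness of the monomials\<close>

text \<open>The sign makes the Laplacian lower the index by one without a factor, as it does for the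
  monomials.\<close>

definition coef :: "(3 \<Rightarrow> real fps) \<Rightarrow> nat \<Rightarrow> real^2 \<Rightarrow> real" where
  "coef T j x = (- 1) ^ j * fps_nth (sol 0 T x) j"

lemma lap_coef:
  assumes "x \<in> V m" "x \<notin> V 0"
  shows "lap m (\<lambda>x. fps_nth (sol 0 T x) j) x = - (\<Sum>i\<le>j. fps_nth (lev m) i * fps_nth (sol 0 T x) (j - i))"
proof -
  have "lap m (\<lambda>x. fps_nth (sol 0 T x) j) x = fps_nth (lap m (sol 0 T) x) j"
    by (simp add: lap_def fps_sum_nth)
  also have "lap m (sol 0 T) x = - (lev m * sol 0 T x)" using sol_lap[OF assms, of 0 T] by simp
  finally show ?thesis by (simp add: fps_mult_nth atLeast0AtMost)
qed

text \<open>In the coefficient of \<lambda>^(j+1) of the discrete equation the linear term 2/3 5^-m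
  of \<open>lev m\<close> yields the Laplacian after scaling by 3/2 5^m. The higher terms carry at
  least 25^-m and disappear in the limit.\<close>

lemma sol_has_laplacian:
  "has_laplacian q (\<lambda>x. fps_nth (sol 0 T x) 0) (\<lambda>x. 0)"
  "has_laplacian q (\<lambda>x. fps_nth (sol 0 T x) (Suc j)) (\<lambda>x. - fps_nth (sol 0 T x) j)"
proof -
  have c: "continuous_on (SG q) (\<lambda>x. fps_nth (sol 0 T x) i)" for i by (rule continuous_on_sol)
  have "lap m (\<lambda>x. fps_nth (sol 0 T x) 0) x = 0" if "x \<in> V m" "x \<notin> V 0" for m x
    using lap_coef[OF that, of T 0] by simp
  then show "has_laplacian q (\<lambda>x. fps_nth (sol 0 T x) 0) (\<lambda>x. 0)"
    unfolding has_laplacian_iff using c by (auto intro: continuous_on_const)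
  have "\<exists>B. \<forall>x\<in>SG q. \<bar>fps_nth (sol 0 T x) i\<bar> \<le> B" for i
    by (rule bounded_on_SG[OF c[of i]]) blast
  then obtain B where B: "\<And>i x. x \<in> SG q \<Longrightarrow> \<bar>fps_nth (sol 0 T x) i\<bar> \<le> B i" by metis
  define D where "D = (\<Sum>i\<in>{2..Suc j}. B (Suc j - i))"
  have B0: "0 \<le> B i" for i using B[OF vertex_in_SG[of 0], of i] by linarith
  have D0: "0 \<le> D" unfolding D_def by (intro sum_nonneg B0)
  have err: "\<bar>3/2 * 5 ^ m * lap m (\<lambda>x. fps_nth (sol 0 T x) (Suc j)) x - - fps_nth (sol 0 T x) j\<bar> \<le> D / 5 ^ m"
    if x: "x \<in> V m" "x \<notin> V 0" for m x
  proof -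
    let ?g = "\<lambda>i. fps_nth (sol 0 T x) i" and ?l = "\<lambda>i. fps_nth (lev m) i"
    have SGx: "x \<in> SG q" using x vertices_subset_SG by blast
    have s1: "(\<Sum>i\<le>Suc j. ?l i * ?g (Suc j - i)) = ?l 1 * ?g j + (\<Sum>i\<in>{2..Suc j}. ?l i * ?g (Suc j - i))"
    proof -
      have "{..Suc j} = insert 0 (insert 1 {2..Suc j})" by auto
      then show ?thesis by simp
    qed
    have l1: "3/2 * 5 ^ m * ?l 1 = 1" by (simp add: lev_nth)
    have s2: "(\<Sum>i\<in>{2..Suc j}. 3/2 * 5 ^ m * ?l i * ?g (Suc j - i))
        = 3/2 * 5 ^ m * (\<Sum>i\<in>{2..Suc j}. ?l i * ?g (Suc j - i))"
      by (simp only: sum_distrib_left mult.assoc)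
    have s3: "c * - (l * g + s) - - g = - (c * s)" if "c * l = 1" for c l g s :: real
    proof -
      have "c * - (l * g + s) - - g = - ((c * l) * g) - c * s + g" by (simp add: algebra_simps)
      then show ?thesis using that by simp
    qed
    have e: "3/2 * 5 ^ m * lap m (\<lambda>x. fps_nth (sol 0 T x) (Suc j)) x - - ?g j
        = - (\<Sum>i\<in>{2..Suc j}. 3/2 * 5 ^ m * ?l i * ?g (Suc j - i))"
      unfolding lap_coef[OF x] s1 s2 by (rule s3[OF l1])
    have "\<bar>\<Sum>i\<in>{2..Suc j}. 3/2 * 5 ^ m * ?l i * ?g (Suc j - i)\<bar> \<le> (\<Sum>i\<in>{2..Suc j}. B (Suc j - i) / 5 ^ m)"
    proof (rule order.trans[OF sum_abs sum_mono])
      fix i assume i: "i \<in> {2..Suc j}"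
      have "\<bar>3/2 * 5 ^ m * ?l i\<bar> \<le> 1 / 5 ^ m"
      proof -
        have "(2 / 3 / 5 ^ m :: real) ^ i \<le> (2 / 3 / 5 ^ m) ^ 2"
        proof (intro power_decreasing)
          have "(1::real) \<le> 5 ^ m" by simp
          then have "(2::real) \<le> 3 * 5 ^ m" by linarith
          then show "2 / 3 / 5 ^ m \<le> (1::real)" by (simp add: field_simps)
        qed (use i in auto)
        then have "\<bar>?l i\<bar> \<le> (2 / 3 / 5 ^ m) ^ 2 * 1"
          unfolding lev_nth abs_mult using psi_coeff_le_1[of i] by (intro mult_mono) auto
        then have "3/2 * 5 ^ m * \<bar>?l i\<bar> \<le> 3/2 * 5 ^ m * ((2 / 3 / 5 ^ m) ^ 2 * 1)" by (intro mult_left_mono) auto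
        also have "\<dots> = 2 / 3 / 5 ^ m" by (simp add: power2_eq_square field_simps)
        also have "\<dots> \<le> 1 / 5 ^ m" by (intro divide_right_mono) auto
        finally show ?thesis by (simp add: abs_mult)
      qed
      then have "\<bar>3/2 * 5 ^ m * ?l i\<bar> * \<bar>?g (Suc j - i)\<bar> \<le> (1 / 5 ^ m) * B (Suc j - i)"
        using B[OF SGx] by (intro mult_mono) auto
      then show "\<bar>3/2 * 5 ^ m * ?l i * ?g (Suc j - i)\<bar> \<le> B (Suc j - i) / 5 ^ m"
        by (simp add: abs_mult)
    qed
    also have "\<dots> = D / 5 ^ m" unfolding D_def by (rule sum_divide_distrib[symmetric])
    finally show ?thesis unfolding e by simp
  qed
  show "has_laplacian q (\<lambda>x. fps_nth (sol 0 T x) (Suc j)) (\<lambda>x. - fps_nth (sol 0 T x) j)"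
    unfolding has_laplacian_iff
  proof (intro conjI allI impI)
    show "continuous_on (SG q) (\<lambda>x. fps_nth (sol 0 T x) (Suc j))" by (rule c)
    show "continuous_on (SG q) (\<lambda>x. - fps_nth (sol 0 T x) j)" by (intro continuous_on_minus c)
    fix e :: real assume "e > 0"
    then obtain M where M: "\<And>m. m \<ge> M \<Longrightarrow> norm (D / 5 ^ m - 0) < e"
      using LIMSEQ_D[OF div_pow5_tendsto_0[of D]] by blast
    show "\<exists>M. \<forall>m\<ge>M. \<forall>x. x \<in> V m \<longrightarrow> x \<notin> V 0 \<longrightarrow>
        \<bar>3/2 * 5 ^ m * lap m (\<lambda>x. fps_nth (sol 0 T x) (Suc j)) x - - fps_nth (sol 0 T x) j\<bar> < e"
    proof (intro exI[of _ M] allI impI)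
      fix m x assume m: "m \<ge> M" and x: "x \<in> V m" "x \<notin> V 0"
      show "\<bar>3/2 * 5 ^ m * lap m (\<lambda>x. fps_nth (sol 0 T x) (Suc j)) x - - fps_nth (sol 0 T x) j\<bar> < e"
        using err[OF x] M[OF m] D0 by simp
    qed
  qed
qed

lemma has_laplacian_cmult:
  assumes "has_laplacian q u f"
  shows "has_laplacian q (\<lambda>x. c * u x) (\<lambda>x. c * f x)"
  unfolding has_laplacian_iff
proof (intro conjI allI impI)
  show "continuous_on (SG q) (\<lambda>x. c * u x)" "continuous_on (SG q) (\<lambda>x. c * f x)"
    using assms unfolding has_laplacian_iff by (auto intro: continuous_on_mult continuous_on_const)
  fix e :: real assume "e > 0"
  then have "e / (\<bar>c\<bar> + 1) > 0" by simp
  then obtain M where M: "\<And>m x. m \<ge> M \<Longrightarrow> x \<in> V m \<Longrightarrow> x \<notin> V 0 \<Longrightarrow> \<bar>3/2 * 5 ^ m * lap m u x - f x\<bar> < e / (\<bar>c\<bar> + 1)"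
    using assms unfolding has_laplacian_iff by meson
  have "\<bar>3/2 * 5 ^ m * lap m (\<lambda>x. c * u x) x - c * f x\<bar> < e"
    if "m \<ge> M" "x \<in> V m" "x \<notin> V 0" for m x
  proof -
    have "lap m (\<lambda>x. c * u x) x = c * lap m u x"
      using lap_lincomb[of m c u 0 u x] by simp
    then have "3/2 * 5 ^ m * lap m (\<lambda>x. c * u x) x - c * f x = c * (3/2 * 5 ^ m * lap m u x - f x)"
      by (simp add: algebra_simps)
    then have "\<bar>3/2 * 5 ^ m * lap m (\<lambda>x. c * u x) x - c * f x\<bar> = \<bar>c\<bar> * \<bar>3/2 * 5 ^ m * lap m u x - f x\<bar>"
      by (simp only: abs_mult)
    also have "\<dots> \<le> (\<bar>c\<bar> + 1) * \<bar>3/2 * 5 ^ m * lap m u x - f x\<bar>" by (intro mult_right_mono) auto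
    also have "\<dots> < e" using M[OF that] by (simp add: field_simps)
    finally show ?thesis .
  qed
  then show "\<exists>M. \<forall>m\<ge>M. \<forall>x. x \<in> V m \<longrightarrow> x \<notin> V 0 \<longrightarrow> \<bar>3/2 * 5 ^ m * lap m (\<lambda>x. c * u x) x - c * f x\<bar> < e"
    by blast
qed

lemma coef_has_laplacian:
  "has_laplacian q (coef T 0) (\<lambda>x. 0)"
  "has_laplacian q (coef T (Suc j)) (coef T j)"
proof -
  show "has_laplacian q (coef T 0) (\<lambda>x. 0)"
    using sol_has_laplacian(1)[of T] by (simp add: coef_def[abs_def])
  have "has_laplacian q (\<lambda>x. (- 1) ^ Suc j * fps_nth (sol 0 T x) (Suc j)) (\<lambda>x. (- 1) ^ Suc j * - fps_nth (sol 0 T x) j)"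
    by (rule has_laplacian_cmult[OF sol_has_laplacian(2)])
  then show "has_laplacian q (coef T (Suc j)) (coef T j)"
    by (simp add: coef_def[abs_def])
qed

lemma coef_outside: "x \<notin> SG q \<Longrightarrow> coef T j x = 0"
  by (simp add: coef_def sol_outside)

lemma laplacian_coef:
  "laplacian q (coef T 0) = (\<lambda>x. 0)" "laplacian q (coef T (Suc j)) = coef T j"
  using laplacian_eq[OF coef_has_laplacian(1)[of T]] laplacian_eq[OF coef_has_laplacian(2)[of T j]]
  by (auto simp: coef_outside)

lemma laplacian_pow_coef: "m \<le> j \<Longrightarrow> (laplacian q ^^ m) (coef T j) = coef T (j - m)"
proof (induction m)
  case (Suc m)
  then have "j - m = Suc (j - Suc m)" by simp
  then show ?case using Suc laplacian_coef(2) by simp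
qed simp

lemma coef_polyharmonic: "coef T j \<in> polyharmonic q j"
proof -
  have "coef T j \<in> dom_laplacian_pow q (Suc j)"
  proof (induction j)
    case 0
    have "coef T 0 \<in> dom_laplacian q" unfolding dom_laplacian_def using coef_has_laplacian(1) by blast
    then show ?case by (simp add: laplacian_coef continuous_on_const)
  next
    case (Suc j)
    have "coef T (Suc j) \<in> dom_laplacian q" unfolding dom_laplacian_def using coef_has_laplacian(2) by blast
    then show ?case using Suc unfolding dom_laplacian_pow.simps(2)[of q "Suc j"]
      by (simp only: mem_Collect_eq laplacian_coef(2) simp_thms)
  qed
  moreover have "(laplacian q ^^ (j + 1)) (coef T j) = (\<lambda>x. 0)"
    using laplacian_pow_coef[of j j T] laplacian_coef(1)[of T] by simp
  ultimately show ?thesis unfolding polyharmonic_def by simp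
qed

lemma three_arith: "(0::3) + 1 = 1" "(0::3) - 1 = 2"
  by simp_all

lemma F0_pow_in_SG: "x \<in> SG q \<Longrightarrow> (F k ^^ m) x \<in> SG q"
  by (induction m) auto

text \<open>Families stable under subdivision at \<open>q 0\<close> have explicit values at all
  points that enter the derivatives there.\<close>

lemma sol_F0_pow:
  assumes "\<And>s. sub s (T s) 0 = T (Suc s)" "x \<in> SG q"
  shows "sol s (T s) ((F 0 ^^ m) x) = sol (s + m) (T (s + m)) x"
proof (induction m arbitrary: s)
  case (Suc m)
  have "sol s (T s) ((F 0 ^^ Suc m) x) = sol s (T s) (F 0 ((F 0 ^^ m) x))" by simp
  also have "\<dots> = sol (Suc s) (sub s (T s) 0) ((F 0 ^^ m) x)"
    by (rule sol_F[OF F0_pow_in_SG[OF assms(2)]])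
  finally have "sol s (T s) ((F 0 ^^ Suc m) x) = sol (Suc s) (T (Suc s)) ((F 0 ^^ m) x)"
    unfolding assms(1) .
  then show ?case using Suc.IH[of "Suc s"] by simp
qed simp

lemma coef_F0_pow:
  assumes "\<And>s. sub s (T s) 0 = T (Suc s)"
  shows "coef (T 0) j ((F 0 ^^ m) (q i)) = (- 1) ^ j * fps_nth (T m i) j"
  using sol_F0_pow[of T "q i" 0 m, OF assms] by (simp add: coef_def)

lemma tangential_zero:
  assumes "\<And>s. sub s (T s) 0 = T (Suc s)" "\<And>s. T s 1 = T s 2"
  shows "has_tangential_deriv q (coef (T 0) j) 0 0"
  unfolding has_tangential_deriv_def three_arith coef_F0_pow[of T, OF assms(1)] assms(2) by simp

lemma coef_T1_normal: "has_normal_deriv q (coef (T1 0) j) 0 0"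
proof -
  have e: "- ((5/3) ^ m * lap m (coef (T1 0) j) (q 0)) = (- 1) ^ j * (1/2) * ((5/3) ^ m * fps_nth (lev m) j)" for m
  proof -
    have "coef (T1 0) j (q 0) = (- 1) ^ j * fps_nth 1 j"
      using coef_F0_pow[of T1 j 0 0, OF sub_T1] by (simp add: T1_def)
    then show ?thesis
      unfolding lap_corner three_arith coef_F0_pow[of T1, OF sub_T1]
      by (simp add: T1_def algebra_simps)
  qed
  have "(\<lambda>m. (5/3) ^ m * fps_nth (lev m) j) \<longlonglongrightarrow> 0"
  proof (rule Lim_null_comparison)
    show "\<forall>\<^sub>F m in sequentially. norm ((5/3) ^ m * fps_nth (lev m) j) \<le> (1/3) ^ m"
    proof (rule always_eventually, rule allI)
      fix m
      have "\<bar>psi_coeff j\<bar> * (2 / 3) ^ j \<le> 1 * 1"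
        by (intro mult_mono psi_coeff_le_1) (auto simp: power_le_one)
      then have "\<bar>psi_coeff j\<bar> * (2 / 3) ^ j / 5 ^ m \<le> 1 / 5 ^ m"
        by (intro divide_right_mono) auto
      then have "\<bar>fps_nth (lev m) j\<bar> \<le> 1 / 5 ^ m" using lev_nth_le[of 1 m j] by simp
      then have "(5/3) ^ m * \<bar>fps_nth (lev m) j\<bar> \<le> (5/3) ^ m * (1 / 5 ^ m)" by (intro mult_left_mono) auto
      also have "\<dots> = (1/3) ^ m" by (simp add: power_divide)
      finally show "norm ((5/3) ^ m * fps_nth (lev m) j) \<le> (1/3) ^ m" by (simp add: abs_mult)
    qed
    show "(\<lambda>m. (1/3) ^ m) \<longlonglongrightarrow> (0::real)" by (rule LIMSEQ_power_zero) simp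
  qed
  from tendsto_mult_right_zero[OF this, of "(- 1) ^ j * (1/2)"]
  show ?thesis unfolding has_normal_deriv_iff e .
qed

text \<open>The scaling (3/5)^m in \<open>cG\<close> cancels (5/3)^m. What remains is a constant
  times 5^(-j m), which is constant for j = 0 and tends to 0 otherwise.\<close>

lemma coef_TG_normal: "has_normal_deriv q (coef (TG 0) j) 0 (of_bool (j = 0))"
proof -
  have e: "- ((5/3) ^ m * lap m (coef (TG 0) j) (q 0)) = (- 1) ^ j * (- 2) * (1 / 5 ^ j) ^ m * fps_nth bG j" for m
  proof -
    have "coef (TG 0) j (q 0) = 0"
      using coef_F0_pow[of TG j 0 0, OF sub_TG] by (simp add: TG_def)
    moreover have "(5/3) ^ m * (fps_nth (cG m) j) = (1 / 5 ^ j) ^ m * fps_nth bG j"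
    proof -
      have "(5/3) ^ m * (3/5) ^ m = (1::real)" by (simp flip: power_mult_distrib)
      moreover have "((1::real) / 5 ^ m) ^ j = (1 / 5 ^ j) ^ m"
        by (simp add: power_divide mult.commute flip: power_mult)
      ultimately show ?thesis by (simp add: cG_def mult.assoc[symmetric])
    qed
    ultimately show ?thesis
      unfolding lap_corner three_arith coef_F0_pow[of TG, OF sub_TG]
      by (simp add: TG_def mult_ac)
  qed
  show ?thesis
  proof (cases "j = 0")
    case True
    then show ?thesis unfolding has_normal_deriv_iff e by (simp add: bG_nth_0)
  next
    case False
    then have "(5::real) ^ 1 \<le> 5 ^ j" by (intro power_increasing) auto
    then have "(\<lambda>m. (1 / 5 ^ j) ^ m) \<longlonglongrightarrow> (0::real)" by (intro LIMSEQ_power_zero) simp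
    then have "(\<lambda>m. (- 1) ^ j * (- 2) * (1 / 5 ^ j) ^ m * fps_nth bG j) \<longlonglongrightarrow> 0"
      by (intro tendsto_mult_left_zero tendsto_mult_right_zero)
    then show ?thesis unfolding has_normal_deriv_iff e using False by simp
  qed
qed

lemma is_monomial_T1: "is_monomial q j 1 (coef (T1 0) j)"
  unfolding is_monomial_def
proof (intro conjI allI impI coef_polyharmonic)
  fix m assume m: "m \<le> j"
  have "coef (T1 0) (j - m) (q 0) = of_bool (m = j)"
    using coef_F0_pow[of T1 "j - m" 0 0, OF sub_T1] m by (auto simp: T1_def)
  then show "(laplacian q ^^ m) (coef (T1 0) j) (q 0) = of_bool (m = j \<and> (1::nat) = 1)"
    unfolding laplacian_pow_coef[OF m] by simp
  show "has_normal_deriv q ((laplacian q ^^ m) (coef (T1 0) j)) 0 (of_bool (m = j \<and> (1::nat) = 2))"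
    unfolding laplacian_pow_coef[OF m] using coef_T1_normal by simp
  show "has_tangential_deriv q ((laplacian q ^^ m) (coef (T1 0) j)) 0 (of_bool (m = j \<and> (1::nat) = 3))"
    unfolding laplacian_pow_coef[OF m] using tangential_zero[of T1, OF sub_T1] by (simp add: T1_def)
qed

lemma is_monomial_TG: "is_monomial q j 2 (coef (TG 0) j)"
  unfolding is_monomial_def
proof (intro conjI allI impI coef_polyharmonic)
  fix m assume m: "m \<le> j"
  have "coef (TG 0) (j - m) (q 0) = 0"
    using coef_F0_pow[of TG "j - m" 0 0, OF sub_TG] by (simp add: TG_def)
  then show "(laplacian q ^^ m) (coef (TG 0) j) (q 0) = of_bool (m = j \<and> (2::nat) = 1)"
    unfolding laplacian_pow_coef[OF m] by simp
  have "(j - m = 0) = (m = j)" using m by auto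
  then show "has_normal_deriv q ((laplacian q ^^ m) (coef (TG 0) j)) 0 (of_bool (m = j \<and> (2::nat) = 2))"
    unfolding laplacian_pow_coef[OF m] using coef_TG_normal[of "j - m"] by simp
  show "has_tangential_deriv q ((laplacian q ^^ m) (coef (TG 0) j)) 0 (of_bool (m = j \<and> (2::nat) = 3))"
    unfolding laplacian_pow_coef[OF m] using tangential_zero[of TG, OF sub_TG] by (simp add: TG_def)
qed

text \<open>Subtracting the junction equations at F 0 (q 1) and F 0 (q 2) shows that the
  antisymmetric part is divided by exactly 5 per level.\<close>

lemma harmonic_tangential:
  fixes u :: "real^2 \<Rightarrow> real"
  assumes "\<And>m x. x \<in> V m \<Longrightarrow> x \<notin> V 0 \<Longrightarrow> dlt m 0 u x = 0"
  shows "5 ^ m * (u ((F 0 ^^ m) (q 1)) - u ((F 0 ^^ m) (q 2))) = u (q 1) - u (q 2)"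
  using assms
proof (induction m arbitrary: u)
  case (Suc m)
  have e: "dlt (Suc 0) 0 u (F k (q j)) = 0" if "k \<noteq> j" for k j
    using new_junction[OF that] by (rule Suc.prems)
  have "5 * (u (F 0 (q 1)) - u (F 0 (q 2))) = u (q 1) - u (q 2)"
    using e[of 0 1] e[of 0 2] by (simp add: dlt_1_junction sum_neq_3 F_commute)
  moreover have "5 ^ m * ((u \<circ> F 0) ((F 0 ^^ m) (q 1)) - (u \<circ> F 0) ((F 0 ^^ m) (q 2))) = (u \<circ> F 0) (q 1) - (u \<circ> F 0) (q 2)"
  proof (rule Suc.IH)
    fix n x assume x: "x \<in> V n" "x \<notin> V 0"
    have "F 0 x \<notin> V 0" using F_not_vertex x vertices_subset_SG by blast
    then have "dlt (Suc n) 0 u (F 0 x) = 0" by (rule Suc.prems[OF F_mem_vertices_Suc[OF x(1)]])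
    then show "dlt n 0 (u \<circ> F 0) x = 0" unfolding dlt_Suc_interior[OF x] .
  qed
  ultimately show ?case by simp
qed simp

text \<open>By the exact equations for l = 0 the rescaled difference quotients at \<open>q 0\<close>
  are the same on all levels. So the jet determines the sum and the difference of the two other
  corner values.\<close>

lemma harmonic_jet_zero:
  assumes "has_laplacian q u f" "\<And>x. x \<in> SG q \<Longrightarrow> f x = 0"
    "u (q 0) = 0" "has_normal_deriv q u 0 0" "has_tangential_deriv q u 0 0" "x \<in> SG q"
  shows "u x = 0"
proof -
  have h: "has_laplacian q u (\<lambda>x. - 0 * u x)"
    by (rule has_laplacian_cong[OF assms(1)]) (simp_all add: assms(2))
  have d: "dlt m 0 u x = 0" if "x \<in> V m" "x \<notin> V 0" for m x
    using eigen_dlt_interior[OF h _ _ that, of 0] by simp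
  have "6 * dlt m 0 u (q 0) = 10 * dlt (Suc m) 0 u (q 0)" for m
  proof -
    have "dlt (Suc m) 0 u x = 0" if "x \<in> V (Suc m)" "x \<notin> V m" for x
      using d[OF that(1)] that(2) vertices_mono[of 0 m] by blast
    from dlt_descend_exact[OF this, of "q 0"] show ?thesis by simp
  qed
  then have rec: "(5/3) ^ Suc m * lap (Suc m) u (q 0) = (5/3) ^ m * lap m u (q 0)" for m
  proof -
    assume a: "\<And>m. 6 * dlt m 0 u (q 0) = 10 * dlt (Suc m) 0 u (q 0)"
    have "5/3 * lap (Suc m) u (q 0) = lap m u (q 0)" using a[of m] by (simp add: dlt_def)
    then show ?thesis by (simp add: mult_ac) 
  qed
  have "(5/3) ^ m * lap m u (q 0) = lap 0 u (q 0)" for m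
    by (induction m) (simp, metis rec)
  then have "(\<lambda>m::nat. - lap 0 u (q 0)) \<longlonglongrightarrow> 0" using assms(4) unfolding has_normal_deriv_iff by simp
  then have "lap 0 u (q 0) = 0" by (simp add: LIMSEQ_const_iff)
  then have s: "u (q 1) + u (q 2) = 0"
    using assms(3) by (simp add: lap_0 sum_neq_3)
  have "(\<lambda>m::nat. u (q 1) - u (q 2)) \<longlonglongrightarrow> 0"
    using assms(5) harmonic_tangential[of u, OF d] unfolding has_tangential_deriv_def three_arith by simp
  then have "u (q 1) - u (q 2) = 0" by (simp add: LIMSEQ_const_iff)
  then have z: "u (q i) = 0" for i using s assms(3) exhaust_3'[of i] by (elim disjE) simp_all
  have "u x = 0" if x: "x \<in> V m" for m x
  proof (rule vertices_zero[where y = "\<lambda>m. 0" and u = u and x = x and m = m])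
    show "u (q i) = 0" for i by (rule z)
    fix m x assume "x \<in> V (Suc m)" "x \<notin> V m"
    then show "dlt (Suc m) 0 u x = 0" using d[of x "Suc m"] vertices_mono[of 0 m] by blast
  qed (use x in simp_all)
  then show ?thesis
    using dense_vertices[of u "\<lambda>x. 0", OF _ _ _ assms(6)] assms(1) unfolding has_laplacian_iff
    by (simp add: continuous_on_const)
qed

lemma has_normal_deriv_diff:
  "has_normal_deriv q u k a \<Longrightarrow> has_normal_deriv q v k b \<Longrightarrow> has_normal_deriv q (\<lambda>x. u x - v x) k (a - b)"
  unfolding has_normal_deriv_def by (drule (1) tendsto_diff) (simp add: algebra_simps)

lemma has_tangential_deriv_diff:
  "has_tangential_deriv q u k a \<Longrightarrow> has_tangential_deriv q v k b \<Longrightarrow> has_tangential_deriv q (\<lambda>x. u x - v x) k (a - b)"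
  unfolding has_tangential_deriv_def by (drule (1) tendsto_diff) (simp add: algebra_simps)

text \<open>The induction hypothesis applied to the Laplacians makes the difference of the two
  functions harmonic, with zero jet.\<close>

lemma jets_unique:
  assumes "u \<in> dom_laplacian_pow q (Suc j)" "v \<in> dom_laplacian_pow q (Suc j)"
    "\<And>x. x \<in> SG q \<Longrightarrow> (laplacian q ^^ Suc j) u x = (laplacian q ^^ Suc j) v x"
    "\<And>m. m \<le> j \<Longrightarrow> (laplacian q ^^ m) u (q 0) = (laplacian q ^^ m) v (q 0)"
    "\<And>m. m \<le> j \<Longrightarrow> \<exists>d. has_normal_deriv q ((laplacian q ^^ m) u) 0 d \<and> has_normal_deriv q ((laplacian q ^^ m) v) 0 d"
    "\<And>m. m \<le> j \<Longrightarrow> \<exists>d. has_tangential_deriv q ((laplacian q ^^ m) u) 0 d \<and> has_tangential_deriv q ((laplacian q ^^ m) v) 0 d"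
    "x \<in> SG q"
  shows "u x = v x"
  using assms
proof (induction j arbitrary: u v x)
  case 0
  have hu: "has_laplacian q u (laplacian q u)" and hv: "has_laplacian q v (laplacian q v)"
    using 0(1,2) has_laplacian_laplacian by simp_all
  obtain a where a: "has_normal_deriv q u 0 a" "has_normal_deriv q v 0 a" using 0(5)[of 0] by auto
  obtain b where b: "has_tangential_deriv q u 0 b" "has_tangential_deriv q v 0 b" using 0(6)[of 0] by auto
  have "u x - v x = 0"
  proof (rule harmonic_jet_zero[OF has_laplacian_diff[OF hu hv] _ _ _ _ 0(7)])
    show "laplacian q u y - laplacian q v y = 0" if "y \<in> SG q" for y using 0(3)[OF that] by simp
    show "u (q 0) - v (q 0) = 0" using 0(4)[of 0] by simp
    show "has_normal_deriv q (\<lambda>x. u x - v x) 0 0" using has_normal_deriv_diff[OF a] by simp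
    show "has_tangential_deriv q (\<lambda>x. u x - v x) 0 0" using has_tangential_deriv_diff[OF b] by simp
  qed
  then show ?case by simp
next
  case (Suc j)
  have hu: "has_laplacian q u (laplacian q u)" and hv: "has_laplacian q v (laplacian q v)"
    using Suc.prems(1,2) has_laplacian_laplacian by simp_all
  have sh: "(laplacian q ^^ m) (laplacian q w) = (laplacian q ^^ Suc m) w" for m w
    by (simp only: funpow_swap1 funpow.simps comp_def)
  have eq: "laplacian q u y = laplacian q v y" if "y \<in> SG q" for y
  proof (rule Suc.IH[OF _ _ _ _ _ _ that])
    show "laplacian q u \<in> dom_laplacian_pow q (Suc j)" "laplacian q v \<in> dom_laplacian_pow q (Suc j)"
      using Suc.prems(1,2) unfolding dom_laplacian_pow.simps(2)[of q "Suc j"] by blast+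
    show "(laplacian q ^^ Suc j) (laplacian q u) z = (laplacian q ^^ Suc j) (laplacian q v) z" if "z \<in> SG q" for z
      unfolding sh by (rule Suc.prems(3)[OF that])
    fix m assume m: "m \<le> j"
    then have m': "Suc m \<le> Suc j" by simp
    show "(laplacian q ^^ m) (laplacian q u) (q 0) = (laplacian q ^^ m) (laplacian q v) (q 0)"
      unfolding sh by (rule Suc.prems(4)[OF m'])
    show "\<exists>d. has_normal_deriv q ((laplacian q ^^ m) (laplacian q u)) 0 d \<and> has_normal_deriv q ((laplacian q ^^ m) (laplacian q v)) 0 d"
      unfolding sh by (rule Suc.prems(5)[OF m'])
    show "\<exists>d. has_tangential_deriv q ((laplacian q ^^ m) (laplacian q u)) 0 d \<and> has_tangential_deriv q ((laplacian q ^^ m) (laplacian q v)) 0 d"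
      unfolding sh by (rule Suc.prems(6)[OF m'])
  qed
  obtain a where a: "has_normal_deriv q u 0 a" "has_normal_deriv q v 0 a" using Suc.prems(5)[of 0] by auto
  obtain b where b: "has_tangential_deriv q u 0 b" "has_tangential_deriv q v 0 b" using Suc.prems(6)[of 0] by auto
  have "u x - v x = 0"
  proof (rule harmonic_jet_zero[OF has_laplacian_diff[OF hu hv] _ _ _ _ Suc.prems(7)])
    show "laplacian q u y - laplacian q v y = 0" if "y \<in> SG q" for y using eq[OF that] by simp
    show "u (q 0) - v (q 0) = 0" using Suc.prems(4)[of 0] by simp
    show "has_normal_deriv q (\<lambda>x. u x - v x) 0 0" using has_normal_deriv_diff[OF a] by simp
    show "has_tangential_deriv q (\<lambda>x. u x - v x) 0 0" using has_tangential_deriv_diff[OF b] by simp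
  qed
  then show ?case by simp
qed

lemma monomial_eq:
  assumes "is_monomial q j k u" "\<And>x. x \<notin> SG q \<Longrightarrow> u x = 0"
  shows "monomial q j k = u"
  unfolding monomial_def
proof (rule the_equality)
  show "is_monomial q j k u \<and> (\<forall>x. x \<notin> SG q \<longrightarrow> u x = 0)" using assms by blast
  fix v assume v: "is_monomial q j k v \<and> (\<forall>x. x \<notin> SG q \<longrightarrow> v x = 0)"
  have "v x = u x" if "x \<in> SG q" for x
  proof (rule jets_unique[OF _ _ _ _ _ _ that])
    show "v \<in> dom_laplacian_pow q (Suc j)" "u \<in> dom_laplacian_pow q (Suc j)"
      "\<And>x. x \<in> SG q \<Longrightarrow> (laplacian q ^^ Suc j) v x = (laplacian q ^^ Suc j) u x"
      using v assms(1) unfolding is_monomial_def polyharmonic_def by simp_all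
    fix m assume "m \<le> j"
    then show "(laplacian q ^^ m) v (q 0) = (laplacian q ^^ m) u (q 0)"
      "\<exists>d. has_normal_deriv q ((laplacian q ^^ m) v) 0 d \<and> has_normal_deriv q ((laplacian q ^^ m) u) 0 d"
      "\<exists>d. has_tangential_deriv q ((laplacian q ^^ m) v) 0 d \<and> has_tangential_deriv q ((laplacian q ^^ m) u) 0 d"
      using v assms(1) unfolding is_monomial_def by metis+
  qed
  then show "v = u" using v assms(2) by (intro ext) metis
qed

lemma monomial_1: "monomial q j 1 = coef (T1 0) j"
  by (rule monomial_eq[OF is_monomial_T1 coef_outside])

lemma monomial_2: "monomial q j 2 = coef (TG 0) j"
  by (rule monomial_eq[OF is_monomial_TG coef_outside])

end

section \<open>The Neumann spectrum below the second eigenvalue\<close>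

lemma eval_lev: "eval_fps (lev m) l = ev l m"
  by (simp add: lev_def eval_fps_scale Psi_def ev_def)

text \<open>Here the discrete eigenvalue is 3 on level 1 and 6 on level 0, the nonzero Neumann
  eigenvalue of the triangle.\<close>

definition lam1 :: real where "lam1 = 15 / 2 * psi3"

lemma lam_order: "0 < lam1" "lam1 < lam2"
  using psi3(1) by (simp_all add: lam1_def lam2_def)

lemma ev_small:
  assumes "l \<le> lam2" "m \<ge> 3"
  shows "ev l m < 7/10"
  unfolding ev_def
proof (rule Psi_small)
  show "2 / 3 * l / 5 ^ m \<le> psi3 / 5"
  proof (cases "l \<ge> 0")
    case True
    have "(5::real) ^ 3 \<le> 5 ^ m" using assms(2) by (intro power_increasing) auto
    then have "2 / 3 * l / 5 ^ m \<le> 2 / 3 * l / 5 ^ 3" using True by (intro divide_left_mono) auto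
    also have "\<dots> \<le> psi3 / 5" using assms(1) by (simp add: lam2_def)
    finally show ?thesis .
  next
    case False
    then have "2 / 3 * l / 5 ^ m \<le> 0" by (simp add: divide_nonpos_pos)
    then show ?thesis using psi3(1) by simp
  qed
qed

lemma ev_lam1: "ev lam1 0 = 6" "ev lam1 (Suc 0) = 3" "ev lam1 (Suc (Suc m)) < 7/10"
proof -
  have "2 / 3 * lam1 = 5 * psi3" by (simp add: lam1_def)
  then show "ev lam1 0 = 6" "ev lam1 (Suc 0) = 3" by (simp_all add: ev_def Psi_5_psi3 psi3)
  have "(1::real) \<le> 5 ^ m" by simp
  then have "psi3 / 5 ^ m \<le> psi3" using psi3(1) by (simp add: divide_le_eq mult_le_cancel_left1)
  then show "ev lam1 (Suc (Suc m)) < 7/10"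
    unfolding ev_def lam1_def by (intro Psi_small) simp
qed

lemma ev_lam2: "ev lam2 (Suc 0) = 6" "ev lam2 (Suc (Suc 0)) = 3"
proof -
  have "2 / 3 * lam2 / 5 ^ Suc 0 = 5 * psi3" "2 / 3 * lam2 / 5 ^ Suc (Suc 0) = psi3"
    by (simp_all add: lam2_def)
  then show "ev lam2 (Suc 0) = 6" "ev lam2 (Suc (Suc 0)) = 3"
    unfolding ev_def by (simp_all only: Psi_5_psi3 psi3)
qed

lemma ev_lam2_regular: "ev lam2 (Suc (Suc m)) \<noteq> 2" "ev lam2 (Suc (Suc m)) \<noteq> 5"
proof -
  have "ev lam2 (Suc (Suc m)) = 3 \<or> ev lam2 (Suc (Suc m)) < 7/10"
    using ev_lam2(2) ev_small[of lam2 "Suc (Suc m)"] by (cases m) auto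
  then show "ev lam2 (Suc (Suc m)) \<noteq> 2" "ev lam2 (Suc (Suc m)) \<noteq> 5" by auto
qed

context gasket
begin

text \<open>The descent reversed: away from 2 and 5 the corner equation passes to finer levels. It
  makes the discrete Laplacian at the corner of order \<open>ev l m\<close>, which is too small for
  a nonzero normal derivative.\<close>

lemma dlt_ascend_corner:
  fixes u :: "real^2 \<Rightarrow> real"
  assumes "\<And>m x. x \<in> V (Suc m) \<Longrightarrow> x \<notin> V 0 \<Longrightarrow> dlt (Suc m) (ev l (Suc m)) u x = 0"
    and start: "dlt m0 (ev l m0) u (q k) = 0"
    and reg: "\<And>m. m \<ge> m0 \<Longrightarrow> ev l (Suc m) \<noteq> 2 \<and> ev l (Suc m) \<noteq> 5"
  shows "has_normal_deriv q u k 0"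
proof -
  have z: "dlt m (ev l m) u (q k) = 0" if "m \<ge> m0" for m
    using that
  proof (induction m rule: dec_induct)
    case (step m)
    let ?y = "ev l (Suc m)"
    have "(6 - ?y) * dlt m (ev l m) u (q k) = (2 - ?y) * (5 - ?y) * dlt (Suc m) ?y u (q k)"
      unfolding ev_Suc[of l m]
    proof (rule dlt_descend_exact)
      fix x assume x: "x \<in> V (Suc m)" "x \<notin> V m"
      show "dlt (Suc m) ?y u x = 0" using assms(1)[OF x(1)] x(2) vertices_mono[of 0 m] by blast
    qed simp
    then show ?case using step.IH reg[OF step.hyps(1)] by simp
  qed (rule start)
  have "(\<lambda>m. (1/2 * u (q k)) * ((5/3) ^ m * ev l m)) \<longlonglongrightarrow> 0"
    by (rule tendsto_mult_right_zero[OF pow_ev_tendsto_0])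
  moreover have "\<forall>\<^sub>F m in sequentially. (1/2 * u (q k)) * ((5/3) ^ m * ev l m) = - ((5/3) ^ m * lap m u (q k))"
    using eventually_ge_at_top[of m0]
  proof eventually_elim
    case (elim m)
    have "lap m u (q k) = - (1/2) * (ev l m * u (q k))" using z[OF elim] by (simp add: dlt_def)
    then show ?case by simp
  qed
  ultimately show ?thesis unfolding has_normal_deriv_iff by (rule Lim_transform_eventually)
qed

lemma eigen_has_laplacian:
  fixes u :: "real^2 \<Rightarrow> real"
  assumes c: "continuous_on (SG q) u"
    and e: "\<And>m x. x \<in> V m \<Longrightarrow> x \<notin> V 0 \<Longrightarrow> lap m u x = - ev l m * u x"
  shows "has_laplacian q u (\<lambda>x. - l * u x)"
  unfolding has_laplacian_iff
proof (intro conjI allI impI)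
  show "continuous_on (SG q) u" by (rule c)
  show "continuous_on (SG q) (\<lambda>x. - l * u x)" by (intro continuous_on_mult continuous_on_const c)
  obtain B where B: "B > 0" "\<And>x. x \<in> SG q \<Longrightarrow> \<bar>u x\<bar> \<le> B" using bounded_on_SG[OF c] by blast
  fix \<delta> :: real assume "\<delta> > 0"
  then have dB: "\<delta> / B > 0" using B by simp
  have "(\<lambda>m. 3/2 * (5 ^ m * ev l m) - l) \<longlonglongrightarrow> 3/2 * (2/3 * l) - l"
    by (intro tendsto_intros ev_tendsto)
  then have lim: "(\<lambda>m. 3/2 * (5 ^ m * ev l m) - l) \<longlonglongrightarrow> 0" by simp
  obtain N where N: "\<And>m. m \<ge> N \<Longrightarrow> norm (3/2 * (5 ^ m * ev l m) - l - 0) < \<delta> / B"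
    using LIMSEQ_D[OF lim dB] by blast
  show "\<exists>M. \<forall>m\<ge>M. \<forall>x. x \<in> V m \<longrightarrow> x \<notin> V 0 \<longrightarrow> \<bar>3/2 * 5 ^ m * lap m u x - - l * u x\<bar> < \<delta>"
  proof (intro exI[of _ N] allI impI)
    fix m x assume m: "m \<ge> N" and x: "x \<in> V m" "x \<notin> V 0"
    have "x \<in> SG q" using x vertices_subset_SG by blast
    have "3/2 * 5 ^ m * lap m u x - - l * u x = - (3/2 * (5 ^ m * ev l m) - l) * u x"
      unfolding e[OF x] by (simp add: algebra_simps)
    then have "\<bar>3/2 * 5 ^ m * lap m u x - - l * u x\<bar> = \<bar>3/2 * (5 ^ m * ev l m) - l\<bar> * \<bar>u x\<bar>"
      by (simp only: abs_mult abs_minus_cancel)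
    also have "\<dots> \<le> \<bar>3/2 * (5 ^ m * ev l m) - l\<bar> * B" using B(2)[OF \<open>x \<in> SG q\<close>] by (intro mult_left_mono) auto
    also have "\<dots> < \<delta> / B * B" using N[OF m] B(1) by (intro mult_strict_right_mono) auto
    finally show "\<bar>3/2 * 5 ^ m * lap m u x - - l * u x\<bar> < \<delta>" using B(1) by simp
  qed
qed

text \<open>The passage from the formal parameter to a number inside a common radius: the
  coefficient bound is uniform on the gasket, so the sums converge uniformly and the discrete
  equations survive.\<close>

lemma eval_family:
  assumes R: "0 \<le> l" "l < R"
    and cont: "\<And>j. continuous_on (SG q) (\<lambda>x. fps_nth (A x) j)"
    and bound: "\<And>x j. x \<in> SG q \<Longrightarrow> \<bar>fps_nth (A x) j\<bar> * R ^ j \<le> C"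
    and eq: "\<And>m x. x \<in> V m \<Longrightarrow> x \<notin> V 0 \<Longrightarrow> lap m A x = - lev m * A x"
  shows "uniform_limit (SG q) (\<lambda>n x. \<Sum>i<n. fps_nth (A x) i * l ^ i) (\<lambda>x. eval_fps (A x) l) sequentially"
    "continuous_on (SG q) (\<lambda>x. eval_fps (A x) l)"
    "\<And>m x. x \<in> V m \<Longrightarrow> x \<notin> V 0 \<Longrightarrow> lap m (\<lambda>x. eval_fps (A x) l) x = - ev l m * eval_fps (A x) l"
    "\<And>x. x \<in> SG q \<Longrightarrow> ereal l < fps_conv_radius (A x)"
proof -
  have Rp: "R > 0" using R by simp
  have rad: "ereal l < fps_conv_radius (A x)" if "x \<in> SG q" for x
  proof -
    have "ereal R \<le> fps_conv_radius (A x)"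
      using bound[OF that] by (intro fps_conv_radius_geI_bound[OF Rp]) simp
    then show ?thesis using R(2) by (meson less_ereal.simps(1) less_le_trans)
  qed
  then show "\<And>x. x \<in> SG q \<Longrightarrow> ereal l < fps_conv_radius (A x)" .
  have bd: "norm (fps_nth (A x) i * l ^ i) \<le> C * (l / R) ^ i" if "x \<in> SG q" for i x
  proof -
    have "norm (fps_nth (A x) i * l ^ i) = \<bar>fps_nth (A x) i\<bar> * R ^ i * (l / R) ^ i"
      using R Rp by (simp add: abs_mult power_divide)
    also have "\<dots> \<le> C * (l / R) ^ i" using R Rp by (intro mult_right_mono bound[OF that]) auto
    finally show ?thesis .
  qed
  have "summable (\<lambda>i. C * (l / R) ^ i)"
    using R Rp by (intro summable_mult summable_geometric) auto
  then show ul: "uniform_limit (SG q) (\<lambda>n x. \<Sum>i<n. fps_nth (A x) i * l ^ i) (\<lambda>x. eval_fps (A x) l) sequentially"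
    unfolding eval_fps_def by (intro Weierstrass_m_test[where M = "\<lambda>i. C * (l / R) ^ i"] bd)
  show "continuous_on (SG q) (\<lambda>x. eval_fps (A x) l)"
    by (rule uniform_limit_theorem[OF always_eventually ul])
      (auto intro!: continuous_on_sum continuous_on_mult cont continuous_on_const)
  fix m x assume x: "x \<in> V m" "x \<notin> V 0"
  have xS: "x \<in> SG q" using x vertices_subset_SG by blast
  have rl: "ereal (norm l) < fps_conv_radius (A y)" if "y \<in> SG q" for y using rad[OF that] R(1) by simp
  have "lap m (\<lambda>x. eval_fps (A x) l) x = eval_fps (lap m A x) l"
  proof -
    have "ereal (norm l) < fps_conv_radius (\<Sum>y\<in>S. A y - A x) \<and>
        eval_fps (\<Sum>y\<in>S. A y - A x) l = (\<Sum>y\<in>S. eval_fps (A y) l - eval_fps (A x) l)"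
      if "finite S" "S \<subseteq> SG q" for S
      using that
    proof (induction S rule: finite_induct)
      case (insert y S)
      have r: "ereal (norm l) < fps_conv_radius (A y - A x)"
        by (rule less_le_trans[OF _ fps_conv_radius_diff]) (use rl[OF xS] rl[of y] insert.prems in simp)
      have r2: "ereal (norm l) < fps_conv_radius (\<Sum>y\<in>S. A y - A x)" using insert by simp
      have "ereal (norm l) < fps_conv_radius ((A y - A x) + (\<Sum>y\<in>S. A y - A x))"
        by (rule less_le_trans[OF _ fps_conv_radius_add]) (use r r2 in simp)
      moreover have "eval_fps ((A y - A x) + (\<Sum>y\<in>S. A y - A x)) l
          = (eval_fps (A y) l - eval_fps (A x) l) + (\<Sum>y\<in>S. eval_fps (A y) l - eval_fps (A x) l)"
        using r r2 rl[OF xS] rl[of y] insert by (simp add: eval_fps_add eval_fps_diff)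
      ultimately show ?case using insert.hyps by simp
    qed (simp add: zero_ereal_def)
    from this[of "{y. sg_adj q m x y}"] adj_mem show ?thesis unfolding lap_def by (simp add: subset_eq)
  qed
  also have "\<dots> = eval_fps (- (lev m * A x)) l" unfolding eq[OF x] by simp
  also have "\<dots> = - (ev l m * eval_fps (A x) l)"
  proof -
    have r: "fps_conv_radius (lev m) = \<infinity>" using ent_lev[of m] by (simp add: ent_def)
    have "ereal (norm l) < fps_conv_radius (lev m * A x)"
      by (rule less_le_trans[OF _ fps_conv_radius_mult]) (use r rl[OF xS] in simp)
    then show ?thesis using r rl[OF xS] by (simp add: eval_fps_minus eval_fps_mult eval_lev)
  qed
  finally show "lap m (\<lambda>x. eval_fps (A x) l) x = - ev l m * eval_fps (A x) l" by simp
qed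

lemma sol_coeff_bound:
  assumes "R > 0" "\<exists>C. \<forall>K m. \<forall>x\<in>V m. nrm K R (sol 0 T x) \<le> C"
  shows "\<exists>C. \<forall>x\<in>SG q. \<forall>j. \<bar>fps_nth (sol 0 T x) j\<bar> * R ^ j \<le> C"
proof -
  obtain C where C: "\<And>K m x. x \<in> V m \<Longrightarrow> nrm K R (sol 0 T x) \<le> C" using assms(2) by blast
  have "\<bar>fps_nth (sol 0 T x) j\<bar> * R ^ j \<le> C" if "x \<in> SG q" for x j
  proof -
    have "\<bar>fps_nth (sol 0 T x) j\<bar> \<le> C / R ^ j"
    proof (rule abs_le_on_SG[OF continuous_on_sol _ that])
      fix m x assume "x \<in> V m"
      then have "\<bar>fps_nth (sol 0 T x) j\<bar> * R ^ j \<le> C"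
        using nrm_coeff[of R j j "sol 0 T x"] C[of x m j] assms(1) by linarith
      then show "\<bar>fps_nth (sol 0 T x) j\<bar> \<le> C / R ^ j" using assms(1) by (simp add: field_simps)
    qed
    then show ?thesis using assms(1) by (simp add: field_simps)
  qed
  then show ?thesis by blast
qed

lemma neumann_eigenfunctionI:
  assumes "has_laplacian q u (\<lambda>x. - l * u x)" "\<And>k. has_normal_deriv q u k 0" "x \<in> SG q" "u x \<noteq> 0"
  shows "neumann_eigenfunction q l u"
  unfolding neumann_eigenfunction_def
  using assms laplacian_eq[OF assms(1)] by (auto simp: dom_laplacian_def)

text \<open>At \<open>lam1\<close> the family of \<open>T1\<close> has the corner values 1, -1/2,
  -1/2, an eigenvector of the triangle for 6.\<close>

lemma lam1_in_spectrum: "lam1 \<in> neumann_spectrum q"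
proof -
  let ?A = "sol 0 (T1 0)" and ?u = "\<lambda>x. eval_fps (sol 0 (T1 0) x) lam1"
  have Rp: "lam1 + 1 > 0" using lam_order by simp
  obtain C where C: "\<And>x j. x \<in> SG q \<Longrightarrow> \<bar>fps_nth (?A x) j\<bar> * (lam1 + 1) ^ j \<le> C"
    using sol_coeff_bound[OF Rp sol_nrm_bound[OF less_imp_le[OF Rp] regular_T1]] by blast
  have eq: "lap m ?A x = - lev m * ?A x" if "x \<in> V m" "x \<notin> V 0" for m x
    using sol_lap[OF that, of 0] by simp
  have l: "0 \<le> lam1" "lam1 < lam1 + 1" using lam_order by simp_all
  have cu: "continuous_on (SG q) ?u"
    by (rule eval_family(2)[where A = ?A, OF l continuous_on_sol C eq])
  have eu: "lap m ?u x = - ev lam1 m * ?u x" if "x \<in> V m" "x \<notin> V 0" for m x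
    by (rule eval_family(3)[where A = ?A, OF l continuous_on_sol C eq], assumption+, (rule that)+)
  have d: "dlt m (ev lam1 m) ?u x = 0" if x: "x \<in> V m" "x \<notin> V 0" for m x
    unfolding dlt_def using eu[OF x] x(2) by simp
  have r: "fps_conv_radius (fps_const (1/4) * lev 0) = \<infinity>"
    using ent_mult[OF ent_const ent_lev, of "1/4" 0] by (simp add: ent_def)
  have v0: "?u (q 0) = 1" by (simp add: T1_def)
  have v1: "?u (q i) = - 1/2" if "i \<noteq> 0" for i
  proof -
    have "?u (q i) = eval_fps (1 - fps_const (1/4) * lev 0) lam1" using that by (simp add: T1_def)
    also have "\<dots> = 1 - 1/4 * ev lam1 0"
      using ent_lev[of 0] r by (simp add: eval_fps_diff eval_fps_mult eval_lev ent_def)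
    finally show ?thesis by (simp add: ev_lam1)
  qed
  have "dlt 0 (ev lam1 0) ?u (q k) = 0" for k
    using exhaust_3'[of k] unfolding dlt_0 ev_lam1
    by (elim disjE) (simp_all only: sum_neq_3 v0 v1[OF neq_3(3)] v1[OF neq_3(5)], simp_all)
  then have nd: "has_normal_deriv q ?u k 0" for k
  proof (rule dlt_ascend_corner[where l = lam1 and ?m0.0 = 0, rotated])
    fix m
    show "ev lam1 (Suc m) \<noteq> 2 \<and> ev lam1 (Suc m) \<noteq> 5"
      using ev_lam1(2) ev_lam1(3)[of "m - 1"] by (cases m) auto
  qed (rule d)
  have "neumann_eigenfunction q lam1 ?u"
    by (rule neumann_eigenfunctionI[OF eigen_has_laplacian[OF cu eu] nd vertex_in_SG[of 0]]) (simp_all add: T1_def)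
  then show ?thesis unfolding neumann_spectrum_def by blast
qed

lemma vertices_zero_from:
  fixes y :: "nat \<Rightarrow> real"
  assumes "\<And>m. m \<ge> m0 \<Longrightarrow> y (Suc m) \<noteq> 2" "\<And>m. m \<ge> m0 \<Longrightarrow> y (Suc m) \<noteq> 5"
    "\<And>m x. m \<ge> m0 \<Longrightarrow> x \<in> V (Suc m) \<Longrightarrow> x \<notin> V m \<Longrightarrow> dlt (Suc m) (y (Suc m)) u x = 0"
    "\<And>x. x \<in> V m0 \<Longrightarrow> u x = 0" "x \<in> V m"
  shows "u x = 0"
  using assms
proof (induction m0 arbitrary: y u x m)
  case 0
  show ?case
  proof (rule vertices_zero[of y u x m])
    show "u (q i) = 0" for i using 0(4)[of "q i"] by simp
  qed (use 0 in blast)+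
next
  case (Suc m0)
  have "x \<in> V (Suc m)" using Suc.prems(5) vertices_mono_Suc by blast
  then obtain k z where z: "x = F k z" "z \<in> V m" by auto
  have "(u \<circ> F k) z = 0"
  proof (rule Suc.IH[of "\<lambda>m. y (Suc m)" "u \<circ> F k" z m])
    show "y (Suc (Suc n)) \<noteq> 2" "y (Suc (Suc n)) \<noteq> 5" if "n \<ge> m0" for n
      using Suc.prems(1,2)[of "Suc n"] that by simp_all
    show "(u \<circ> F k) x = 0" if "x \<in> V m0" for x
      using Suc.prems(4)[OF F_mem_vertices_Suc[OF that]] by simp
    show "z \<in> V m" by (rule z)
    fix n x assume n: "n \<ge> m0" and x: "x \<in> V (Suc n)" "x \<notin> V n"
    have "dlt (Suc (Suc n)) (y (Suc (Suc n))) u (F k x) = 0"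
      by (rule Suc.prems(3)[OF _ new_vertex_F(2,3)[OF x]]) (use n in simp)
    then show "dlt (Suc n) (y (Suc (Suc n))) (u \<circ> F k) x = 0"
      unfolding dlt_Suc_interior[OF x(1) new_vertex_F(1)[OF x]] .
  qed
  then show ?case by (simp add: z)
qed

text \<open>For y = 2 the junction equations are dependent: the corner sum has to vanish, and one
  parameter stays free, the sum s of the junction values.\<close>

lemma cell_2:
  fixes v :: "real^2 \<Rightarrow> real"
  assumes "\<And>a b. a \<noteq> b \<Longrightarrow> dlt (Suc 0) 2 v (F a (q b)) = 0"
  shows "v (q 0) + v (q 1) + v (q 2) = 0"
    "\<exists>s. (\<forall>k. dlt (Suc 0) 2 v (q k) = 4/3 * (s - v (q k))) \<and>
      ((\<forall>k. v (q k) = 0) \<and> s = 0 \<longrightarrow> (\<forall>a b. v (F a (q b)) = 0))"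
proof -
  define m01 m02 m12 where "m01 = v (F 0 (q 1))" and "m02 = v (F 0 (q 2))" and "m12 = v (F 1 (q 2))"
  have e: "2 * m01 = v (q 0) + v (q 1) + m02 + m12" "2 * m02 = v (q 0) + v (q 2) + m01 + m12"
    "2 * m12 = v (q 1) + v (q 2) + m01 + m02"
    using assms[of 0 1] assms[of 0 2] assms[of 1 2]
    by (simp_all add: dlt_1_junction sum_neq_3 F_commute m01_def m02_def m12_def)
  show z: "v (q 0) + v (q 1) + v (q 2) = 0" using e by linarith
  let ?s = "m01 + m02 + m12"
  have "dlt (Suc 0) 2 v (q k) = 4/3 * (?s - v (q k))" for k
    using exhaust_3'[of k] e z
    by (elim disjE) (simp_all add: dlt_1_corner sum_neq_3 F_commute flip: m01_def m02_def m12_def)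
  moreover have "v (F a (q b)) = 0" if "\<forall>k. v (q k) = 0" "?s = 0" for a b
  proof -
    have "m01 = 0" "m02 = 0" "m12 = 0" using e that by (simp_all)
    then show ?thesis
      using exhaust_3'[of a] exhaust_3'[of b] that(1)
      by (elim disjE) (simp_all add: m01_def m02_def m12_def F_commute)
  qed
  ultimately show "\<exists>s. (\<forall>k. dlt (Suc 0) 2 v (q k) = 4/3 * (s - v (q k))) \<and>
      ((\<forall>k. v (q k) = 0) \<and> s = 0 \<longrightarrow> (\<forall>a b. v (F a (q b)) = 0))"
    by blast
qed

lemma level1_eq_2:
  fixes u :: "real^2 \<Rightarrow> real"
  assumes "\<And>x. x \<in> V (Suc 0) \<Longrightarrow> dlt (Suc 0) 2 u x = 0" "x \<in> V (Suc 0)"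
  shows "u x = 0"
proof -
  have n: "dlt (Suc 0) 2 u (F a (q b)) = 0" for a b
    by (rule assms(1)[OF F_mem_vertices_Suc[OF vertex_mem]])
  obtain s where s: "\<And>k. dlt (Suc 0) 2 u (q k) = 4/3 * (s - u (q k))"
      "(\<forall>k. u (q k) = 0) \<and> s = 0 \<longrightarrow> (\<forall>a b. u (F a (q b)) = 0)"
    using cell_2(2)[of u, OF n] by blast
  have "u (q k) = s" for k using s(1)[of k] assms(1)[OF vertex_mem, of k] by simp
  then have "(\<forall>k. u (q k) = 0) \<and> s = 0" using cell_2(1)[of u, OF n] by simp
  then have z: "u (F a (q b)) = 0" for a b using s(2) by blast
  obtain a b where "x = F a (q b)" using assms(2) by auto
  then show ?thesis using z by simp
qed

lemma level1_eq_5: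
  fixes u :: "real^2 \<Rightarrow> real"
  assumes "\<And>x. x \<in> V (Suc 0) \<Longrightarrow> dlt (Suc 0) 5 u x = 0" "x \<in> V (Suc 0)"
  shows "u x = 0"
proof -
  have n: "dlt (Suc 0) 5 u (F a (q b)) = 0" for a b
    by (rule assms(1)[OF F_mem_vertices_Suc[OF vertex_mem]])
  have c: "dlt (Suc 0) 5 u (q k) = 0" for k by (rule assms(1)[OF vertex_mem])
  define m01 m02 m12 where "m01 = u (F 0 (q 1))" and "m02 = u (F 0 (q 2))" and "m12 = u (F 1 (q 2))"
  have e: "- m01 = u (q 0) + u (q 1) + m02 + m12" "- m02 = u (q 0) + u (q 2) + m01 + m12"
    "- m12 = u (q 1) + u (q 2) + m01 + m02"
    using n[of 0 1] n[of 0 2] n[of 1 2]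
    by (simp_all add: dlt_1_junction sum_neq_3 F_commute m01_def m02_def m12_def)
  have f: "u (q 0) + 2 * (m01 + m02) = 0" "u (q 1) + 2 * (m01 + m12) = 0" "u (q 2) + 2 * (m02 + m12) = 0"
    using c[of 0] c[of 1] c[of 2]
    by (simp_all add: dlt_1_corner sum_neq_3 F_commute m01_def m02_def m12_def)
  have "m01 = 0" "m02 = 0" "m12 = 0" "u (q 0) = 0" "u (q 1) = 0" "u (q 2) = 0" using e f[unfolded distrib_left] by linarith+
  moreover obtain a b where "x = F a (q b)" using assms(2) by auto
  ultimately show ?thesis
    using exhaust_3'[of a] exhaust_3'[of b]
    by (elim disjE) (simp_all add: m01_def m02_def m12_def F_commute)
qed

text \<open>By \<open>cell_2\<close> the equations become s k = u (q k) and s k + s j = 2 u (F k (q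
  j)). Together with the vanishing corner sums of the three cells they have only the zero
  solution.\<close>

lemma level2_eq_2:
  fixes u :: "real^2 \<Rightarrow> real"
  assumes d: "\<And>x. x \<in> V (Suc (Suc 0)) \<Longrightarrow> dlt (Suc (Suc 0)) 2 u x = 0" and x: "x \<in> V (Suc (Suc 0))"
  shows "u x = 0"
proof -
  have n: "dlt (Suc 0) 2 (u \<circ> F k) (F a (q b)) = 0" if "a \<noteq> b" for k a b
  proof -
    have m: "F a (q b) \<in> V (Suc 0)" by (rule F_mem_vertices_Suc[OF vertex_mem])
    show ?thesis
      using d[OF F_mem_vertices_Suc[OF m, of k]] unfolding dlt_Suc_interior[OF m new_junction(2)[OF that]] .
  qed
  obtain s where s: "\<And>k j. dlt (Suc 0) 2 (u \<circ> F k) (q j) = 4/3 * (s k - u (F k (q j)))"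
      "\<And>k. (\<forall>j. u (F k (q j)) = 0) \<and> s k = 0 \<Longrightarrow> (\<forall>a b. u (F k (F a (q b))) = 0)"
    using cell_2(2)[of "u \<circ> F _", OF n] unfolding comp_apply by metis
  have z: "u (F k (q 0)) + u (F k (q 1)) + u (F k (q 2)) = 0" for k
    using cell_2(1)[of "u \<circ> F k", OF n] by simp
  have c: "s k = u (q k)" for k
    using d[OF vertex_mem, of k] unfolding dlt_Suc_corner[of "Suc 0"] s(1) by simp
  have j: "s k + s j = 2 * u (F k (q j))" if "k \<noteq> j" for k j
  proof -
    have "dlt (Suc (Suc 0)) 2 u (F k (q j)) = 0" by (rule d[OF F_mem_vertices_Suc[OF vertex_mem]])
    then have "(s k - u (F k (q j))) + (s j - u (F j (q k))) = 0"
      unfolding dlt_Suc_junction[OF that] s(1) by (simp add: field_simps)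
    then show ?thesis by (simp add: F_vertex_commute[of j k])
  qed
  have e: "u (q 0) + u (F 0 (q 1)) + u (F 0 (q 2)) = 0" "u (F 0 (q 1)) + u (q 1) + u (F 1 (q 2)) = 0"
    "u (F 0 (q 2)) + u (F 1 (q 2)) + u (q 2) = 0"
    using z[of 0] z[of 1] z[of 2] by (simp_all add: F_commute)
  have f: "u (q 0) + u (q 1) = 2 * u (F 0 (q 1))" "u (q 0) + u (q 2) = 2 * u (F 0 (q 2))"
    "u (q 1) + u (q 2) = 2 * u (F 1 (q 2))"
    using j[of 0 1] j[of 0 2] j[of 1 2] unfolding c by simp_all
  have "u (q 0) = 0" "u (q 1) = 0" "u (q 2) = 0" "u (F 0 (q 1)) = 0" "u (F 0 (q 2)) = 0" "u (F 1 (q 2)) = 0"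
    using e f by linarith+
  then have v: "u (F k (q j)) = 0" for k j
    using exhaust_3'[of k] exhaust_3'[of j] by (elim disjE) (simp_all add: F_commute)
  have "s k = 0" for k using c[of k] v[of k k] by simp
  then have "u (F k (F a (q b))) = 0" for k a b using s(2)[of k] v by blast
  moreover obtain k a b where "x = F k (F a (q b))" using x by auto
  ultimately show ?thesis by simp
qed

text \<open>Below \<open>lam2\<close> the discrete eigenvalues are less than 7/10 from level 3 on
  and less than 3 on level 2. Exceptional values could occur only on levels 1 and 2, where no
  Neumann eigenvector has them. So the equations descend to the triangle, with eigenvalues 0 and
  6.\<close>

lemma spectrum_below_lam2:
  assumes "l \<in> neumann_spectrum q" "l < lam2"
  shows "l = 0 \<or> l = lam1"
proof -
  obtain u where u: "\<exists>x\<in>SG q. u x \<noteq> 0" "u \<in> dom_laplacian q"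
      "\<And>x. x \<in> SG q \<Longrightarrow> - laplacian q u x = l * u x" "\<And>k. has_normal_deriv q u k 0"
    using assms(1) unfolding neumann_spectrum_def neumann_eigenfunction_def by blast
  have hl: "has_laplacian q u (\<lambda>x. - l * u x)"
  proof (rule has_laplacian_cong[OF has_laplacian_laplacian[OF u(2)] refl])
    fix x assume "x \<in> SG q"
    then show "laplacian q u x = - l * u x" using u(3)[of x] by simp
  qed
  have small: "ev l m < 7/10" if "m \<ge> 3" for m using ev_small[OF _ that] assms(2) by simp
  have int: "dlt m (ev l m) u x = 0" if "m \<ge> 2" "x \<in> V m" "x \<notin> V 0" for m x
  proof (rule eigen_dlt_interior[OF hl _ that])
    fix m :: nat assume "m \<ge> 2"
    then show "ev l (Suc m) < 2" using small[of "Suc m"] by simp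
  qed
  have new: "dlt (Suc m) (ev l (Suc m)) u x = 0" if "m \<ge> 1" "x \<in> V (Suc m)" "x \<notin> V m" for m x
    using int[of "Suc m" x] that vertices_mono[of 0 m] by auto
  obtain M where M: "\<And>m. m \<ge> M \<Longrightarrow> norm (ev l m - 0) < 1/2"
    using LIMSEQ_D[OF ev_tendsto_0[of l], of "1/2"] by auto
  \<comment> \<open>The corner estimate wants values of modulus at most 1/2, hence a possibly deeper
    level; \<open>corner\<close> then returns to level 2.\<close>
  define m0 where "m0 = max M 2"
  have corner0: "dlt m0 (ev l m0) u (q k) = 0" for k
  proof (rule eigen_dlt_corner[where m = m0 and ?m0.0 = m0, OF u(4)])
    fix m x assume "m \<ge> m0" "x \<in> V m" "x \<notin> V 0"
    then show "dlt m (ev l m) u x = 0" using int[of m x] by (simp add: m0_def)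
  next
    fix m assume "m \<ge> m0"
    then show "\<bar>ev l (Suc m)\<bar> \<le> 1/2" using M[of "Suc m"] by (simp add: m0_def)
  qed simp
  have corner: "dlt 2 (ev l 2) u (q k) = 0" for k
  proof -
    have "2 \<le> m0" by (simp add: m0_def)
    then show ?thesis
    proof (induction rule: inc_induct)
      case (step n)
      have n: "\<And>x. x \<in> V (Suc n) \<Longrightarrow> x \<notin> V n \<Longrightarrow> dlt (Suc n) (ev l (Suc n)) u x = 0"
        using new[of n] step.hyps(1) by simp
      have "(6 - ev l (Suc n)) * dlt n (ev l n) u (q k) = 0"
        using dlt_descend_exact[OF n vertex_mem, of k] step.IH unfolding ev_Suc[of l n] by simp
      moreover have "ev l (Suc n) < 7/10" using small[of "Suc n"] step.hyps(1) by simp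
      ultimately show ?case by simp
    qed (rule corner0)
  qed
  have d2: "dlt (Suc (Suc 0)) (ev l 2) u x = 0" if "x \<in> V (Suc (Suc 0))" for x
  proof (cases "x \<in> V 0")
    case True
    then obtain k where "x = q k" by auto
    then show ?thesis using corner[of k] by (simp add: numeral_2_eq_2)
  next
    case False
    then show ?thesis using int[of "Suc (Suc 0)" x] that by (simp add: numeral_2_eq_2)
  qed
  have nonzero: "\<exists>x\<in>V m0. u x \<noteq> 0"
    if reg: "\<And>m. m \<ge> m0 \<Longrightarrow> ev l (Suc m) \<noteq> 2 \<and> ev l (Suc m) \<noteq> 5"
      and n: "\<And>m x. m \<ge> m0 \<Longrightarrow> x \<in> V (Suc m) \<Longrightarrow> x \<notin> V m \<Longrightarrow> dlt (Suc m) (ev l (Suc m)) u x = 0" for m0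
  proof (rule ccontr)
    assume "\<not> (\<exists>x\<in>V m0. u x \<noteq> 0)"
    then have z: "\<And>x. x \<in> V m0 \<Longrightarrow> u x = 0" by blast
    have "u x = 0" if "x \<in> V m" for m x
    proof (rule vertices_zero_from[where y = "ev l" and ?m0.0 = m0 and u = u and x = x and m = m])
      show "x \<in> V m" by (rule that)
    next
      fix m assume "m \<ge> m0"
      then show "ev l (Suc m) \<noteq> 2" "ev l (Suc m) \<noteq> 5" using reg by blast+
    next
      fix y assume "y \<in> V m0"
      then show "u y = 0" by (rule z)
    next
      fix m y assume "m \<ge> m0" "y \<in> V (Suc m)" "y \<notin> V m"
      then show "dlt (Suc m) (ev l (Suc m)) u y = 0" by (rule n)
    qed
    then have "u x = 0" if "x \<in> SG q" for x
      using dense_vertices[of u "\<lambda>x. 0", OF _ _ _ that] hl unfolding has_laplacian_iff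
      by (simp add: continuous_on_const)
    then show False using u(1) by blast
  qed
  define y where "y = ev l 2"
  have y3: "y < 3"
  proof -
    have "2 / 3 * l / 5 ^ 2 < psi3" using assms(2) by (simp add: lam2_def)
    then show ?thesis unfolding y_def ev_def by (rule psi3(3))
  qed
  have ge2: "ev l (Suc m) \<noteq> 2 \<and> ev l (Suc m) \<noteq> 5" if "m \<ge> 2" for m
    using small[of "Suc m"] that by simp
  have y2: "y \<noteq> 2"
  proof
    assume "y = 2"
    have "\<exists>x\<in>V (Suc (Suc 0)). u x \<noteq> 0"
      by (rule nonzero) (use ge2 new in \<open>simp_all add: numeral_2_eq_2\<close>)
    then show False using level2_eq_2[of u] d2 unfolding y_def[symmetric] \<open>y = 2\<close> by blast
  qed
  have ge1: "ev l (Suc m) \<noteq> 2 \<and> ev l (Suc m) \<noteq> 5" if "m \<ge> Suc 0" for m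
  proof (cases "m = 1")
    case True
    then show ?thesis using y2 y3 by (simp add: y_def numeral_2_eq_2)
  next
    case False
    then show ?thesis using ge2[of m] that by simp
  qed
  have nz1: "\<exists>x\<in>V (Suc 0). u x \<noteq> 0"
    by (rule nonzero[OF ge1]) (use new in simp_all)
  define y1 where "y1 = ev l (Suc 0)"
  have y1: "y1 = y * (5 - y)" using ev_Suc[of l "Suc 0"] by (simp add: y1_def y_def numeral_2_eq_2)
  have d1: "dlt (Suc 0) y1 u x = 0" if "x \<in> V (Suc 0)" for x
  proof -
    have "(6 - y) * dlt (Suc 0) y1 u x = (2 - y) * (5 - y) * dlt (Suc (Suc 0)) y u x"
      unfolding y1 by (rule dlt_descend_exact[OF _ that]) (use d2 in \<open>simp add: y_def del: sg_vertices.simps\<close>)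
    moreover have "dlt (Suc (Suc 0)) y u x = 0"
      unfolding y_def by (rule d2[OF subsetD[OF vertices_mono_Suc that]])
    ultimately show ?thesis using y3 by simp
  qed
  have y1_25: "y1 \<noteq> 2" "y1 \<noteq> 5"
    using level1_eq_2[of u] level1_eq_5[of u] d1 nz1 by blast+
  have y1_6: "y1 \<noteq> 6"
  proof
    assume "y1 = 6"
    then have "(y - 2) * (y - 3) = 0" unfolding y1 by (simp add: algebra_simps)
    then show False using y2 y3 by simp
  qed
  have nz0: "\<exists>x\<in>V 0. u x \<noteq> 0"
  proof (rule nonzero)
    fix m :: nat
    show "ev l (Suc m) \<noteq> 2 \<and> ev l (Suc m) \<noteq> 5"
      using ge1[of m] y1_25 by (cases m) (auto simp: y1_def)
    fix x assume "x \<in> V (Suc m)" "x \<notin> V m"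
    then show "dlt (Suc m) (ev l (Suc m)) u x = 0"
      using new[of m x] d1[of x] by (cases m) (auto simp: y1_def)
  qed
  define z where "z = y1 * (5 - y1)"
  have d0: "dlt 0 z u (q k) = 0" for k
  proof -
    have "(6 - y1) * dlt 0 z u (q k) = (2 - y1) * (5 - y1) * dlt (Suc 0) y1 u (q k)"
      unfolding z_def by (rule dlt_descend_exact[OF _ vertex_mem]) (rule d1)
    moreover have "dlt (Suc 0) y1 u (q k) = 0" by (rule d1[OF vertex_mem])
    ultimately show ?thesis using y1_6 by simp
  qed
  let ?S = "u (q 0) + u (q 1) + u (q 2)"
  have e: "2 * ?S + (z - 6) * u (q k) = 0" for k
    using d0[of k] exhaust_3'[of k] unfolding dlt_0
    by (elim disjE) (simp_all add: sum_neq_3 algebra_simps)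
  have "z * ?S = (2 * ?S + (z - 6) * u (q 0)) + (2 * ?S + (z - 6) * u (q 1)) + (2 * ?S + (z - 6) * u (q 2))"
    by (simp add: algebra_simps)
  then have "z = 0 \<or> ?S = 0" unfolding e by simp
  moreover have "z = 6" if "?S = 0"
  proof -
    obtain k where "u (q k) \<noteq> 0" using nz0 by auto
    then show ?thesis using e[of k] that by simp
  qed
  ultimately have z06: "z = 0 \<or> z = 6" by blast
  have xle: "2 / 3 * l / 5 ^ 2 \<le> psi3" using assms(2) by (simp add: lam2_def)
  from z06 show ?thesis
  proof
    assume "z = 0"
    then have "y1 = 0" using y1_25 by (simp add: z_def)
    then have "y = 0" using y1 y3 by auto
    then have "Psi (2 / 3 * l / 5 ^ 2) = Psi 0" by (simp add: y_def ev_def)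
    then have "2 / 3 * l / 5 ^ 2 = 0" using Psi_inj[OF xle, of 0] psi3(1) by simp
    then show ?thesis by simp
  next
    assume "z = 6"
    then have "(y1 - 2) * (y1 - 3) = 0" unfolding z_def by (simp add: algebra_simps)
    then have "y1 = 3" using y1_25 by simp
    \<comment> \<open>As y (5 - y) = 3 and y < 3, y is the smaller root, which is the value of
      \<open>Psi\<close> at psi3 / 5; the larger root exceeds 4.\<close>
    let ?w = "Psi (psi3 / 5)"
    have w: "?w * (5 - ?w) = 3" using Psi_div[of psi3] psi3(2) by simp
    have "?w < 7/10" by (rule Psi_small) simp
    moreover have "(y - ?w) * (5 - y - ?w) = 0"
      using w y1 \<open>y1 = 3\<close> by (simp add: algebra_simps)
    ultimately have "y = ?w" using y3 by auto
    then have "2 / 3 * l / 5 ^ 2 = psi3 / 5"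
      using Psi_inj[OF xle, of "psi3 / 5"] psi3(1) by (simp add: y_def ev_def)
    then show ?thesis by (simp add: lam1_def)
  qed
qed

lemma lambda2_eq:
  assumes "lam2 \<in> neumann_spectrum q"
  shows "lambda2 q = lam2"
proof -
  have 0: "nonzero_neumann_eigenvalue q 0 = lam1"
    unfolding nonzero_neumann_eigenvalue.simps
  proof (rule Least_equality)
    show "lam1 \<in> neumann_spectrum q - {0}" using lam1_in_spectrum lam_order by simp
    fix l assume "l \<in> neumann_spectrum q - {0}"
    then show "lam1 \<le> l" using spectrum_below_lam2[of l] lam_order by force
  qed
  show ?thesis
    unfolding lambda2_def One_nat_def nonzero_neumann_eigenvalue.simps(2) 0
  proof (rule Least_equality)
    show "lam2 \<in> neumann_spectrum q - {0} \<and> lam1 < lam2" using assms lam_order by simp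
    fix l assume "l \<in> neumann_spectrum q - {0} \<and> lam1 < l"
    then show "lam2 \<le> l" using spectrum_below_lam2[of l] by force
  qed
qed

end

section \<open>The limit eigenfunction\<close>

lemma vG_radius: "\<exists>R>lam2. ereal R < fps_conv_radius vG"
proof -
  obtain r where r: "r > psi3" "ereal r \<le> fps_conv_radius prd_inv"
    using prd_inv_properties(1) by blast
  let ?R = "(lam2 + 75 / 2 * r) / 2"
  have R: "lam2 < ?R" "?R < r / (2 / 75)" using r(1) by (simp_all add: lam2_def)
  have "ereal (r / (2 / 75)) \<le> fps_conv_radius (fps_scale (2 / 75) prd_inv)"
    by (rule fps_conv_radius_scale_ge[OF _ r(2)]) simp
  then have "ereal ?R < fps_conv_radius (fps_scale (2 / 75) prd_inv)"
    using R(2) by (meson less_ereal.simps(1) less_le_trans)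
  then have "ereal ?R < fps_conv_radius vG"
    unfolding vG_def by (intro less_le_trans[OF _ fps_conv_radius_mult]) simp
  then show ?thesis using R(1) by blast
qed

lemma eval_vG: "eval_fps vG lam2 \<noteq> 0"
proof -
  obtain r where r: "r > psi3" "ereal r \<le> fps_conv_radius prd_inv"
    using prd_inv_properties(1) by blast
  have "ereal (r / (2 / 75)) \<le> fps_conv_radius (fps_scale (2 / 75) prd_inv)"
    by (rule fps_conv_radius_scale_ge[OF _ r(2)]) simp
  moreover have "norm lam2 < r / (2 / 75)" using r(1) psi3(1) by (simp add: lam2_def)
  ultimately have "ereal (norm lam2) < fps_conv_radius (fps_scale (2 / 75) prd_inv)"
    by (meson less_ereal.simps(1) less_le_trans)
  then have "eval_fps vG lam2 = 3 / (8 * psi3) * eval_fps prd_inv (2 / 75 * lam2)"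
    unfolding vG_def by (simp add: eval_fps_mult eval_fps_scale)
  also have "2 / 75 * lam2 = psi3" by (simp add: lam2_def)
  finally show ?thesis using prd_inv_properties(2) psi3(1) by simp
qed

context gasket
begin

lemma TG_TH: "W 0 * (fps_X * sol 0 (TG 0) x) = fps_const (-3/8) * sol 0 (TH 0) x" if "x \<in> V m"
proof -
  have "(\<lambda>i. (W 0 * fps_X) * TG 0 i) = (\<lambda>i. fps_const (-3/8) * TH 0 i)"
    by (rule ext) (use bG_eq in \<open>simp add: TG_def TH_def cG_0 mult_ac\<close>)
  then have "(W 0 * fps_X) * sol 0 (TG 0) x = fps_const (-3/8) * sol 0 (TH 0) x"
    using sol_cmult[OF that, of 0 "W 0 * fps_X" "TG 0"] sol_cmult[OF that, of 0 "fps_const (-3/8)" "TH 0"] by simp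
  then show ?thesis by (simp only: mult.assoc)
qed

text \<open>
  \<open>solA\<close> is the family of the \<open>P_{j2}\<close> with its pole at \<open>lam2\<close> removed; the partial sums of its
  value at \<open>lam2\<close> are the \<open>(-lam2)^j P_{j2}\<close>.
\<close>

definition solA :: "real^2 \<Rightarrow> real fps" where
  "solA x = (1 - fps_const (1 / lam2) * fps_X) * sol 0 (TG 0) x"

definition phi :: "real^2 \<Rightarrow> real" where
  "phi x = eval_fps (solA x) lam2"

lemma X_solA: "x \<in> V m \<Longrightarrow> fps_X * solA x = vG * sol 0 (TH 0) x"
  using vG_W[OF TG_TH[symmetric]] by (simp only: solA_def mult_ac)

lemma solA_nth:
  "fps_nth (solA x) 0 = fps_nth (sol 0 (TG 0) x) 0"
  "fps_nth (solA x) (Suc n) = fps_nth (sol 0 (TG 0) x) (Suc n) - fps_nth (sol 0 (TG 0) x) n / lam2"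
  by (simp_all add: solA_def left_diff_distrib mult.assoc)

text \<open>Multiplication by 1 - \<lambda> / lam2 makes the sum telescope.\<close>

lemma sum_solA: "(\<Sum>i<Suc n. fps_nth (solA x) i * lam2 ^ i) = (- lam2) ^ n * coef (TG 0) n x"
proof -
  have "(\<Sum>i<Suc n. fps_nth (solA x) i * lam2 ^ i) = lam2 ^ n * fps_nth (sol 0 (TG 0) x) n"
  proof (induction n)
    case (Suc n)
    then show ?case using lam2_pos by (simp add: solA_nth field_simps)
  qed (simp add: solA_nth)
  then show ?thesis by (simp add: coef_def flip: mult.assoc power_mult_distrib)
qed

lemma continuous_on_solA: "continuous_on (SG q) (\<lambda>x. fps_nth (solA x) n)"
  by (cases n) (auto simp: solA_nth divide_inverse
      intro!: continuous_on_diff continuous_on_mult continuous_on_const continuous_on_sol)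

text \<open>By \<open>X_solA\<close>, up to a shift by one power, \<open>solA\<close> is
  \<open>vG\<close> times a family bounded in every radius. So any radius between
  \<open>lam2\<close> and that of \<open>vG\<close> will do, and the bound extends from the vertices
  by continuity.\<close>

lemma solA_bound: "\<exists>R>lam2. \<exists>C. \<forall>x\<in>SG q. \<forall>n. \<bar>fps_nth (solA x) n\<bar> * R ^ n \<le> C"
proof -
  obtain R where R: "R > lam2" "ereal R < fps_conv_radius vG" using vG_radius by blast
  have R0: "R > 0" using R(1) lam2_pos by simp
  obtain C1 where C1: "\<And>K. nrm K R vG \<le> C1" using nrm_bounded[OF R(2)] R0 by auto
  obtain C2 where C2: "\<And>K m x. x \<in> V m \<Longrightarrow> nrm K R (sol 0 (TH 0) x) \<le> C2"
    using sol_nrm_cells[OF sol_nrm_bound[OF less_imp_le[OF R0] regular_TH], of 0] by blast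
  have "\<bar>fps_nth (solA x) n\<bar> * R ^ n \<le> C1 * C2 / R" if "x \<in> SG q" for x n
  proof -
    have "\<bar>fps_nth (solA x) n\<bar> \<le> C1 * C2 / R / R ^ n"
    proof (rule abs_le_on_SG[OF continuous_on_solA _ that])
      fix m x assume x: "x \<in> V m"
      have "\<bar>fps_nth (solA x) n\<bar> * R ^ Suc n = \<bar>fps_nth (vG * sol 0 (TH 0) x) (Suc n)\<bar> * R ^ Suc n"
        unfolding X_solA[OF x, symmetric] by simp
      also have "\<dots> \<le> nrm (Suc n) R (vG * sol 0 (TH 0) x)" using R0 by (intro nrm_coeff) auto
      also have "\<dots> \<le> nrm (Suc n) R vG * nrm (Suc n) R (sol 0 (TH 0) x)" using R0 by (intro nrm_mult) auto
      also have "\<dots> \<le> C1 * C2"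
        using R0 nrm_nonneg[of R "Suc n"] order.trans[OF nrm_nonneg[OF less_imp_le[OF R0], of "Suc n" vG] C1]
        by (intro mult_mono C1 C2[OF x]) auto
      finally show "\<bar>fps_nth (solA x) n\<bar> \<le> C1 * C2 / R / R ^ n" using R0 by (simp add: field_simps)
    qed
    then show ?thesis using R0 by (simp add: field_simps)
  qed
  then show ?thesis using R(1) by blast
qed

lemma solA_lap: "lap m solA x = - lev m * solA x" if "x \<in> V m" "x \<notin> V 0"
proof -
  have "lap m solA x = (1 - fps_const (1 / lam2) * fps_X) * lap m (sol 0 (TG 0)) x"
    by (simp only: lap_def solA_def right_diff_distrib[symmetric] sum_distrib_left)
  then show ?thesis unfolding sol_lap[OF that] by (simp add: solA_def mult_ac)
qed

lemma phi_family:
  "continuous_on (SG q) phi"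
  "x \<in> V m \<Longrightarrow> x \<notin> V 0 \<Longrightarrow> lap m phi x = - ev lam2 m * phi x"
  "y \<in> SG q \<Longrightarrow> ereal lam2 < fps_conv_radius (solA y)"
proof -
  obtain R C where R: "R > lam2" and C: "\<And>x n. x \<in> SG q \<Longrightarrow> \<bar>fps_nth (solA x) n\<bar> * R ^ n \<le> C"
    using solA_bound by blast
  note ef = eval_family[where A = solA, OF less_imp_le[OF lam2_pos] R continuous_on_solA C solA_lap, folded phi_def]
  show "continuous_on (SG q) phi" by (rule ef(2))
  show "x \<in> V m \<Longrightarrow> x \<notin> V 0 \<Longrightarrow> lap m phi x = - ev lam2 m * phi x" by (rule ef(3))
  show "y \<in> SG q \<Longrightarrow> ereal lam2 < fps_conv_radius (solA y)" by (rule ef(4))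
qed

lemma phi_H:
  assumes x: "x \<in> V m" and H: "ent (sol 0 (TH 0) x)"
  shows "lam2 * phi x = eval_fps vG lam2 * eval_fps (sol 0 (TH 0) x) lam2"
proof -
  have xS: "x \<in> SG q" using x vertices_subset_SG by blast
  obtain R where R: "R > lam2" "ereal R < fps_conv_radius vG" using vG_radius by blast
  have l: "ereal (norm lam2) < fps_conv_radius vG"
  proof -
    have "ereal (norm lam2) < ereal R" using R lam2_pos by simp
    then show ?thesis using R(2) by (rule less_trans)
  qed
  have "lam2 * phi x = eval_fps (fps_X * solA x) lam2"
    using phi_family(3)[OF xS] lam2_pos by (simp add: eval_fps_mult phi_def)
  also have "\<dots> = eval_fps vG lam2 * eval_fps (sol 0 (TH 0) x) lam2"
    unfolding X_solA[OF x] using l H by (simp add: eval_fps_mult ent_def)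
  finally show ?thesis .
qed

text \<open>At the two junctions next to \<open>q 0\<close> the family of \<open>TH\<close> has the
  factor 6 - \<open>lev (Suc 0)\<close>, which is zero at \<open>lam2\<close>.\<close>

lemma phi_zero: "phi (F 0 (q i)) = 0"
proof -
  have "sol 0 (TH 0) (F 0 (q i)) = sub 0 (TH 0) 0 i" by (simp add: sol_F)
  also have "\<dots> = (if i = 0 then 0 else lev (Suc 0) * (6 - lev (Suc 0)))"
    using sub_TH[of i 0] by (simp add: TH_def)
  finally have H: "sol 0 (TH 0) (F 0 (q i)) = (if i = 0 then 0 else lev (Suc 0) * (6 - lev (Suc 0)))" .
  have e: "ent (sol 0 (TH 0) (F 0 (q i)))" unfolding H by (simp add: ent_intros)
  have "ent (6 - lev (Suc 0))" by (intro ent_intros)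
  then have "eval_fps (lev (Suc 0) * (6 - lev (Suc 0))) lam2 = 0"
    using ent_lev[of "Suc 0"] by (simp add: eval_fps_mult eval_fps_diff eval_lev ev_lam2 ent_def)
  then have "eval_fps (sol 0 (TH 0) (F 0 (q i))) lam2 = 0" unfolding H by simp
  then show ?thesis using phi_H[OF F_mem_vertices_Suc[OF vertex_mem] e] lam2_pos by simp
qed

lemma phi_nonzero: "phi (q 1) \<noteq> 0"
proof -
  have H: "sol 0 (TH 0) (q 1) = bH 0" by (simp add: TH_def)
  have e: "ent (2 - lev (Suc 0))" "ent (5 - lev (Suc 0))" "ent ((2 - lev (Suc 0)) * (5 - lev (Suc 0)))" "ent (lev (Suc 0))"
    by (intro ent_intros)+
  \<comment> \<open>The eigenvalue on level 1 is 6, and 6 (2 - 6) (5 - 6) = 24.\<close>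
  then have "eval_fps (bH 0) lam2 = 24"
    by (simp add: bH_def eval_fps_mult eval_fps_diff eval_lev ev_lam2 ent_def)
  moreover have "ent (bH 0)" using e by (simp add: bH_def ent_intros)
  ultimately show ?thesis
    using phi_H[OF vertex_mem, of 1] eval_vG unfolding H by auto
qed

lemma phi_dlt: "x \<in> V m \<Longrightarrow> x \<notin> V 0 \<Longrightarrow> dlt m (ev lam2 m) phi x = 0"
  unfolding dlt_def using phi_family(2) by simp

lemma phi_eigenfunction: "neumann_eigenfunction q lam2 phi"
proof (rule neumann_eigenfunctionI)
  show "has_laplacian q phi (\<lambda>x. - lam2 * phi x)"
    by (rule eigen_has_laplacian[OF phi_family(1,2)])
  show "phi (q 1) \<noteq> 0" by (rule phi_nonzero)
  fix k
  show "has_normal_deriv q phi k 0"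
  proof (rule dlt_ascend_corner[where l = lam2 and ?m0.0 = "Suc 0"])
    \<comment> \<open>For y = 6 the left-hand side of the descent identity is zero, so the corner
      equation on level 1 follows from the junction equations alone.\<close>
    have "(6 - 6) * dlt 0 (6 * (5 - 6)) phi (q k) = (2 - 6) * (5 - 6) * dlt (Suc 0) 6 phi (q k)"
    proof (rule dlt_descend_exact[OF _ vertex_mem])
      fix x assume "x \<in> V (Suc 0)" "x \<notin> V 0"
      then show "dlt (Suc 0) 6 phi x = 0" using phi_dlt[of x "Suc 0"] by (simp add: ev_lam2 del: sg_vertices.simps)
    qed
    then show "dlt (Suc 0) (ev lam2 (Suc 0)) phi (q k) = 0" by (simp add: ev_lam2)
    fix m assume "m \<ge> Suc 0"
    then show "ev lam2 (Suc m) \<noteq> 2 \<and> ev lam2 (Suc m) \<noteq> 5"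
      using ev_lam2_regular[of "m - 1"] by simp
  qed (rule phi_dlt)
qed simp

lemma lambda2_lam2: "lambda2 q = lam2"
  using lambda2_eq phi_eigenfunction unfolding neumann_spectrum_def by blast

text \<open>The corners of this cell carry the value 0, and its new vertices belong to levels from 2
  on, where the eigenvalue is neither 2 nor 5.\<close>

lemma phi_F0:
  assumes "x \<in> SG q" shows "phi (F 0 x) = 0"
proof -
  have "continuous_on (SG q) (phi \<circ> F 0)"
    by (rule continuous_on_compose[OF continuous_on_F continuous_on_subset[OF phi_family(1)]]) auto
  moreover have "(phi \<circ> F 0) x = 0" if "x \<in> V m" for m x
  proof (rule vertices_zero[where y = "\<lambda>m. ev lam2 (Suc m)" and u = "phi \<circ> F 0" and x = x and m = m])
    show "ev lam2 (Suc (Suc m)) \<noteq> 2" "ev lam2 (Suc (Suc m)) \<noteq> 5" for m by (rule ev_lam2_regular)+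
    show "(phi \<circ> F 0) (q i) = 0" for i by (simp add: phi_zero)
    show "x \<in> V m" by (rule that)
    fix m x assume x: "x \<in> V (Suc m)" "x \<notin> V m"
    show "dlt (Suc m) (ev lam2 (Suc (Suc m))) (phi \<circ> F 0) x = 0"
      using phi_dlt[OF new_vertex_F(2)[OF x], of 0] new_vertex_F(3)[OF x, of 0] vertices_mono[of 0 "Suc m"]
        dlt_Suc_interior[OF x(1) new_vertex_F(1)[OF x], of "ev lam2 (Suc (Suc m))" phi 0]
      by (auto simp del: sg_vertices.simps)
  qed
  ultimately have "(phi \<circ> F 0) x = 0"
    by (rule dense_vertices[OF _ continuous_on_const _ assms])
  then show ?thesis by simp
qed

lemma continuous_on_rho0: "continuous_on A (rho0 q)"
  unfolding rho0_def Let_def divide_inverse by (intro continuous_intros)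

lemma rho0_in_SG:
  assumes "x \<in> SG q" shows "rho0 q x \<in> SG q"
proof -
  have "rho0 q ` closure (\<Union>m. V m) \<subseteq> SG q"
  proof (rule image_closure_subset[OF continuous_on_rho0 compact_imp_closed[OF SG_char(2)]])
    show "rho0 q ` (\<Union>m. V m) \<subseteq> SG q" using rho0_mem_vertices vertices_subset_SG by blast
  qed
  then show ?thesis using assms unfolding SG_char(1)[symmetric] by blast
qed

lemma phi_rho0:
  assumes "x \<in> SG q" shows "phi (rho0 q x) = phi x"
proof -
  have "continuous_on (SG q) (phi \<circ> rho0 q)"
    by (rule continuous_on_compose[OF continuous_on_rho0 continuous_on_subset[OF phi_family(1)]])
      (use rho0_in_SG in blast)
  moreover have "(phi \<circ> rho0 q) x = phi x" if "x \<in> V m" for m x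
  proof -
    have "TG 0 \<circ> refl = TG 0"
    proof
      fix i show "(TG 0 \<circ> refl) i = TG 0 i" using exhaust_3'[of i] by (elim disjE) (simp_all add: TG_def)
    qed
    then show ?thesis using sol_refl[OF that, of 0 "TG 0"] by (simp add: phi_def solA_def)
  qed
  ultimately have "(phi \<circ> rho0 q) x = phi x"
    by (rule dense_vertices[OF _ phi_family(1) _ assms])
  then show ?thesis by simp
qed

text \<open>The error is the tail of \<open>solA\<close> at \<open>lam2\<close>, geometric because
  the common radius R is larger than \<open>lam2\<close>.\<close>

lemma phi_approx: "\<exists>R>lam2. \<exists>C>0. \<forall>x\<in>SG q. \<bar>phi x\<bar> \<le> C \<and>
   (\<forall>n. \<bar>(- lam2) ^ n * coef (TG 0) n x - phi x\<bar> \<le> C * (lam2 / R) ^ n)"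
proof -
  obtain R C where R: "R > lam2" and C: "\<And>x n. x \<in> SG q \<Longrightarrow> \<bar>fps_nth (solA x) n\<bar> * R ^ n \<le> C"
    using solA_bound by blast
  have Rp: "R > 0" using R lam2_pos by simp
  let ?t = "lam2 / R"
  have t: "0 < ?t" "?t < 1" using R Rp lam2_pos by simp_all
  have C0: "0 \<le> C" using C[OF vertex_in_SG[of 0], of 0] by simp
  have tail: "\<bar>phi x - (\<Sum>i<n. fps_nth (solA x) i * lam2 ^ i)\<bar> \<le> C / (1 - ?t) * ?t ^ n" if "x \<in> SG q" for x n
  proof -
    let ?f = "\<lambda>i. fps_nth (solA x) i * lam2 ^ i"
    have b: "norm (?f i) \<le> C * ?t ^ i" for i
    proof -
      have "norm (?f i) = \<bar>fps_nth (solA x) i\<bar> * R ^ i * ?t ^ i"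
        using Rp lam2_pos by (simp add: abs_mult power_divide)
      also have "\<dots> \<le> C * ?t ^ i" using t by (intro mult_right_mono C that) auto
      finally show ?thesis .
    qed
    have sg: "summable (\<lambda>i. C * ?t ^ i)" using t by (intro summable_mult summable_geometric) auto
    have sf: "summable ?f" by (rule summable_comparison_test'[OF sg b])
    have "phi x - (\<Sum>i<n. ?f i) = (\<Sum>i. ?f (i + n))"
      unfolding phi_def eval_fps_def by (subst suminf_minus_initial_segment[OF sf]) simp
    moreover have "norm (\<Sum>i. ?f (i + n)) \<le> (\<Sum>i. C * ?t ^ (i + n))"
      by (rule norm_suminf_le[OF b]) (rule summable_ignore_initial_segment[OF sg])
    moreover have "(\<Sum>i. C * ?t ^ (i + n)) = C / (1 - ?t) * ?t ^ n"
    proof -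
      have "(\<Sum>i. C * ?t ^ (i + n)) = (\<Sum>i. C * ?t ^ n * ?t ^ i)" by (simp only: power_add mult_ac)
      also have "\<dots> = C * ?t ^ n * (1 / (1 - ?t))"
        using t by (subst suminf_mult) (simp_all add: suminf_geometric summable_geometric)
      finally show ?thesis by simp
    qed
    ultimately show ?thesis by simp
  qed
  let ?D = "C / (1 - ?t) + 1"
  have D: "C / (1 - ?t) \<ge> 0" using C0 t by simp
  show ?thesis
  proof (rule exI[of _ R], rule conjI[OF R], rule exI[of _ ?D], intro conjI ballI)
    fix x assume x: "x \<in> SG q"
    show "\<bar>phi x\<bar> \<le> ?D" using tail[OF x, of 0] by simp
    show "\<forall>n. \<bar>(- lam2) ^ n * coef (TG 0) n x - phi x\<bar> \<le> ?D * ?t ^ n"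
    proof
      fix n
      have "\<bar>phi x - (- lam2) ^ n * coef (TG 0) n x\<bar> \<le> C / (1 - ?t) * ?t ^ Suc n"
        using tail[OF x, of "Suc n"] unfolding sum_solA .
      also have "\<dots> \<le> ?D * ?t ^ n"
      proof (rule mult_mono)
        show "?t ^ Suc n \<le> ?t ^ n" using t by (intro power_decreasing) simp_all
        show "0 \<le> ?t ^ Suc n" using t by (intro zero_le_power) simp
      qed (use D in simp_all)
      finally show "\<bar>(- lam2) ^ n * coef (TG 0) n x - phi x\<bar> \<le> ?D * ?t ^ n"
        by (simp only: abs_minus_commute)
    qed
  next
    show "0 < ?D" using D by simp
  qed
qed

section \<open>Convergence in energy\<close>

definition edges :: "nat \<Rightarrow> ((real^2) \<times> (real^2)) set" where
  "edges m = {(x, y). sg_adj q m x y}"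

lemma finite_edges: "finite (edges m)"
  by (rule finite_subset[OF _ finite_cartesian_product[OF finite_vertices[of m] finite_vertices[of m]]])
    (auto simp: edges_def sg_adj_def)

lemma energy_level_edges: "energy_level q m u = (5/3) ^ m * (1/2 * (\<Sum>(x, y)\<in>edges m. (u x - u y)\<^sup>2))"
proof -
  have "edges m = Sigma (V m) (\<lambda>x. {y. sg_adj q m x y})" by (auto simp: edges_def sg_adj_def)
  then show ?thesis
    by (simp add: energy_level_def sum.Sigma finite_vertices)
qed

lemma edges_Suc: "edges (Suc m) = (\<Union>k. map_prod (F k) (F k) ` edges m)"
  unfolding edges_def adj_Suc by (auto simp: image_iff)

text \<open>Two cells have at most one point in common and hence no edge, so energies simply
  add.\<close>

lemma energy_level_Suc: "energy_level q (Suc m) u = 5/3 * (\<Sum>k\<in>UNIV. energy_level q m (u \<circ> F k))"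
proof -
  let ?f = "\<lambda>u (x, y). (u x - u y)\<^sup>2 :: real"
  have "sum (?f u) (edges (Suc m)) = (\<Sum>k\<in>UNIV. sum (?f u) (map_prod (F k) (F k) ` edges m))"
    unfolding edges_Suc
  proof (rule sum.UNION_disjoint)
    show "\<forall>k\<in>UNIV. \<forall>j\<in>UNIV. k \<noteq> j \<longrightarrow> map_prod (F k) (F k) ` edges m \<inter> map_prod (F j) (F j) ` edges m = {}"
    proof (intro ballI impI)
      fix k j :: 3 assume "k \<noteq> j"
      show "map_prod (F k) (F k) ` edges m \<inter> map_prod (F j) (F j) ` edges m = {}"
      proof (rule ccontr)
        assume "\<not> ?thesis"
        then obtain x y x' y' where e: "sg_adj q m x y" "sg_adj q m x' y'" "F k x = F j x'" "F k y = F j y'"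
          unfolding edges_def by auto
        have "x = q j" "y = q j"
          using F_eq_F_imp(1)[of x x' k j] F_eq_F_imp(1)[of y y' k j] adj_mem[OF e(1)] adj_mem[OF e(2)] e(3,4) \<open>k \<noteq> j\<close>
          by blast+
        then show False using adj_mem[OF e(1)] by simp
      qed
    qed
  qed (simp_all add: finite_edges)
  also have "\<dots> = (\<Sum>k\<in>UNIV. sum (?f (u \<circ> F k)) (edges m))"
  proof (rule sum.cong[OF refl])
    fix k
    have "inj_on (map_prod (F k) (F k)) (edges m)" by (auto simp: inj_on_def)
    then show "sum (?f u) (map_prod (F k) (F k) ` edges m) = sum (?f (u \<circ> F k)) (edges m)"
      by (subst sum.reindex) (simp_all add: comp_def case_prod_unfold)
  qed
  finally show ?thesis
    by (simp add: energy_level_edges sum_distrib_left mult_ac)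
qed

lemma energy_level_0: "energy_level q 0 u = (u (q 0) - u (q 1))\<^sup>2 + (u (q 0) - u (q 2))\<^sup>2 + (u (q 1) - u (q 2))\<^sup>2"
proof -
  have a: "{y. sg_adj q 0 (q i) y} = q ` (UNIV - {i})" for i using adj_0 by blast
  have "(\<Sum>x\<in>V 0. \<Sum>y | sg_adj q 0 x y. (u x - u y)\<^sup>2) = (\<Sum>i\<in>UNIV. \<Sum>j\<in>UNIV - {i}. (u (q i) - u (q j))\<^sup>2)"
    by (simp add: sum.reindex inj_on_def a)
  also have "\<dots> = 2 * ((u (q 0) - u (q 1))\<^sup>2 + (u (q 0) - u (q 2))\<^sup>2 + (u (q 1) - u (q 2))\<^sup>2)"
    by (simp add: sum_3' sum_neq_3 power2_commute)
  finally show ?thesis by (simp add: energy_level_def)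
qed

text \<open>
  Splitting off the harmonic extension, with junction values \<open>(2a + 2b + c)/5\<close>, is orthogonal for
  the energy; the deviations from it are determined by the junction Laplacians.
\<close>

lemma energy_cell_identity:
  fixes a b c x y z :: real
  defines "d \<equiv> x - (2 * a + 2 * b + c) / 5" and "e \<equiv> y - (2 * a + 2 * c + b) / 5" and "f \<equiv> z - (2 * b + 2 * c + a) / 5"
  shows "5/3 * (((a - x)\<^sup>2 + (a - y)\<^sup>2 + (x - y)\<^sup>2) + ((x - b)\<^sup>2 + (x - z)\<^sup>2 + (b - z)\<^sup>2) + ((y - z)\<^sup>2 + (y - c)\<^sup>2 + (z - c)\<^sup>2))
    = (a - b)\<^sup>2 + (a - c)\<^sup>2 + (b - c)\<^sup>2 + 5/3 * (2 * (d\<^sup>2 + e\<^sup>2 + f\<^sup>2) + (d - e)\<^sup>2 + (d - f)\<^sup>2 + (e - f)\<^sup>2)"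
  unfolding d_def e_def f_def power2_eq_square by (simp add: field_simps)

text \<open>Summing the hypotheses gives |d + e + f| \<le> 3/2 \<epsilon>, so 5 d = (d + e + f) - (e
  + f - 4 d) is at most 5/2 \<epsilon> in modulus. The differences come from differences of the
  hypotheses.\<close>

lemma junction_bound:
  fixes d e f \<epsilon> :: real
  assumes "\<bar>e + f - 4 * d\<bar> \<le> \<epsilon>" "\<bar>d + f - 4 * e\<bar> \<le> \<epsilon>" "\<bar>d + e - 4 * f\<bar> \<le> \<epsilon>"
  shows "2 * (d\<^sup>2 + e\<^sup>2 + f\<^sup>2) + (d - e)\<^sup>2 + (d - f)\<^sup>2 + (e - f)\<^sup>2 \<le> 9/2 * \<epsilon>\<^sup>2"
proof -
  have "\<bar>d\<bar> \<le> \<epsilon> / 2" "\<bar>e\<bar> \<le> \<epsilon> / 2" "\<bar>f\<bar> \<le> \<epsilon> / 2" "\<bar>d - e\<bar> \<le> \<epsilon>" "\<bar>d - f\<bar> \<le> \<epsilon>" "\<bar>e - f\<bar> \<le> \<epsilon>"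
    using assms by linarith+
  then have "d\<^sup>2 \<le> (\<epsilon> / 2)\<^sup>2" "e\<^sup>2 \<le> (\<epsilon> / 2)\<^sup>2" "f\<^sup>2 \<le> (\<epsilon> / 2)\<^sup>2"
    "(d - e)\<^sup>2 \<le> \<epsilon>\<^sup>2" "(d - f)\<^sup>2 \<le> \<epsilon>\<^sup>2" "(e - f)\<^sup>2 \<le> \<epsilon>\<^sup>2"
    by (simp_all add: abs_le_square_iff[symmetric])
  then show ?thesis by (simp add: power_divide)
qed

lemma energy_level_0_1:
  fixes u :: "real^2 \<Rightarrow> real"
  shows "energy_level q 0 u \<le> energy_level q (Suc 0) u"
    and "(\<And>x. x \<in> V (Suc 0) \<Longrightarrow> x \<notin> V 0 \<Longrightarrow> \<bar>lap (Suc 0) u x\<bar> \<le> \<epsilon>)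
      \<Longrightarrow> energy_level q (Suc 0) u \<le> energy_level q 0 u + 15/2 * \<epsilon>\<^sup>2"
proof -
  define a b c x y z where "a = u (q 0)" and "b = u (q 1)" and "c = u (q 2)"
    and "x = u (F 0 (q 1))" and "y = u (F 0 (q 2))" and "z = u (F 1 (q 2))"
  note defs = a_def[symmetric] b_def[symmetric] c_def[symmetric] x_def[symmetric] y_def[symmetric] z_def[symmetric]
  define d e f where "d = x - (2 * a + 2 * b + c) / 5" and "e = y - (2 * a + 2 * c + b) / 5"
    and "f = z - (2 * b + 2 * c + a) / 5"
  let ?Q = "2 * (d\<^sup>2 + e\<^sup>2 + f\<^sup>2) + (d - e)\<^sup>2 + (d - f)\<^sup>2 + (e - f)\<^sup>2"
  have e0: "energy_level q 0 u = (a - b)\<^sup>2 + (a - c)\<^sup>2 + (b - c)\<^sup>2"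
    unfolding energy_level_0 defs ..
  have "energy_level q (Suc 0) u = 5/3 * (((a - x)\<^sup>2 + (a - y)\<^sup>2 + (x - y)\<^sup>2)
      + ((x - b)\<^sup>2 + (x - z)\<^sup>2 + (b - z)\<^sup>2) + ((y - z)\<^sup>2 + (y - c)\<^sup>2 + (z - c)\<^sup>2))"
    unfolding energy_level_Suc energy_level_0 sum_3' comp_apply F_vertex F_commute defs ..
  then have e1: "energy_level q (Suc 0) u = energy_level q 0 u + 5/3 * ?Q"
    unfolding e0 d_def e_def f_def by (simp only: energy_cell_identity)
  then show "energy_level q 0 u \<le> energy_level q (Suc 0) u" by simp
  assume l: "\<And>x. x \<in> V (Suc 0) \<Longrightarrow> x \<notin> V 0 \<Longrightarrow> \<bar>lap (Suc 0) u x\<bar> \<le> \<epsilon>"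
  have "lap (Suc 0) u (F 0 (q 1)) = e + f - 4 * d" "lap (Suc 0) u (F 0 (q 2)) = d + f - 4 * e"
    "lap (Suc 0) u (F 1 (q 2)) = d + e - 4 * f"
    by (simp_all add: lap_Suc_junction lap_0 sum_neq_3 F_commute defs d_def e_def f_def field_simps)
  then have "?Q \<le> 9/2 * \<epsilon>\<^sup>2"
    using l[OF new_junction[of 0 1]] l[OF new_junction[of 0 2]] l[OF new_junction[of 1 2]]
    by (intro junction_bound) simp_all
  then show "energy_level q (Suc 0) u \<le> energy_level q 0 u + 15/2 * \<epsilon>\<^sup>2" unfolding e1 by simp
qed

lemma energy_level_mono: "energy_level q m u \<le> energy_level q (Suc m) u"
proof (induction m arbitrary: u)
  case (Suc m)
  then show ?case unfolding energy_level_Suc[of "Suc m"] energy_level_Suc[of m]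
    by (intro mult_left_mono sum_mono) simp_all
qed (rule energy_level_0_1)

text \<open>Each of the 3^m cells gains at most 15/2 \<epsilon>^2, and the renormalisation (5/3)^m
  turns 3^m into 5^m.\<close>

lemma energy_level_step:
  fixes u :: "real^2 \<Rightarrow> real"
  assumes "\<And>x. x \<in> V (Suc m) \<Longrightarrow> x \<notin> V m \<Longrightarrow> \<bar>lap (Suc m) u x\<bar> \<le> \<epsilon>"
  shows "energy_level q (Suc m) u \<le> energy_level q m u + 15/2 * 5 ^ m * \<epsilon>\<^sup>2"
  using assms
proof (induction m arbitrary: u)
  case 0
  then show ?case using energy_level_0_1(2)[of u \<epsilon>] by simp
next
  case (Suc m)
  have "energy_level q (Suc m) (u \<circ> F k) \<le> energy_level q m (u \<circ> F k) + 15/2 * 5 ^ m * \<epsilon>\<^sup>2" for k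
  proof (rule Suc.IH)
    fix x assume x: "x \<in> V (Suc m)" "x \<notin> V m"
    show "\<bar>lap (Suc m) (u \<circ> F k) x\<bar> \<le> \<epsilon>"
      using Suc.prems[OF new_vertex_F(2,3)[OF x, of k]]
      unfolding lap_Suc_interior[OF x(1) new_vertex_F(1)[OF x]] .
  qed
  then have "(\<Sum>k\<in>UNIV. energy_level q (Suc m) (u \<circ> F k))
      \<le> (\<Sum>k\<in>UNIV. energy_level q m (u \<circ> F k) + 15/2 * 5 ^ m * \<epsilon>\<^sup>2)" by (intro sum_mono)
  also have "\<dots> = (\<Sum>k\<in>UNIV. energy_level q m (u \<circ> F k)) + 3 * (15/2 * 5 ^ m * \<epsilon>\<^sup>2)"
    by (simp add: sum.distrib)
  finally show ?case unfolding energy_level_Suc[of "Suc m"] energy_level_Suc[of m] by simp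
qed

text \<open>With Laplacians of size \<eta> / 5^m the gains form a geometric series of sum 3/8
  \<eta>^2. Keeping its remainder in the estimate closes the induction.\<close>

lemma energy_level_bound:
  fixes u :: "real^2 \<Rightarrow> real"
  assumes "\<And>m x. x \<in> V (Suc m) \<Longrightarrow> x \<notin> V 0 \<Longrightarrow> 5 ^ Suc m * \<bar>lap (Suc m) u x\<bar> \<le> \<eta>"
  shows "energy_level q m u \<le> energy_level q 0 u + \<eta>\<^sup>2"
proof -
  have "energy_level q m u \<le> energy_level q 0 u + 3/8 * \<eta>\<^sup>2 * (1 - (1/5) ^ m)"
  proof (induction m)
    case (Suc m)
    have "energy_level q (Suc m) u \<le> energy_level q m u + 15/2 * 5 ^ m * (\<eta> / 5 ^ Suc m)\<^sup>2"
    proof (rule energy_level_step)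
      fix x assume x: "x \<in> V (Suc m)" "x \<notin> V m"
      then have "x \<notin> V 0" using vertices_mono[of 0 m] by blast
      then show "\<bar>lap (Suc m) u x\<bar> \<le> \<eta> / 5 ^ Suc m"
        using assms[OF x(1)] by (simp add: field_simps del: sg_vertices.simps)
    qed
    also have "15/2 * 5 ^ m * (\<eta> / 5 ^ Suc m)\<^sup>2 = 3/10 * \<eta>\<^sup>2 * (1/5) ^ m"
      by (simp add: power2_eq_square power_divide field_simps)
    finally have "energy_level q (Suc m) u \<le> energy_level q m u + 3/10 * \<eta>\<^sup>2 * (1/5) ^ m" .
    moreover have "3/8 * \<eta>\<^sup>2 * (1 - (1/5) ^ m) + 3/10 * \<eta>\<^sup>2 * (1/5) ^ m = 3/8 * \<eta>\<^sup>2 * (1 - (1/5) ^ Suc m)"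
      by (simp add: field_simps)
    ultimately show ?case using Suc.IH by linarith
  qed simp
  also have "\<dots> \<le> energy_level q 0 u + \<eta>\<^sup>2"
  proof -
    have "3/8 * P * (1 - z) \<le> P" if "0 \<le> P" "0 \<le> z" for P z :: real
    proof -
      have "3/8 * P * (1 - z) \<le> 3/8 * P * 1" using that by (intro mult_left_mono) simp_all
      then show ?thesis using that(1) by linarith
    qed
    from this[of "\<eta>\<^sup>2" "(1/5) ^ m"] show ?thesis by simp
  qed
  finally show ?thesis .
qed

text \<open>The constant is 13 = 3 * 4 + 1: three edges of the triangle with differences at most 2
  \<eta>, and the gain \<eta>^2.\<close>

lemma energy_bound:
  fixes u :: "real^2 \<Rightarrow> real"
  assumes "\<And>m x. x \<in> V (Suc m) \<Longrightarrow> x \<notin> V 0 \<Longrightarrow> 5 ^ Suc m * \<bar>lap (Suc m) u x\<bar> \<le> \<eta>"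
    and "\<And>i. \<bar>u (q i)\<bar> \<le> \<eta>"
  shows "0 \<le> energy q u" "energy q u \<le> ereal (13 * \<eta>\<^sup>2)"
proof -
  have "energy_level q 0 u \<le> (2 * \<eta>)\<^sup>2 + (2 * \<eta>)\<^sup>2 + (2 * \<eta>)\<^sup>2"
  proof -
    have "\<bar>u (q i) - u (q j)\<bar> \<le> \<bar>2 * \<eta>\<bar>" for i j using assms(2)[of i] assms(2)[of j] by linarith
    then show ?thesis unfolding energy_level_0 by (intro add_mono) (simp_all only: abs_le_square_iff)
  qed
  then have b: "ereal (energy_level q m u) \<le> ereal (13 * \<eta>\<^sup>2)" for m
    using energy_level_bound[OF assms(1), of m] by (simp add: power_mult_distrib)
  have n: "0 \<le> ereal (energy_level q m u)" for m
    by (simp add: energy_level_def sum_nonneg)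
  have "incseq (\<lambda>m. ereal (energy_level q m u))"
    by (rule incseq_SucI) (simp add: energy_level_mono)
  then have l: "(\<lambda>m. ereal (energy_level q m u)) \<longlonglongrightarrow> energy q u"
    unfolding energy_def using LIMSEQ_SUP limI by metis
  show "0 \<le> energy q u" by (rule LIMSEQ_le_const[OF l]) (use n in blast)
  show "energy q u \<le> ereal (13 * \<eta>\<^sup>2)" by (rule LIMSEQ_le_const2[OF l]) (use b in blast)
qed

text \<open>The discrete equations express the Laplacian of the error by the errors at the indices n
  - i, weighted with the coefficients of \<open>lev m\<close> times lam2^i. Such an error is larger
  than that at n by (R / lam2)^i, which turns lam2^i into R^i; the entire series
  \<open>lev m\<close> converges there too, with a sum of order 5^-m.\<close>

lemma coef_TG_lap:
  assumes R: "R > lam2" and C: "\<And>x. x \<in> SG q \<Longrightarrow> \<bar>phi x\<bar> \<le> C"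
    and a: "\<And>x n. x \<in> SG q \<Longrightarrow> \<bar>(- lam2) ^ n * coef (TG 0) n x - phi x\<bar> \<le> C * (lam2 / R) ^ n"
    and x: "x \<in> V m" "x \<notin> V 0"
  shows "5 ^ m * \<bar>lap m (\<lambda>x. (- lam2) ^ n * coef (TG 0) n x - phi x) x\<bar>
     \<le> C * (lam2 / R) ^ n * (\<Sum>i. \<bar>psi_coeff i\<bar> * (2 / 3 * R) ^ i)"
proof -
  let ?t = "lam2 / R" and ?U = "\<lambda>n x. (- lam2) ^ n * coef (TG 0) n x"
  let ?l = "\<lambda>i. fps_nth (lev m) i * lam2 ^ i"
  have Rp: "R > 0" using R lam2_pos by simp
  have t: "0 < ?t" "?t \<le> 1" using R Rp lam2_pos by simp_all
  have xS: "x \<in> SG q" using x vertices_subset_SG by blast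
  have C0: "0 \<le> C" using C[OF xS] by linarith
  have U: "?U n x = lam2 ^ n * fps_nth (sol 0 (TG 0) x) n" for n x
    by (simp add: coef_def flip: mult.assoc power_mult_distrib)
  have "lap m (?U n) x = lam2 ^ n * lap m (\<lambda>x. fps_nth (sol 0 (TG 0) x) n) x"
    unfolding U by (simp add: lap_def sum_distrib_left right_diff_distrib)
  also have "\<dots> = - (\<Sum>i\<le>n. ?l i * ?U (n - i) x)"
  proof -
    have "lam2 ^ n * (fps_nth (lev m) i * g) = ?l i * (lam2 ^ (n - i) * g)" if "i \<le> n" for i g
      using power_add[of lam2 i "n - i"] that by simp
    then show ?thesis
      unfolding lap_coef[OF x] U mult_minus_right sum_distrib_left by (intro arg_cong[where f = uminus] sum.cong refl) simp
  qed
  finally have lU: "lap m (?U n) x = - (\<Sum>i\<le>n. ?l i * ?U (n - i) x)" .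
  \<comment> \<open>For i > n no monomial is left and w is - phi, whose bound C is below C t^n (1 /
    t)^i.\<close>
  define w where "w i = (if i \<le> n then ?U (n - i) x else 0) - phi x" for i
  have "ent (lev m)" by (rule ent_lev)
  then have "?l sums ev lam2 m"
    unfolding eval_lev[symmetric] eval_fps_def ent_def by (intro summable_sums summable_fps) simp
  then have "(\<lambda>i. ?l i * phi x) sums (ev lam2 m * phi x)" by (rule sums_mult2)
  moreover have "(\<lambda>i. ?l i * (if i \<le> n then ?U (n - i) x else 0)) sums (\<Sum>i\<le>n. ?l i * ?U (n - i) x)"
    using sums_If_finite_set[of "{..n}" "\<lambda>i. ?l i * ?U (n - i) x"] by (simp add: if_distrib cong: if_cong)
  ultimately have "(\<lambda>i. ?l i * w i) sums ((\<Sum>i\<le>n. ?l i * ?U (n - i) x) - ev lam2 m * phi x)"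
    unfolding w_def right_diff_distrib by (rule sums_diff[rotated])
  moreover have "lap m (\<lambda>x. ?U n x - phi x) x = lap m (?U n) x - lap m phi x"
    using lap_lincomb[of m 1 "?U n" "-1" phi x] by simp
  ultimately have s: "(\<lambda>i. ?l i * w i) sums - lap m (\<lambda>x. ?U n x - phi x) x"
    using phi_family(2)[OF x] by (simp only: lU) simp
  have w: "\<bar>w i\<bar> \<le> C * ?t ^ n * (1 / ?t) ^ i" for i
  proof (cases "i \<le> n")
    case True
    have "z ^ n * (1 / z) ^ i = z ^ (n - i)" if "z > 0" for z :: real
      using that True by (simp add: power_diff power_divide)
    then have "?t ^ n * (1 / ?t) ^ i = ?t ^ (n - i)" using t by blast
    then show ?thesis using a[OF xS, of "n - i"] True by (simp add: w_def mult.assoc)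
  next
    case False
    have "z ^ n * (1 / z) ^ i = (1 / z) ^ (i - n)" if "z > 0" for z :: real
      using that False by (simp add: power_diff power_divide)
    then have "?t ^ n * (1 / ?t) ^ i = (1 / ?t) ^ (i - n)" using t by blast
    moreover have "1 \<le> (1 / ?t) ^ (i - n)" using R lam2_pos by (intro one_le_power) simp
    ultimately have "C * 1 \<le> C * (?t ^ n * (1 / ?t) ^ i)" using C0 by (intro mult_left_mono) simp_all
    then show ?thesis using C[OF xS] False by (simp add: w_def mult.assoc)
  qed
  let ?p = "\<lambda>i. \<bar>psi_coeff i\<bar> * (2 / 3 * R) ^ i"
  have sp: "summable ?p" using Rp by (intro psi_summable) simp
  have g: "norm (?l i * w i) \<le> C * ?t ^ n / 5 ^ m * ?p i" for i
  proof -
    have "norm (?l i * w i) = \<bar>fps_nth (lev m) i\<bar> * lam2 ^ i * \<bar>w i\<bar>"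
      using lam2_pos by (simp add: abs_mult)
    also have "\<dots> \<le> \<bar>fps_nth (lev m) i\<bar> * lam2 ^ i * (C * ?t ^ n * (1 / ?t) ^ i)"
      using lam2_pos by (intro mult_left_mono w) simp
    also have "\<dots> = C * ?t ^ n * (\<bar>fps_nth (lev m) i\<bar> * R ^ i)"
      using lam2_pos by (simp add: power_divide)
    also have "\<dots> \<le> C * ?t ^ n * (?p i / 5 ^ m)"
      using Rp t C0 by (intro mult_left_mono lev_nth_le) simp_all
    finally show ?thesis by simp
  qed
  have "\<bar>lap m (\<lambda>x. ?U n x - phi x) x\<bar> = norm (\<Sum>i. ?l i * w i)"
    using sums_unique[OF s] by simp
  also have "\<dots> \<le> (\<Sum>i. C * ?t ^ n / 5 ^ m * ?p i)"
    by (rule norm_suminf_le[OF g summable_mult[OF sp]])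
  also have "\<dots> = C * ?t ^ n / 5 ^ m * (\<Sum>i. ?p i)" by (rule suminf_mult[OF sp])
  finally have "5 ^ m * \<bar>lap m (\<lambda>x. ?U n x - phi x) x\<bar> \<le> 5 ^ m * (C * ?t ^ n / 5 ^ m * (\<Sum>i. ?p i))"
    by (rule mult_left_mono) simp
  also have "\<dots> = C * ?t ^ n * (\<Sum>i. ?p i)" by simp
  finally show ?thesis .
qed

lemma abs_le_sup_norm_bound: "(\<And>x. x \<in> SG q \<Longrightarrow> \<bar>u x\<bar> \<le> C) \<Longrightarrow> sup_norm q u \<le> C"
  unfolding sup_norm_def using vertex_in_SG by (intro cSUP_least) blast+

lemma part_b_limits:
  "uniform_limit (SG q) (\<lambda>j x. (- lam2) ^ j * coef (TG 0) j x) phi sequentially"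
  "converges_in_energy q (\<lambda>j x. (- lam2) ^ j * coef (TG 0) j x) phi"
  "\<exists>c. \<forall>j. sup_norm q (coef (TG 0) j) \<le> c * lam2 powi (- int j)"
proof -
  obtain R C where R: "R > lam2" and C: "C > 0" "\<And>x. x \<in> SG q \<Longrightarrow> \<bar>phi x\<bar> \<le> C"
    and a: "\<And>x n. x \<in> SG q \<Longrightarrow> \<bar>(- lam2) ^ n * coef (TG 0) n x - phi x\<bar> \<le> C * (lam2 / R) ^ n"
    using phi_approx by blast
  have Rp: "R > 0" using R lam2_pos by simp
  let ?t = "lam2 / R" and ?U = "\<lambda>n x. (- lam2) ^ n * coef (TG 0) n x"
  have t: "0 < ?t" "?t < 1" using R Rp lam2_pos by simp_all
  have lim: "(\<lambda>n. c * ?t ^ n) \<longlonglongrightarrow> 0" for c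
    using t by (intro tendsto_mult_right_zero LIMSEQ_power_zero) simp
  show "uniform_limit (SG q) ?U phi sequentially"
  proof (rule uniform_limitI)
    fix e :: real assume "e > 0"
    then have "\<forall>\<^sub>F n in sequentially. C * ?t ^ n < e" using order_tendstoD(2)[OF lim] by blast
    then show "\<forall>\<^sub>F n in sequentially. \<forall>x\<in>SG q. dist (?U n x) (phi x) < e"
    proof eventually_elim
      case (elim n)
      then show ?case using a unfolding dist_real_def by (blast intro: le_less_trans)
    qed
  qed
  \<comment> \<open>The added 1 lets S cover the bound at the corners as well.\<close>
  define S where "S = 1 + (\<Sum>i. \<bar>psi_coeff i\<bar> * (2 / 3 * R) ^ i)"
  have S: "S \<ge> 1" unfolding S_def using Rp by (simp add: suminf_nonneg[OF psi_summable])
  have E: "0 \<le> energy q (\<lambda>x. ?U n x - phi x)" "energy q (\<lambda>x. ?U n x - phi x) \<le> ereal (13 * (C * S * ?t ^ n)\<^sup>2)" for n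
  proof -
    have 1: "5 ^ Suc m * \<bar>lap (Suc m) (\<lambda>x. ?U n x - phi x) x\<bar> \<le> C * S * ?t ^ n"
      if "x \<in> V (Suc m)" "x \<notin> V 0" for m x
    proof -
      have "C * ?t ^ n * (S - 1) \<le> C * ?t ^ n * S" using C(1) t by (intro mult_left_mono) simp_all
      then show ?thesis using coef_TG_lap[OF R C(2) a that, of n] by (simp add: S_def mult_ac)
    qed
    have 2: "\<bar>?U n (q i) - phi (q i)\<bar> \<le> C * S * ?t ^ n" for i
    proof -
      have "C * ?t ^ n * 1 \<le> C * ?t ^ n * S" using C(1) t S by (intro mult_left_mono) simp_all
      then show ?thesis using a[OF vertex_in_SG[of i], of n] by (simp add: mult_ac)
    qed
    show "0 \<le> energy q (\<lambda>x. ?U n x - phi x)" "energy q (\<lambda>x. ?U n x - phi x) \<le> ereal (13 * (C * S * ?t ^ n)\<^sup>2)"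
      by (rule energy_bound[OF 1 2]; assumption)+
  qed
  have "(\<lambda>n. 13 * (C * S * ?t ^ n)\<^sup>2) \<longlonglongrightarrow> 13 * 0\<^sup>2" by (intro tendsto_intros lim)
  then have "(\<lambda>n. ereal (13 * (C * S * ?t ^ n)\<^sup>2)) \<longlonglongrightarrow> 0" by (simp add: zero_ereal_def)
  then show "converges_in_energy q ?U phi"
    unfolding converges_in_energy_def
    by (rule tendsto_sandwich[OF always_eventually always_eventually tendsto_const, rotated -1]) (use E in blast)+
  show "\<exists>c. \<forall>j. sup_norm q (coef (TG 0) j) \<le> c * lam2 powi (- int j)"
  proof (intro exI[of _ "2 * C"] allI abs_le_sup_norm_bound)
    fix j x assume x: "x \<in> SG q"
    have "C * ?t ^ j \<le> C * 1" using C(1) t by (intro mult_left_mono power_le_one) simp_all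
    then have "\<bar>?U j x\<bar> \<le> 2 * C" using a[OF x, of j] C(2)[OF x] by linarith
    moreover have "\<bar>?U j x\<bar> = lam2 ^ j * \<bar>coef (TG 0) j x\<bar>" using lam2_pos by (simp add: abs_mult power_abs)
    ultimately show "\<bar>coef (TG 0) j x\<bar> \<le> 2 * C * lam2 powi (- int j)"
      using lam2_pos by (simp add: power_int_minus field_simps)
  qed
qed

lemma coef_T1_bound:
  assumes "r > 0"
  shows "\<exists>c>0. \<forall>j. sup_norm q (coef (T1 0) j) \<le> c / r ^ j"
proof -
  obtain C where C: "\<And>x j. x \<in> SG q \<Longrightarrow> \<bar>fps_nth (sol 0 (T1 0) x) j\<bar> * r ^ j \<le> C"
    using sol_coeff_bound[OF assms sol_nrm_bound[OF less_imp_le[OF assms] regular_T1]] by blast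
  have "0 \<le> C" using C[OF vertex_in_SG[of 0], of 0] by simp
  moreover have "sup_norm q (coef (T1 0) j) \<le> (C + 1) / r ^ j" for j
  proof (rule abs_le_sup_norm_bound)
    fix x assume "x \<in> SG q"
    then have "\<bar>coef (T1 0) j x\<bar> * r ^ j \<le> C + 1" using C[of x j] by (simp add: coef_def abs_mult power_abs)
    then show "\<bar>coef (T1 0) j x\<bar> \<le> (C + 1) / r ^ j" using assms by (simp add: field_simps)
  qed
  ultimately show ?thesis by (intro exI[of _ "C + 1"]) auto
qed

text \<open>A vanishing function has a vanishing Laplacian, and the Laplacian leads down to index 0,
  with value 1 at \<open>q 0\<close>. The norms are therefore positive, as monotonicity of the
  logarithm requires.\<close>

lemma coef_T1_nonzero: "\<exists>x\<in>SG q. coef (T1 0) j x \<noteq> 0"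
proof (induction j)
  case 0
  have "coef (T1 0) 0 (q 0) = 1" by (simp add: coef_def T1_def)
  then show ?case by (intro bexI[of _ "q 0"]) simp_all
next
  case (Suc j)
  show ?case
  proof (rule ccontr)
    assume "\<not> ?thesis"
    then have z: "\<And>x. x \<in> SG q \<Longrightarrow> coef (T1 0) (Suc j) x = 0 * coef (T1 0) 0 x" by simp
    have "has_laplacian q (\<lambda>x. 0 * coef (T1 0) 0 x) (\<lambda>x. 0 * 0)"
      by (rule has_laplacian_cmult[OF coef_has_laplacian(1)])
    then have "coef (T1 0) j x = 0" if "x \<in> SG q" for x
      using has_laplacian_unique[OF has_laplacian_cong[OF coef_has_laplacian(2) z refl] _ that] by simp
    then show False using Suc.IH by blast
  qed
qed

lemma sup_norm_coef_T1_pos: "sup_norm q (coef (T1 0) j) > 0"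
proof -
  obtain x where x: "x \<in> SG q" "coef (T1 0) j x \<noteq> 0" using coef_T1_nonzero by blast
  have "continuous_on (SG q) (coef (T1 0) j)"
    unfolding coef_def by (intro continuous_on_mult continuous_on_const continuous_on_sol)
  then obtain B where "\<And>x. x \<in> SG q \<Longrightarrow> \<bar>coef (T1 0) j x\<bar> \<le> B" using bounded_on_SG by blast
  then have "bdd_above ((\<lambda>x. \<bar>coef (T1 0) j x\<bar>) ` SG q)" by (intro bdd_aboveI2) blast
  then have "\<bar>coef (T1 0) j x\<bar> \<le> sup_norm q (coef (T1 0) j)"
    unfolding sup_norm_def by (rule cSUP_upper[OF x(1)])
  then show ?thesis using x(2) by simp
qed

lemma ln_coef_T1: "filterlim (\<lambda>j. 1 / real j * ln (sup_norm q (coef (T1 0) j))) at_bot sequentially"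
  unfolding filterlim_at_bot
proof
  fix Z :: real
  \<comment> \<open>The choice r = exp (1 - Z) gives the bound ln c - j (1 - Z), with a spare j that
    outweighs ln c.\<close>
  obtain c where c: "c > 0" "\<And>j. sup_norm q (coef (T1 0) j) \<le> c / exp (1 - Z) ^ j"
    using coef_T1_bound[of "exp (1 - Z)"] by auto
  have "\<forall>\<^sub>F j in sequentially. j > 0 \<and> real j \<ge> ln c"
    using eventually_gt_at_top[of 0] eventually_ge_at_top[of "nat \<lceil>ln c\<rceil>"]
    by eventually_elim linarith
  then show "\<forall>\<^sub>F j in sequentially. 1 / real j * ln (sup_norm q (coef (T1 0) j)) \<le> Z"
  proof eventually_elim
    case (elim j)
    have "ln (sup_norm q (coef (T1 0) j)) \<le> ln (c / exp (1 - Z) ^ j)"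
      using c sup_norm_coef_T1_pos[of j] by (subst ln_le_cancel_iff) simp_all
    also have "\<dots> = ln c - real j * (1 - Z)"
      using c(1) by (simp add: ln_div ln_realpow)
    also have "\<dots> \<le> Z * real j" using elim by (simp add: algebra_simps)
    finally show ?case using elim by (simp add: field_simps)
  qed
qed

end

theorem theorem2p9:
  fixes q :: "3 \<Rightarrow> real^2"
  assumes "equilateral q"
  shows
    "(\<forall>r>0. \<exists>c. \<forall>j. sup_norm q (monomial q j 1) \<le> c * r powi (- int j)) \<and>
     filterlim (\<lambda>j. 1 / real j * ln (sup_norm q (monomial q j 1))) at_bot sequentially \<and>
     (\<exists>c. \<forall>j. sup_norm q (monomial q j 2) \<le> c * lambda2 q powi (- int j)) \<and>
     (\<exists>\<phi>. neumann_eigenfunction q (lambda2 q) \<phi> \<and>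
          (\<forall>x\<in>SG q. \<phi> (rho0 q x) = \<phi> x) \<and>
          (\<forall>x\<in>sg_map q 0 ` SG q. \<phi> x = 0) \<and>
          uniform_limit (SG q) (\<lambda>j x. (- lambda2 q) ^ j * monomial q j 2 x) \<phi> sequentially \<and>
          converges_in_energy q (\<lambda>j x. (- lambda2 q) ^ j * monomial q j 2 x) \<phi>)"
proof -
  interpret gasket q by (rule gasket.intro[OF assms])
  have "\<exists>c. \<forall>j. sup_norm q (coef (T1 0) j) \<le> c * r powi (- int j)" if "r > 0" for r
    using coef_T1_bound[OF that] by (auto simp: power_int_minus divide_inverse)
  then show ?thesis
    unfolding monomial_1 monomial_2 lambda2_lam2
    using ln_coef_T1 part_b_limits phi_eigenfunction phi_rho0 phi_F0 by (intro conjI exI[of _ phi]) blast+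
qed

end
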